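(* Let $T$ be a complete first-order theory. If $T$ has the strong witnessing property and Conant-independence is symmetric in $T$, then $T$ is either $\mathrm{NSOP}_1$ or $\mathrm{SOP}_3$.
   Context: Work in a monster model $\mathbb{M}$. A global type $p$ is $M$-invariant if membership of $\varphi(x,b)$ depends only on $\mathrm{tp}(b/M)$; an invariant Morley sequence over $M$ in $p$ is $(b_i)_{i\in I}$ with $b_i\models p|_{Mb_{<i}}$. Kim-dividing order: for $M$-invariant global $p,q$ with common restriction $r$ to $M$, $p\geq q$ if for every $\varphi(x,b)$ with $b\models r$, if Morley sequences in $q$ starting with $b$ make $\{\varphi(x,b_i)\}$ inconsistent then so do Morley sequences in $p$. An $M$-invariant type is least if it is $\leq$ all $M$-invariant global types with the same restriction to $M$. Strong witnessing property: for every small $M\prec\mathbb{M}$ there is a global type $\mathbb{P}(\mathbb{X})$ extending $\mathrm{tp}(\mathbb{M}/M)$ (in variables $\mathbb{X}$ indexed by the elements of $\mathbb{M}$) such that for every small subtuple $x\subseteq\mathbb{X}$, the restriction $\mathbb{P}(\mathbb{X})|_x$ is least in the Kim-dividing order among $M$-invariant global extensions of $(\mathbb{P}(\mathbb{X})|_x)|_M$. Conant-independence: $\varphi(x,b)$ Conant-divides over $M$ if for every invariant Morley sequence $(b_i)_{i<\omega}$ over $M$ with $b_0=b$, $\{\varphi(x,b_i)\}$ is inconsistent; it Conant-forks if it implies a finite disjunction of Conant-dividing formulas; $a\perp^{K^*}_M b$ iff $\mathrm{tp}(a/Mb)$ contains no Conant-forking formula over $M$. Symmetric means $a\perp^{K^*}_M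 b \iff b\perp^{K^*}_M a$ for all models $M$. $\mathrm{SOP}_1$: there are $\varphi(x,y)$ and $(b_\eta)_{\eta\in 2^{<\omega}}$ with $\{\varphi(x,b_{\sigma|n})\}_n$ consistent for each $\sigma\in 2^\omega$, and $\{\varphi(x,b_{\eta_2}),\varphi(x,b_{\eta_1\frown\langle1\rangle})\}$ inconsistent whenever $\eta_2\unrhd\eta_1\frown\langle0\rangle$; $\mathrm{NSOP}_1$ is its negation. $\mathrm{SOP}_3$: there is a definable relation $R(x_1,x_2)$ with no $3$-cycles and a sequence $(a_i)_{i<\omega}$ with $R(a_i,a_j)$ for all $i<j$. *)

theory Defs
  imports Main "HOL-Library.Sublist"
begin

unbundle cardinal_syntax

section \<open>First-order logic\<close>

text \<open>
  A symbol is a name together with an arity. Bound variables are de Bruijn indices; the type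
  \<open>'v\<close> of free variables is arbitrary, so that one datatype covers formulas in tuples of variables
  of any index type as well as formulas with parameters: a formula over \<open>'i + 'm\<close> has variables
  \<open>Inl i\<close> and parameters \<open>Inr m\<close>.
\<close>

record ('f, 'r) lang =
  funs :: "('f \<times> nat) set"
  rels :: "('r \<times> nat) set"

datatype (dead 'f, fv_tm: 'v) tm =
    Free 'v
  | Bound nat
  | Fn 'f "('f, 'v) tm list"
  for map: map_tm

datatype (dead 'f, dead 'r, fv: 'v) fm =
    Eq "('f, 'v) tm" "('f, 'v) tm"
  | Rel 'r "('f, 'v) tm list"
  | Neg "('f, 'r, 'v) fm"
  | Conj "('f, 'r, 'v) fm" "('f, 'r, 'v) fm"
  | Forall "('f, 'r, 'v) fm"
  for map: map_fm

fun wf_tm :: "('f, 'r) lang \<Rightarrow> nat \<Rightarrow> ('f, 'v) tm \<Rightarrow> bool" where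
  "wf_tm L k (Free v) \<longleftrightarrow> True"
| "wf_tm L k (Bound i) \<longleftrightarrow> i < k"
| "wf_tm L k (Fn f ts) \<longleftrightarrow> (f, length ts) \<in> funs L \<and> (\<forall>t\<in>set ts. wf_tm L k t)"

fun wf_fm :: "('f, 'r) lang \<Rightarrow> nat \<Rightarrow> ('f, 'r, 'v) fm \<Rightarrow> bool" where
  "wf_fm L k (Eq s t) \<longleftrightarrow> wf_tm L k s \<and> wf_tm L k t"
| "wf_fm L k (Rel r ts) \<longleftrightarrow> (r, length ts) \<in> rels L \<and> (\<forall>t\<in>set ts. wf_tm L k t)"
| "wf_fm L k (Neg \<phi>) \<longleftrightarrow> wf_fm L k \<phi>"
| "wf_fm L k (Conj \<phi> \<psi>) \<longleftrightarrow> wf_fm L k \<phi> \<and> wf_fm L k \<psi>"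
| "wf_fm L k (Forall \<phi>) \<longleftrightarrow> wf_fm L (Suc k) \<phi>"

definition fms :: "('f, 'r) lang \<Rightarrow> 'v set \<Rightarrow> ('f, 'r, 'v) fm set" where
  "fms L X = {\<phi>. wf_fm L 0 \<phi> \<and> fv \<phi> \<subseteq> X}"

record ('f, 'r, 'm) interp =
  fun_of :: "'f \<Rightarrow> 'm list \<Rightarrow> 'm"
  rel_of :: "'r \<Rightarrow> 'm list \<Rightarrow> bool"

fun val :: "('f, 'r, 'm) interp \<Rightarrow> ('v \<Rightarrow> 'm) \<Rightarrow> 'm list \<Rightarrow> ('f, 'v) tm \<Rightarrow> 'm" where
  "val S e \<rho> (Free v) = e v"
| "val S e \<rho> (Bound i) = \<rho> ! i"
| "val S e \<rho> (Fn f ts) = fun_of S f (map (val S e \<rho>) ts)"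

text \<open>Satisfaction in the structure with universe \<open>D\<close> and the interpretation of \<open>S\<close>.\<close>

fun sat :: "'m set \<Rightarrow> ('f, 'r, 'm) interp \<Rightarrow> ('v \<Rightarrow> 'm) \<Rightarrow> 'm list \<Rightarrow> ('f, 'r, 'v) fm \<Rightarrow> bool" where
  "sat D S e \<rho> (Eq s t) \<longleftrightarrow> val S e \<rho> s = val S e \<rho> t"
| "sat D S e \<rho> (Rel r ts) \<longleftrightarrow> rel_of S r (map (val S e \<rho>) ts)"
| "sat D S e \<rho> (Neg \<phi>) \<longleftrightarrow> \<not> sat D S e \<rho> \<phi>"
| "sat D S e \<rho> (Conj \<phi> \<psi>) \<longleftrightarrow> sat D S e \<rho> \<phi> \<and> sat D S e \<rho> \<psi>"
| "sat D S e \<rho> (Forall \<phi>) \<longleftrightarrow> (\<forall>d\<in>D. sat D S e (d # \<rho>) \<phi>)"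

text \<open>The ambient structure always has a whole type as its universe.\<close>

abbreviation holds :: "('f, 'r, 'm) interp \<Rightarrow> ('v \<Rightarrow> 'm) \<Rightarrow> ('f, 'r, 'v) fm \<Rightarrow> bool" where
  "holds S e \<phi> \<equiv> sat UNIV S e [] \<phi>"

text \<open>Theories are taken deductively closed, so a complete theory contains each sentence or its
  negation; consistency is not included here, as it follows from having a model.\<close>

definition complete_theory :: "('f, 'r) lang \<Rightarrow> ('f, 'r, nat) fm set \<Rightarrow> bool" where
  "complete_theory L T \<longleftrightarrow> T \<subseteq> fms L {} \<and> (\<forall>\<phi>\<in>fms L {}. \<phi> \<in> T \<or> Neg \<phi> \<in> T)"

definition models :: "('f, 'r, 'm) interp \<Rightarrow> ('f, 'r, nat) fm set \<Rightarrow> bool" where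
  "models S T \<longleftrightarrow> (\<forall>\<phi>\<in>T. \<forall>e. holds S e \<phi>)"

text \<open>In the last clause, the formulas over \<open>M\<close> are the sentences with parameters in \<open>M\<close>.\<close>

definition elem_sub :: "('f, 'r) lang \<Rightarrow> ('f, 'r, 'm) interp \<Rightarrow> 'm set \<Rightarrow> bool" where
  "elem_sub L S M \<longleftrightarrow> M \<noteq> {}
     \<and> (\<forall>(f, n)\<in>funs L. \<forall>xs. length xs = n \<and> set xs \<subseteq> M \<longrightarrow> fun_of S f xs \<in> M)
     \<and> (\<forall>\<phi>\<in>fms L M. sat M S id [] \<phi> \<longleftrightarrow> holds S id \<phi>)"


section \<open>Types and monster models\<close>

text \<open>
  A tuple of variables is a set \<open>V\<close> of indices, and a tuple of elements indexed by \<open>V\<close> is a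
  function used only on \<open>V\<close>. The operator \<open>inst\<close> turns \<open>\<phi>(x,y)\<close> into \<open>\<phi>(x,b)\<close>.
\<close>

definition inst :: "('j \<Rightarrow> 'm) \<Rightarrow> ('f, 'r, 'i + 'j) fm \<Rightarrow> ('f, 'r, 'i + 'm) fm" where
  "inst b \<phi> = map_fm (map_sum id b) \<phi>"

definition realizes :: "('f, 'r, 'm) interp \<Rightarrow> ('i \<Rightarrow> 'm) \<Rightarrow> ('f, 'r, 'i + 'm) fm set \<Rightarrow> bool" where
  "realizes S a p \<longleftrightarrow> (\<forall>\<phi>\<in>p. holds S (case_sum a id) \<phi>)"

definition consistent :: "('f, 'r, 'm) interp \<Rightarrow> ('f, 'r, 'i + 'm) fm set \<Rightarrow> bool" where
  "consistent S p \<longleftrightarrow> (\<forall>F\<subseteq>p. finite F \<longrightarrow> (\<exists>a. realizes S a F))"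

definition is_type ::
  "('f, 'r) lang \<Rightarrow> ('f, 'r, 'm) interp \<Rightarrow> 'i set \<Rightarrow> 'm set \<Rightarrow> ('f, 'r, 'i + 'm) fm set \<Rightarrow> bool" where
  "is_type L S V A p \<longleftrightarrow> p \<subseteq> fms L (V <+> A) \<and> consistent S p
     \<and> (\<forall>\<phi>\<in>fms L (V <+> A). \<phi> \<in> p \<or> Neg \<phi> \<in> p)"

definition tp ::
  "('f, 'r) lang \<Rightarrow> ('f, 'r, 'm) interp \<Rightarrow> 'i set \<Rightarrow> ('i \<Rightarrow> 'm) \<Rightarrow> 'm set \<Rightarrow> ('f, 'r, 'i + 'm) fm set" where
  "tp L S V a A = {\<phi> \<in> fms L (V <+> A). holds S (case_sum a id) \<phi>}"

definition restr ::
  "('f, 'r) lang \<Rightarrow> 'i set \<Rightarrow> 'm set \<Rightarrow> ('f, 'r, 'i + 'm) fm set \<Rightarrow> ('f, 'r, 'i + 'm) fm set" where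
  "restr L V A p = p \<inter> fms L (V <+> A)"

definition saturated :: "('f, 'r) lang \<Rightarrow> 'k rel \<Rightarrow> ('f, 'r, 'm) interp \<Rightarrow> bool" where
  "saturated L \<kappa> S \<longleftrightarrow> (\<forall>A n (p :: ('f, 'r, nat + 'm) fm set).
     |A| <o \<kappa> \<and> is_type L S {..<n} A p \<longrightarrow> (\<exists>a. realizes S a p))"

definition automorphism :: "('f, 'r) lang \<Rightarrow> ('f, 'r, 'm) interp \<Rightarrow> ('m \<Rightarrow> 'm) \<Rightarrow> bool" where
  "automorphism L S \<sigma> \<longleftrightarrow> bij \<sigma>
     \<and> (\<forall>(f, n)\<in>funs L. \<forall>xs. length xs = n \<longrightarrow> fun_of S f (map \<sigma> xs) = \<sigma> (fun_of S f xs))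
     \<and> (\<forall>(r, n)\<in>rels L. \<forall>xs. length xs = n \<longrightarrow> rel_of S r (map \<sigma> xs) = rel_of S r xs)"

definition strongly_homogeneous :: "('f, 'r) lang \<Rightarrow> 'k rel \<Rightarrow> ('f, 'r, 'm) interp \<Rightarrow> bool" where
  "strongly_homogeneous L \<kappa> S \<longleftrightarrow> (\<forall>A h.
     |A| <o \<kappa> \<and> (\<forall>\<phi>\<in>fms L A. holds S id \<phi> \<longleftrightarrow> holds S h \<phi>)
     \<longrightarrow> (\<exists>\<sigma>. automorphism L S \<sigma> \<and> (\<forall>a\<in>A. \<sigma> a = h a)))"

text \<open>
  Small means of cardinality less than \<open>\<kappa>\<close>. The only size requirement on \<open>\<kappa>\<close> is that it exceeds
  the number of formulas; in particular it is uncountable.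
\<close>

definition monster_model ::
  "('f, 'r) lang \<Rightarrow> ('f, 'r, nat) fm set \<Rightarrow> 'k rel \<Rightarrow> ('f, 'r, 'm) interp \<Rightarrow> bool" where
  "monster_model L T \<kappa> S \<longleftrightarrow> models S T
     \<and> Card_order \<kappa> \<and> |fms L (UNIV :: nat set)| <o \<kappa>
     \<and> saturated L \<kappa> S \<and> strongly_homogeneous L \<kappa> S"


section \<open>Invariant types and the Kim-dividing order\<close>

definition invariant_type ::
  "('f, 'r) lang \<Rightarrow> ('f, 'r, 'm) interp \<Rightarrow> 'm set \<Rightarrow> 'i set \<Rightarrow> ('f, 'r, 'i + 'm) fm set \<Rightarrow> bool" where
  "invariant_type L S M V p \<longleftrightarrow> is_type L S V UNIV p
     \<and> (\<forall>(n :: nat) b b'. \<forall>\<phi>\<in>fms L (V <+> {..<n}).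
          tp L S {..<n} b M = tp L S {..<n} b' M \<longrightarrow> (inst b \<phi> \<in> p \<longleftrightarrow> inst b' \<phi> \<in> p))"

definition morley_seq ::
  "('f, 'r) lang \<Rightarrow> ('f, 'r, 'm) interp \<Rightarrow> 'm set \<Rightarrow> 'i set \<Rightarrow> ('f, 'r, 'i + 'm) fm set
     \<Rightarrow> ('l::linorder \<Rightarrow> 'i \<Rightarrow> 'm) \<Rightarrow> bool" where
  "morley_seq L S M V p b \<longleftrightarrow>
     (\<forall>i. realizes S (b i) (restr L V (M \<union> (\<Union>j\<in>{..<i}. b j ` V)) p))"

text \<open>
  Any two Morley sequences in an \<open>M\<close>-invariant type have the same type over \<open>M\<close>, so it makes no
  difference that the following quantifies over all of them.
\<close>

definition kim_divides_wrt ::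
  "('f, 'r) lang \<Rightarrow> ('f, 'r, 'm) interp \<Rightarrow> 'm set \<Rightarrow> 'i set \<Rightarrow> ('f, 'r, 'i + 'm) fm set
     \<Rightarrow> ('f, 'r, nat + 'i) fm \<Rightarrow> ('i \<Rightarrow> 'm) \<Rightarrow> bool" where
  "kim_divides_wrt L S M V p \<phi> b \<longleftrightarrow> (\<forall>c :: nat \<Rightarrow> 'i \<Rightarrow> 'm.
     morley_seq L S M V p c \<and> (\<forall>v\<in>V. c 0 v = b v) \<longrightarrow> \<not> consistent S (range (\<lambda>i. inst (c i) \<phi>)))"

text \<open>\<open>kim_ge L S M V p q\<close> is \<open>p \<ge> q\<close>; it is meant for invariant \<open>p\<close>, \<open>q\<close> that agree over \<open>M\<close>.\<close>

definition kim_ge ::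
  "('f, 'r) lang \<Rightarrow> ('f, 'r, 'm) interp \<Rightarrow> 'm set \<Rightarrow> 'i set \<Rightarrow> ('f, 'r, 'i + 'm) fm set
     \<Rightarrow> ('f, 'r, 'i + 'm) fm set \<Rightarrow> bool" where
  "kim_ge L S M V p q \<longleftrightarrow> (\<forall>\<phi>\<in>fms L (UNIV <+> V). \<forall>b.
     realizes S b (restr L V M p) \<longrightarrow> kim_divides_wrt L S M V q \<phi> b \<longrightarrow> kim_divides_wrt L S M V p \<phi> b)"

definition least_type ::
  "('f, 'r) lang \<Rightarrow> ('f, 'r, 'm) interp \<Rightarrow> 'm set \<Rightarrow> 'i set \<Rightarrow> ('f, 'r, 'i + 'm) fm set \<Rightarrow> bool" where
  "least_type L S M V p \<longleftrightarrow> invariant_type L S M V p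
     \<and> (\<forall>q. invariant_type L S M V q \<and> restr L V M q = restr L V M p \<longrightarrow> kim_ge L S M V q p)"

text \<open>The variables of \<open>P\<close> are indexed by the elements of the monster model, so that
  \<open>tp L S UNIV id M\<close> is the type over \<open>M\<close> of the monster model enumerated by itself.\<close>

definition strong_witnessing :: "('f, 'r) lang \<Rightarrow> 'k rel \<Rightarrow> ('f, 'r, 'm) interp \<Rightarrow> bool" where
  "strong_witnessing L \<kappa> S \<longleftrightarrow> (\<forall>M. elem_sub L S M \<and> |M| <o \<kappa> \<longrightarrow>
     (\<exists>P :: ('f, 'r, 'm + 'm) fm set. is_type L S UNIV UNIV P \<and> tp L S UNIV id M \<subseteq> P
        \<and> (\<forall>V. |V| <o \<kappa> \<longrightarrow> least_type L S M V (restr L V UNIV P))))"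


section \<open>Conant-independence\<close>

text \<open>The parameter tuple \<open>b\<close> of \<open>\<phi>(x,b)\<close> is indexed by \<open>{..<n}\<close>; variables of \<open>y\<close> that do not
  occur in \<open>\<phi>(x,y)\<close> are allowed.\<close>

definition conant_divides ::
  "('f, 'r) lang \<Rightarrow> ('f, 'r, 'm) interp \<Rightarrow> 'm set \<Rightarrow> ('f, 'r, 'i + nat) fm \<Rightarrow> nat \<Rightarrow> (nat \<Rightarrow> 'm) \<Rightarrow> bool" where
  "conant_divides L S M \<phi> n b \<longleftrightarrow> (\<forall>p (c :: nat \<Rightarrow> nat \<Rightarrow> 'm).
     invariant_type L S M {..<n} p \<and> morley_seq L S M {..<n} p c \<and> (\<forall>j<n. c 0 j = b j)
     \<longrightarrow> \<not> consistent S (range (\<lambda>i. inst (c i) \<phi>)))"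

definition conant_forks ::
  "('f, 'r) lang \<Rightarrow> ('f, 'r, 'm) interp \<Rightarrow> 'm set \<Rightarrow> 'i set \<Rightarrow> ('f, 'r, 'i + 'm) fm \<Rightarrow> bool" where
  "conant_forks L S M V \<psi> \<longleftrightarrow> (\<exists>D. finite D
     \<and> (\<forall>(\<phi>, n, b)\<in>D. \<phi> \<in> fms L (V <+> {..<n}) \<and> conant_divides L S M \<phi> n b)
     \<and> (\<forall>a. holds S (case_sum a id) \<psi> \<longrightarrow> (\<exists>(\<phi>, n, b)\<in>D. holds S (case_sum a id) (inst b \<phi>))))"

definition conant_indep ::
  "('f, 'r) lang \<Rightarrow> ('f, 'r, 'm) interp \<Rightarrow> 'm set \<Rightarrow> 'i set \<Rightarrow> ('i \<Rightarrow> 'm) \<Rightarrow> 'j set \<Rightarrow> ('j \<Rightarrow> 'm) \<Rightarrow> bool" where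
  "conant_indep L S M V a W b \<longleftrightarrow> \<not> (\<exists>\<psi>\<in>tp L S V a (M \<union> b ` W). conant_forks L S M V \<psi>)"

text \<open>Every small tuple can be indexed by a small subset of the underlying type of \<open>\<kappa>\<close>.\<close>

definition conant_symmetric :: "('f, 'r) lang \<Rightarrow> 'k rel \<Rightarrow> ('f, 'r, 'm) interp \<Rightarrow> bool" where
  "conant_symmetric L \<kappa> S \<longleftrightarrow> (\<forall>M (V :: 'k set) (W :: 'k set) a b.
     elem_sub L S M \<and> |M| <o \<kappa> \<and> |V| <o \<kappa> \<and> |W| <o \<kappa>
     \<longrightarrow> (conant_indep L S M V a W b \<longleftrightarrow> conant_indep L S M W b V a))"


section \<open>The properties SOP1 and SOP3\<close>

definition sop1 :: "('f, 'r) lang \<Rightarrow> ('f, 'r, 'm) interp \<Rightarrow> bool" where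
  "sop1 L S \<longleftrightarrow> (\<exists>(k :: nat) (n :: nat). \<exists>\<phi>\<in>fms L ({..<k} <+> {..<n}).
     \<exists>b :: bool list \<Rightarrow> nat \<Rightarrow> 'm.
       (\<forall>\<sigma> :: nat \<Rightarrow> bool. consistent S (range (\<lambda>l. inst (b (map \<sigma> [0..<l])) \<phi>)))
     \<and> (\<forall>\<eta>1 \<eta>2. prefix (\<eta>1 @ [False]) \<eta>2
          \<longrightarrow> \<not> consistent S {inst (b \<eta>2) \<phi>, inst (b (\<eta>1 @ [True])) \<phi>}))"

definition sop3 :: "('f, 'r) lang \<Rightarrow> ('f, 'r, 'm) interp \<Rightarrow> bool" where
  "sop3 L S \<longleftrightarrow> (\<exists>n :: nat. \<exists>\<phi>\<in>fms L ({..<n} <+> {..<n}).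
     let R = (\<lambda>x y. holds S (case_sum x y) \<phi>) in
       (\<nexists>x y z. R x y \<and> R y z \<and> R z x)
     \<and> (\<exists>a :: nat \<Rightarrow> nat \<Rightarrow> 'm. \<forall>i j. i < j \<longrightarrow> R (a i) (a j)))"

end

theory Submission
  imports Defs
begin

unbundle cardinal_syntax

text \<open>
  From \<open>SOP\<^sub>1\<close> one extracts a model \<open>M\<close> and two coheirs over \<open>M\<close> of the same type, such that \<open>\<Phi>(x,b)\<close> is
  consistent along Morley sequences in one of them and contradicts \<open>\<Phi>(x,b')\<close> when \<open>b'\<close> follows \<open>b\<close> in a
  Morley sequence of the other. Hence \<open>\<Phi>(x,b)\<close> does not Conant-divide, while \<open>b'\<close> is independent of
  \<open>b\<close>: a failure of the independence theorem. The strong witnessing property gives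
  compatible least types \<open>r b\<close> for all tuples \<open>b\<close>; Conant-dividing is dividing along \<open>r b\<close>, so
  Conant-independence has extension, and symmetry yields a weak independence theorem where the base tuples
  are in free position with respect to \<open>r\<close>. With it one builds
  \<open>d\<^sub>0, c\<^sub>0, d\<^sub>1, c\<^sub>1, \<dots>\<close>, where \<open>d\<^sub>n\<close> is free over everything before, \<open>c\<^sub>n\<close> is free only over
  \<open>c\<^sub>0, \<dots>, c\<^sub>n\<^sub>-\<^sub>1\<close>, and \<open>(c\<^sub>n,d\<^sub>j)\<close> looks like \<open>(b',b)\<close> for \<open>j \<le> n\<close>. Then \<open>\<Phi>\<close> is consistent on
  \<open>c\<^sub>0, \<dots>, c\<^sub>i\<^sub>-\<^sub>1, d\<^sub>i, d\<^sub>i\<^sub>+\<^sub>1, \<dots>\<close> and inconsistent on \<open>c\<^sub>n, d\<^sub>j\<close> for \<open>j \<le> n\<close>, which is \<open>SOP\<^sub>3\<close>.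

  Only finite tuples occur, represented by lists, and formulas are replaced by the predicates on lists
  that they define.
\<close>

section \<open>Syntax\<close>

text \<open>The obstacle is that a type over M cannot be amalgamated over arbitrary independent
  tuples: \<open>b'\<close> is independent of \<open>b\<close>, yet \<open>\<Phi>(x,b)\<close> and
  \<open>\<Phi>(x,b')\<close> exclude each other. Amalgamation becomes possible when the new tuple
  \<open>e\<close> realizes \<open>r b\<close> over the old tuple \<open>C\<close>, because
  stationarity of invariant types then identifies \<open>(C,e)\<close> with parts of two consecutive
  terms of one Morley sequence. So a realization of \<open>\<Phi>\<close> can be carried along a
  sequence only while each new entry is free over the entries already in that sequence. The entry
  \<open>d n\<close> may be appended to every mixed sequence, \<open>c n\<close> only to
  \<open>c 0, ..., c (n-1)\<close>; this fixes which sequences stay consistent. Symmetry is needed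
  because least types give extension only on the left of the independence relation, while
  amalgamation must also enlarge the right side. Two coheirs are needed because one cannot do both
  jobs: Morley sequences in the first produce the clash, those in the second the consistency. They
  must agree over M so that the same \<open>b\<close> realizes both, which is why the tree has to
  yield two sequences that eventually agree over every finite part of M.\<close>

lemma finite_fv_tm: "finite (fv_tm t)"
  by (induction t) auto

lemma finite_fv: "finite (fv \<phi>)"
  by (induction \<phi>) (auto simp: finite_fv_tm)

lemma val_map: "val S e \<rho> (map_tm h t) = val S (e \<circ> h) \<rho> t"
  by (induction t) (auto intro!: arg_cong[where f = "fun_of S _"])

lemma sat_map: "sat D S e \<rho> (map_fm h \<phi>) = sat D S (e \<circ> h) \<rho> \<phi>"
  by (induction \<phi> arbitrary: \<rho>) (auto simp: val_map comp_def)

lemma wf_tm_map: "wf_tm L k (map_tm h t) = wf_tm L k t"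
  by (induction t) auto

lemma wf_fm_map: "wf_fm L k (map_fm h \<phi>) = wf_fm L k \<phi>"
  by (induction \<phi> arbitrary: k) (auto simp: wf_tm_map)

lemma map_fm_in_fms: "map_fm h \<phi> \<in> fms L Y \<longleftrightarrow> wf_fm L 0 \<phi> \<and> h ` fv \<phi> \<subseteq> Y"
  by (auto simp: fms_def wf_fm_map fm.set_map)

lemma val_cong: "(\<And>v. v \<in> fv_tm t \<Longrightarrow> e v = e' v) \<Longrightarrow> val S e \<rho> t = val S e' \<rho> t"
proof (induction t)
  case (Fn f ts)
  then have "map (val S e \<rho>) ts = map (val S e' \<rho>) ts"
    by (intro map_cong refl) (metis UN_I tm.set(3))
  then show ?case by (metis val.simps(3))
qed auto

lemma sat_cong: "(\<And>v. v \<in> fv \<phi> \<Longrightarrow> e v = e' v) \<Longrightarrow> sat D S e \<rho> \<phi> = sat D S e' \<rho> \<phi>"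
proof (induction \<phi> arbitrary: \<rho>)
  case (Eq s t)
  have "val S e \<rho> s = val S e' \<rho> s" "val S e \<rho> t = val S e' \<rho> t"
    using Eq by (auto intro!: val_cong)
  then show ?case by simp
next
  case (Rel r ts)
  have "map (val S e \<rho>) ts = map (val S e' \<rho>) ts"
    using Rel by (intro map_cong refl val_cong) auto
  then show ?case by (metis sat.simps(2))
next
  case (Neg \<phi>)
  have "sat D S e \<rho> \<phi> = sat D S e' \<rho> \<phi>" by (rule Neg.IH) (use Neg.prems in auto)
  then show ?case by simp
next
  case (Conj \<phi> \<psi>)
  have "sat D S e \<rho> \<phi> = sat D S e' \<rho> \<phi>" by (rule Conj.IH(1)) (use Conj.prems in auto)
  moreover have "sat D S e \<rho> \<psi> = sat D S e' \<rho> \<psi>" by (rule Conj.IH(2)) (use Conj.prems in auto)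
  ultimately show ?case by simp
next
  case (Forall \<phi>)
  have "sat D S e \<rho>' \<phi> = sat D S e' \<rho>' \<phi>" for \<rho>' by (rule Forall.IH) (use Forall.prems in auto)
  then show ?case by simp
qed

text \<open>
  Under \<open>d\<close> binders, \<open>g\<close> renames free variables or turns them into indices beyond the binders
  (closing), and \<open>h\<close> names the dangling indices (opening).
\<close>

fun sb_tm :: "nat \<Rightarrow> ('v \<Rightarrow> 'w + nat) \<Rightarrow> (nat \<Rightarrow> 'w) \<Rightarrow> ('f, 'v) tm \<Rightarrow> ('f, 'w) tm" where
  "sb_tm d g h (Free v) = (case g v of Inl w \<Rightarrow> Free w | Inr j \<Rightarrow> Bound (d + j))"
| "sb_tm d g h (Bound i) = (if i < d then Bound i else Free (h (i - d)))"
| "sb_tm d g h (Fn f ts) = Fn f (map (sb_tm d g h) ts)"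

fun sb_fm :: "nat \<Rightarrow> ('v \<Rightarrow> 'w + nat) \<Rightarrow> (nat \<Rightarrow> 'w) \<Rightarrow> ('f, 'r, 'v) fm \<Rightarrow> ('f, 'r, 'w) fm" where
  "sb_fm d g h (Eq s t) = Eq (sb_tm d g h s) (sb_tm d g h t)"
| "sb_fm d g h (Rel r ts) = Rel r (map (sb_tm d g h) ts)"
| "sb_fm d g h (Neg \<phi>) = Neg (sb_fm d g h \<phi>)"
| "sb_fm d g h (Conj \<phi> \<psi>) = Conj (sb_fm d g h \<phi>) (sb_fm d g h \<psi>)"
| "sb_fm d g h (Forall \<phi>) = Forall (sb_fm (Suc d) g h \<phi>)"

text \<open>\<open>\<rho>1\<close> holds the values of the inner binders. Beyond them the source
  term reads \<open>\<rho>3\<close>, whose values the names \<open>h\<close> must supply, and the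
  target term reads \<open>\<rho>2\<close> at the indices created by closing.\<close>

lemma val_sb:
  assumes "wf_tm L (length \<rho>1 + length \<rho>3) t" "\<And>j. j < length \<rho>3 \<Longrightarrow> e (h j) = \<rho>3 ! j"
  shows "val S e (\<rho>1 @ \<rho>2) (sb_tm (length \<rho>1) g h t) =
    val S (\<lambda>v. case g v of Inl w \<Rightarrow> e w | Inr j \<Rightarrow> \<rho>2 ! j) (\<rho>1 @ \<rho>3) t"
  using assms(1)
proof (induction t)
  case (Fn f ts)
  then show ?case by (auto intro!: arg_cong[where f = "fun_of S _"])
qed (auto simp: nth_append assms(2) split: sum.split)

lemma sat_sb:
  assumes "wf_fm L (length \<rho>1 + length \<rho>3) \<phi>" "\<And>j. j < length \<rho>3 \<Longrightarrow> e (h j) = \<rho>3 ! j"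
  shows "sat D S e (\<rho>1 @ \<rho>2) (sb_fm (length \<rho>1) g h \<phi>) =
    sat D S (\<lambda>v. case g v of Inl w \<Rightarrow> e w | Inr j \<Rightarrow> \<rho>2 ! j) (\<rho>1 @ \<rho>3) \<phi>"
  using assms(1)
proof (induction \<phi> arbitrary: \<rho>1)
  case (Eq s t)
  then have "wf_tm L (length \<rho>1 + length \<rho>3) s" "wf_tm L (length \<rho>1 + length \<rho>3) t" by auto
  then show ?case
    using val_sb[of L \<rho>1 \<rho>3 s e h S \<rho>2 g] val_sb[of L \<rho>1 \<rho>3 t e h S \<rho>2 g] assms(2) by simp
next
  case (Rel r ts)
  have "map (val S e (\<rho>1 @ \<rho>2)) (map (sb_tm (length \<rho>1) g h) ts)
     = map (val S (\<lambda>v. case g v of Inl w \<Rightarrow> e w | Inr j \<Rightarrow> \<rho>2 ! j) (\<rho>1 @ \<rho>3)) ts"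
    unfolding map_map comp_def
    by (intro map_cong refl val_sb[where L = L] assms(2)) (use Rel in auto)
  then show ?case by (metis sat.simps(2) sb_fm.simps(2))
next
  case (Neg \<phi>)
  show ?case using Neg.IH[of \<rho>1] Neg.prems by simp
next
  case (Conj \<phi> \<psi>)
  show ?case using Conj.IH(1)[of \<rho>1] Conj.IH(2)[of \<rho>1] Conj.prems by simp
next
  case (Forall \<phi>)
  have "sat D S e ((x # \<rho>1) @ \<rho>2) (sb_fm (length (x # \<rho>1)) g h \<phi>) =
    sat D S (\<lambda>v. case g v of Inl w \<Rightarrow> e w | Inr j \<Rightarrow> \<rho>2 ! j) ((x # \<rho>1) @ \<rho>3) \<phi>" for x
    using Forall.prems by (intro Forall.IH) auto
  then show ?case by simp
qed

text \<open>Here \<open>m\<close> counts the dangling indices that are opened and \<open>k\<close>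
  bounds those created by closing; quantification uses \<open>m = 0\<close> and
  \<open>k = 1\<close>, instantiation of an environment uses \<open>k = 0\<close>.\<close>

lemma wf_sb_tm:
  "wf_tm L (d + m) t \<Longrightarrow> (\<And>v j. v \<in> fv_tm t \<Longrightarrow> g v = Inr j \<Longrightarrow> j < k) \<Longrightarrow> wf_tm L (d + k) (sb_tm d g h t)"
proof (induction t)
  case (Fn f ts)
  have "wf_tm L (d + k) (sb_tm d g h t)" if "t \<in> set ts" for t
    by (rule Fn.IH[OF that]) (use Fn.prems that in auto)
  then show ?case using Fn.prems by auto
qed (auto split: sum.split)

lemma wf_sb_fm:
  "wf_fm L (d + m) \<phi> \<Longrightarrow> (\<And>v j. v \<in> fv \<phi> \<Longrightarrow> g v = Inr j \<Longrightarrow> j < k) \<Longrightarrow> wf_fm L (d + k) (sb_fm d g h \<phi>)"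
proof (induction \<phi> arbitrary: d)
  case (Eq s t)
  have "wf_tm L (d + k) (sb_tm d g h s)" by (rule wf_sb_tm[where m = m]) (use Eq in auto)
  moreover have "wf_tm L (d + k) (sb_tm d g h t)" by (rule wf_sb_tm[where m = m]) (use Eq in auto)
  ultimately show ?case by simp
next
  case (Rel r ts)
  have "wf_tm L (d + k) (sb_tm d g h t)" if "t \<in> set ts" for t
    by (rule wf_sb_tm[where m = m]) (use Rel that in auto)
  then show ?case using Rel by auto
next
  case (Neg \<phi>)
  have "wf_fm L (d + k) (sb_fm d g h \<phi>)" by (rule Neg.IH) (use Neg.prems in auto)
  then show ?case by simp
next
  case (Conj \<phi> \<psi>)
  have "wf_fm L (d + k) (sb_fm d g h \<phi>)" by (rule Conj.IH(1)) (use Conj.prems in auto)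
  moreover have "wf_fm L (d + k) (sb_fm d g h \<psi>)" by (rule Conj.IH(2)) (use Conj.prems in auto)
  ultimately show ?case by simp
next
  case (Forall \<phi>)
  have "wf_fm L (Suc d + k) (sb_fm (Suc d) g h \<phi>)"
    by (rule Forall.IH) (use Forall.prems in auto)
  then show ?case by simp
qed

lemma fv_sb_tm:
  "wf_tm L (d + m) t \<Longrightarrow> fv_tm (sb_tm d g h t) \<subseteq> {w. \<exists>v\<in>fv_tm t. g v = Inl w} \<union> h ` {..<m}"
proof (induction t)
  case (Fn f ts)
  have "fv_tm (sb_tm d g h t) \<subseteq> {w. \<exists>v\<in>fv_tm t. g v = Inl w} \<union> h ` {..<m}" if "t \<in> set ts" for t
    by (rule Fn.IH[OF that]) (use Fn.prems that in auto)
  then show ?case by fastforce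
qed (auto split: sum.split)

lemma fv_sb_fm:
  "wf_fm L (d + m) \<phi> \<Longrightarrow> fv (sb_fm d g h \<phi>) \<subseteq> {w. \<exists>v\<in>fv \<phi>. g v = Inl w} \<union> h ` {..<m}"
proof (induction \<phi> arbitrary: d)
  case (Eq s t)
  have "fv_tm (sb_tm d g h s) \<subseteq> {w. \<exists>v\<in>fv_tm s. g v = Inl w} \<union> h ` {..<m}"
    "fv_tm (sb_tm d g h t) \<subseteq> {w. \<exists>v\<in>fv_tm t. g v = Inl w} \<union> h ` {..<m}"
    using Eq by (auto intro!: fv_sb_tm)
  then show ?case unfolding sb_fm.simps fm.set by blast
next
  case (Rel r ts)
  have "fv_tm (sb_tm d g h t) \<subseteq> {w. \<exists>v\<in>fv_tm t. g v = Inl w} \<union> h ` {..<m}" if "t \<in> set ts" for t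
    using Rel that by (intro fv_sb_tm) auto
  then show ?case by fastforce
next
  case (Neg \<phi>)
  then show ?case by simp
next
  case (Conj \<phi> \<psi>)
  then have "fv (sb_fm d g h \<phi>) \<subseteq> {w. \<exists>v\<in>fv \<phi>. g v = Inl w} \<union> h ` {..<m}"
    "fv (sb_fm d g h \<psi>) \<subseteq> {w. \<exists>v\<in>fv \<psi>. g v = Inl w} \<union> h ` {..<m}" by auto
  then show ?case unfolding sb_fm.simps fm.set by blast
next
  case (Forall \<phi>)
  have "fv (sb_fm (Suc d) g h \<phi>) \<subseteq> {w. \<exists>v\<in>fv \<phi>. g v = Inl w} \<union> h ` {..<m}"
    by (rule Forall.IH) (use Forall.prems in auto)
  then show ?case by simp
qed

section \<open>Ultrafilters\<close>

definition fip :: "'a set set \<Rightarrow> bool" where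
  "fip F \<longleftrightarrow> (\<forall>G\<subseteq>F. finite G \<longrightarrow> \<Inter>G \<noteq> {})"

text \<open>Closure under supersets and finite intersections need not be postulated: a failure would
  put two or three sets with empty intersection into \<open>U\<close>.\<close>

definition ultra :: "'a set set \<Rightarrow> bool" where
  "ultra U \<longleftrightarrow> fip U \<and> (\<forall>X. X \<in> U \<or> -X \<in> U)"

lemma fipD: "fip F \<Longrightarrow> G \<subseteq> F \<Longrightarrow> finite G \<Longrightarrow> \<Inter>G \<noteq> {}"
  by (simp add: fip_def)

lemma ultra_fip: "ultra U \<Longrightarrow> fip U"
  by (simp add: ultra_def)

text \<open>Zorn's lemma gives a maximal family with the finite intersection property. If it omitted
  both X and its complement, finite subfamilies refuting each of them would together have empty
  intersection.\<close>

lemma ultra_extends: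
  assumes "fip F"
  shows "\<exists>U. ultra U \<and> F \<subseteq> U"
proof -
  let ?A = "{G. F \<subseteq> G \<and> fip G}"
  have "\<exists>U\<in>?A. \<forall>X\<in>?A. U \<subseteq> X \<longrightarrow> X = U"
  proof (rule subset_Zorn_nonempty)
    show "?A \<noteq> {}" using assms by auto
  next
    fix C assume C: "C \<noteq> {}" "subset.chain ?A C"
    then have sub: "C \<subseteq> ?A" unfolding subset.chain_def by blast
    have "fip (\<Union>C)"
      unfolding fip_def
    proof (intro allI impI)
      fix G assume "G \<subseteq> \<Union>C" "finite G"
      obtain H where "H \<in> C" "G \<subseteq> H"
        by (rule finite_subset_Union_chain[OF \<open>finite G\<close> \<open>G \<subseteq> \<Union>C\<close> C])
      then show "\<Inter>G \<noteq> {}" using sub \<open>finite G\<close> by (auto simp: fip_def)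
    qed
    then show "\<Union>C \<in> ?A" using sub C(1) by auto
  qed
  then obtain U where "U \<in> ?A" and max: "\<forall>X\<in>?A. U \<subseteq> X \<longrightarrow> X = U" ..
  then have U: "F \<subseteq> U" "fip U" by auto
  have "X \<in> U \<or> -X \<in> U" for X
  proof (rule ccontr)
    assume n: "\<not> (X \<in> U \<or> -X \<in> U)"
    have nf: "\<not> fip (insert Y U)" if "Y \<notin> U" for Y
    proof
      assume "fip (insert Y U)"
      then have "insert Y U = U" using bspec[OF max, of "insert Y U"] U(1) by auto
      then show False using that by auto
    qed
    have *: "\<exists>G\<subseteq>U. finite G \<and> Y \<inter> \<Inter>G = {}" if Y: "Y \<notin> U" for Y
    proof -
      obtain G where G: "G \<subseteq> insert Y U" "finite G" "\<Inter>G = {}"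
        using nf[OF Y] unfolding fip_def by meson
      have "G - {Y} \<subseteq> U" "finite (G - {Y})" "Y \<inter> \<Inter>(G - {Y}) = {}" using G by auto
      then show ?thesis by (intro exI[of _ "G - {Y}"] conjI)
    qed
    obtain G1 where G1: "G1 \<subseteq> U" "finite G1" "X \<inter> \<Inter>G1 = {}" using n *[of X] by blast
    obtain G2 where G2: "G2 \<subseteq> U" "finite G2" "-X \<inter> \<Inter>G2 = {}" using n *[of "-X"] by blast
    note G = G1 G2
    have "\<Inter>(G1 \<union> G2) = {}" unfolding Inf_union_distrib using G by blast
    moreover have "G1 \<union> G2 \<subseteq> U" "finite (G1 \<union> G2)" using G by auto
    ultimately show False using fipD[OF U(2)] by metis
  qed
  then show ?thesis using U by (auto simp: ultra_def)
qed

lemma ultra_not: assumes "ultra U" shows "-X \<in> U \<longleftrightarrow> X \<notin> U"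
proof -
  have "False" if "X \<in> U" "-X \<in> U"
  proof -
    have "\<Inter>{X, -X} \<noteq> {}" using that by (intro fipD[OF ultra_fip[OF assms]]) auto
    then show False by simp
  qed
  then show ?thesis using assms by (auto simp: ultra_def)
qed

lemma ultra_nonempty: assumes "ultra U" "X \<in> U" shows "X \<noteq> {}"
proof -
  have "\<Inter>{X} \<noteq> {}" using assms(2) by (intro fipD[OF ultra_fip[OF assms(1)]]) auto
  then show ?thesis by simp
qed

lemma ultra_mono: assumes "ultra U" "X \<in> U" "X \<subseteq> Y" shows "Y \<in> U"
proof (rule ccontr)
  assume "Y \<notin> U"
  then have "-Y \<in> U" using assms ultra_not by blast
  then have "\<Inter>{X, -Y} \<noteq> {}" using assms(2) by (intro fipD[OF ultra_fip[OF assms(1)]]) auto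
  then show False using assms(3) by auto
qed

lemma ultra_Int: assumes "ultra U" shows "X \<inter> Y \<in> U \<longleftrightarrow> X \<in> U \<and> Y \<in> U"
proof -
  have "False" if "X \<in> U" "Y \<in> U" "-(X \<inter> Y) \<in> U"
  proof -
    have "\<Inter>{X, Y, -(X \<inter> Y)} \<noteq> {}" using that by (intro fipD[OF ultra_fip[OF assms]]) auto
    then show False by auto
  qed
  then have "X \<in> U \<Longrightarrow> Y \<in> U \<Longrightarrow> X \<inter> Y \<in> U" using assms by (auto simp: ultra_def)
  moreover have "X \<inter> Y \<in> U \<Longrightarrow> X \<in> U" "X \<inter> Y \<in> U \<Longrightarrow> Y \<in> U"
    using ultra_mono[OF assms] by blast+
  ultimately show ?thesis by blast
qed

section \<open>Definable predicates on tuples\<close>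

locale monster =
  fixes L :: "('f, 'r) lang" and \<kappa> :: "'k rel" and S :: "('f, 'r, 'm) interp"
  assumes Card_order_\<kappa>: "Card_order \<kappa>"
    and fms_less_\<kappa>: "|fms L (UNIV :: nat set)| <o \<kappa>"
    and saturated: "saturated L \<kappa> S"
begin

text \<open>Nothing is said about lists of other lengths, so equality of definable predicates is
  always meant on lists of length \<open>n\<close>.\<close>

definition dfn :: "'m set \<Rightarrow> nat \<Rightarrow> ('m list \<Rightarrow> bool) \<Rightarrow> bool" where
  "dfn A n Q \<longleftrightarrow> (\<exists>\<phi>\<in>fms L ({..<n} <+> A). \<forall>xs. length xs = n \<longrightarrow> Q xs = holds S (case_sum (nth xs) id) \<phi>)"

text \<open>Substitution of variables and of constants from \<open>A\<close>, seen as a map on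
  lists. Such maps are built from \<open>take\<close>, \<open>drop\<close> and append, and this
  replaces all renaming of variables in formulas.\<close>

definition sub :: "'m set \<Rightarrow> nat \<Rightarrow> nat \<Rightarrow> ('m list \<Rightarrow> 'm list) \<Rightarrow> bool" where
  "sub A n m F \<longleftrightarrow> (\<forall>xs. length xs = n \<longrightarrow> length (F xs) = m)
     \<and> (\<forall>i<m. (\<exists>j<n. \<forall>xs. length xs = n \<longrightarrow> F xs ! i = xs ! j)
            \<or> (\<exists>a\<in>A. \<forall>xs. length xs = n \<longrightarrow> F xs ! i = a))"

text \<open>Each variable has a coordinate or a constant giving its value uniformly in the list;
  choosing one per variable is a renaming of the formula.\<close>

lemma dfn_fm:
  assumes "\<phi> \<in> fms L W"
    and "\<And>w. w \<in> W \<Longrightarrow> (\<exists>j<n. \<forall>xs. length xs = n \<longrightarrow> e xs w = xs ! j)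
            \<or> (\<exists>a\<in>A. \<forall>xs. length xs = n \<longrightarrow> e xs w = a)"
  shows "dfn A n (\<lambda>xs. holds S (e xs) \<phi>)"
proof -
  have "\<forall>w\<in>W. \<exists>g\<in>{..<n} <+> A. \<forall>xs. length xs = n \<longrightarrow> e xs w = case_sum (nth xs) id g"
  proof
    fix w assume "w \<in> W"
    from assms(2)[OF this] show "\<exists>g\<in>{..<n} <+> A. \<forall>xs. length xs = n \<longrightarrow> e xs w = case_sum (nth xs) id g"
    proof
      assume "\<exists>j<n. \<forall>xs. length xs = n \<longrightarrow> e xs w = xs ! j"
      then obtain j where "j < n" "\<forall>xs. length xs = n \<longrightarrow> e xs w = xs ! j" by blast
      then show ?thesis by (intro bexI[of _ "Inl j"]) auto
    next
      assume "\<exists>a\<in>A. \<forall>xs. length xs = n \<longrightarrow> e xs w = a"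
      then obtain a where "a \<in> A" "\<forall>xs. length xs = n \<longrightarrow> e xs w = a" by blast
      then show ?thesis by (intro bexI[of _ "Inr a"]) auto
    qed
  qed
  then obtain g where g: "\<And>w. w \<in> W \<Longrightarrow> g w \<in> {..<n} <+> A"
    "\<And>w xs. w \<in> W \<Longrightarrow> length xs = n \<Longrightarrow> e xs w = case_sum (nth xs) id (g w)"
    by metis
  show ?thesis
    unfolding dfn_def
  proof (intro bexI allI impI)
    show "map_fm g \<phi> \<in> fms L ({..<n} <+> A)"
      using assms(1) g(1) unfolding map_fm_in_fms by (auto simp: fms_def subset_iff)
    fix xs :: "'m list" assume "length xs = n"
    then show "holds S (e xs) \<phi> = holds S (case_sum (nth xs) id) (map_fm g \<phi>)"
      unfolding sat_map using assms(1) g(2) by (intro sat_cong) (auto simp: fms_def subset_iff)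
  qed
qed

lemma dfn_cong: "dfn A n Q \<Longrightarrow> (\<And>xs. length xs = n \<Longrightarrow> Q xs = R xs) \<Longrightarrow> dfn A n R"
  unfolding dfn_def by simp

lemma dfn_sub:
  assumes "dfn B m Q" "sub A n m F" "B \<subseteq> A"
  shows "dfn A n (\<lambda>xs. Q (F xs))"
proof -
  obtain \<phi> where \<phi>: "\<phi> \<in> fms L ({..<m} <+> B)"
    "\<And>xs. length xs = m \<Longrightarrow> Q xs = holds S (case_sum (nth xs) id) \<phi>"
    using assms(1) unfolding dfn_def by blast
  have "dfn A n (\<lambda>xs. holds S (case_sum (nth (F xs)) id) \<phi>)"
  proof (rule dfn_fm[OF \<phi>(1)])
    fix w assume "w \<in> {..<m} <+> B"
    then show "(\<exists>j<n. \<forall>xs. length xs = n \<longrightarrow> case_sum (nth (F xs)) id w = xs ! j)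
            \<or> (\<exists>a\<in>A. \<forall>xs. length xs = n \<longrightarrow> case_sum (nth (F xs)) id w = a)"
      using assms(2,3) by (cases w) (auto simp: sub_def)
  qed
  then show ?thesis
    by (rule dfn_cong) (use \<phi>(2) assms(2) in \<open>auto simp: sub_def\<close>)
qed

lemma sub_id: "sub A n n (\<lambda>xs. xs)"
  by (auto simp: sub_def)

lemma sub_append:
  assumes "sub A n m F" "sub A n k G"
  shows "sub A n (m + k) (\<lambda>xs. F xs @ G xs)"
  unfolding sub_def
proof (intro conjI allI impI)
  fix i assume i: "i < m + k"
  show "(\<exists>j<n. \<forall>xs. length xs = n \<longrightarrow> (F xs @ G xs) ! i = xs ! j)
            \<or> (\<exists>a\<in>A. \<forall>xs. length xs = n \<longrightarrow> (F xs @ G xs) ! i = a)"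
  proof (cases "i < m")
    case True
    then show ?thesis using assms(1) by (auto simp: sub_def nth_append)
  next
    case False
    then have "i - m < k" using i by auto
    then show ?thesis using assms False by (simp add: sub_def nth_append)
  qed
qed (use assms in \<open>auto simp: sub_def\<close>)

lemma sub_const: "set ys \<subseteq> A \<Longrightarrow> m = length ys \<Longrightarrow> sub A n m (\<lambda>xs. ys)"
  unfolding sub_def
proof (intro conjI allI impI)
  fix i assume "set ys \<subseteq> A" "m = length ys" "i < m"
  then have "ys ! i \<in> A" by auto
  then show "(\<exists>j<n. \<forall>xs. length xs = n \<longrightarrow> ys ! i = xs ! j) \<or> (\<exists>a\<in>A. \<forall>xs::'m list. length xs = n \<longrightarrow> ys ! i = a)"
    by blast
qed auto

lemma sub_take: "k \<le> n \<Longrightarrow> sub A n k (take k)"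
  by (auto simp: sub_def intro: order_less_le_trans)

lemma sub_drop: "m = n - k \<Longrightarrow> sub A n m (drop k)"
  by (auto simp: sub_def intro!: exI[of _ "k + _"])

lemma sub_mid: "k + m \<le> n \<Longrightarrow> sub A n m (\<lambda>xs. take m (drop k xs))"
  by (auto simp: sub_def intro!: exI[of _ "k + _"])

lemma sub_map_nth: "set is \<subseteq> {..<n} \<Longrightarrow> sub A n (length is) (\<lambda>xs. map (nth xs) is)"
  unfolding sub_def by (auto simp: subset_iff intro!: exI[of _ "is ! _"])

lemma sub_comp:
  assumes "sub A n m F" "sub A m k G"
  shows "sub A n k (\<lambda>xs. G (F xs))"
  unfolding sub_def
proof (intro conjI allI impI)
  fix i assume "i < k"
  then consider (1) j where "j < m" "\<And>xs. length xs = m \<Longrightarrow> G xs ! i = xs ! j"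
    | (2) a where "a \<in> A" "\<And>xs. length xs = m \<Longrightarrow> G xs ! i = a"
    using assms(2) unfolding sub_def by blast
  then show "(\<exists>j<n. \<forall>xs. length xs = n \<longrightarrow> G (F xs) ! i = xs ! j)
            \<or> (\<exists>a\<in>A. \<forall>xs. length xs = n \<longrightarrow> G (F xs) ! i = a)"
  proof cases
    case 1
    then show ?thesis using assms(1) unfolding sub_def by simp
  next
    case 2
    then show ?thesis using assms(1) unfolding sub_def by auto
  qed
qed (use assms in \<open>auto simp: sub_def\<close>)

lemma sub_mono: "sub A n m F \<Longrightarrow> A \<subseteq> B \<Longrightarrow> sub B n m F"
  unfolding sub_def by blast

lemma dfn_mono: "dfn A n Q \<Longrightarrow> A \<subseteq> B \<Longrightarrow> dfn B n Q"
  by (rule dfn_sub[OF _ sub_id])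

lemma dfn_not: "dfn A n Q \<Longrightarrow> dfn A n (\<lambda>xs. \<not> Q xs)"
  unfolding dfn_def
  by (erule bexE, rule_tac x = "Neg \<phi>" in bexI) (auto simp: fms_def)

lemma dfn_conj:
  assumes "dfn A n Q" "dfn A n R" shows "dfn A n (\<lambda>xs. Q xs \<and> R xs)"
proof -
  obtain \<phi> \<psi> where "\<phi> \<in> fms L ({..<n} <+> A)" "\<psi> \<in> fms L ({..<n} <+> A)"
    "\<And>xs. length xs = n \<Longrightarrow> Q xs = holds S (case_sum (nth xs) id) \<phi>"
    "\<And>xs. length xs = n \<Longrightarrow> R xs = holds S (case_sum (nth xs) id) \<psi>"
    using assms unfolding dfn_def by blast
  then show ?thesis
    unfolding dfn_def by (intro bexI[of _ "Conj \<phi> \<psi>"]) (auto simp: fms_def)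
qed

lemma dfn_disj: "dfn A n Q \<Longrightarrow> dfn A n R \<Longrightarrow> dfn A n (\<lambda>xs. Q xs \<or> R xs)"
  using dfn_not[OF dfn_conj[OF dfn_not dfn_not, of A n Q R]] by simp

lemma dfn_imp: "dfn A n Q \<Longrightarrow> dfn A n R \<Longrightarrow> dfn A n (\<lambda>xs. Q xs \<longrightarrow> R xs)"
  using dfn_disj[OF dfn_not, of A n Q R] by simp

lemma dfn_iff: "dfn A n Q \<Longrightarrow> dfn A n R \<Longrightarrow> dfn A n (\<lambda>xs. Q xs = R xs)"
  by (rule dfn_cong[OF dfn_conj[OF dfn_imp dfn_imp, of A n Q R R Q]]) auto

lemma dfn_True: "dfn A n (\<lambda>xs. True)"
  unfolding dfn_def by (intro bexI[of _ "Forall (Eq (Bound 0) (Bound 0))"]) (auto simp: fms_def)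

lemma dfn_const: "dfn A n (\<lambda>xs. b)"
  using dfn_True[of A n] dfn_not[OF dfn_True, of A n] by (cases b) auto

lemma dfn_eq: "i < n \<Longrightarrow> j < n \<Longrightarrow> dfn A n (\<lambda>xs. xs ! i = xs ! j)"
  unfolding dfn_def by (intro bexI[of _ "Eq (Free (Inl i)) (Free (Inl j))"]) (auto simp: fms_def)

lemma dfn_ball: "finite I \<Longrightarrow> (\<And>i. i \<in> I \<Longrightarrow> dfn A n (Q i)) \<Longrightarrow> dfn A n (\<lambda>xs. \<forall>i\<in>I. Q i xs)"
proof (induction I rule: finite_induct)
  case (insert x F)
  then have "dfn A n (\<lambda>xs. Q x xs \<and> (\<forall>i\<in>F. Q i xs))" by (intro dfn_conj) auto
  then show ?case by simp
qed (simp add: dfn_True)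

lemma dfn_ex1:
  assumes "dfn A (Suc n) Q"
  shows "dfn A n (\<lambda>xs. \<exists>y. Q (xs @ [y]))"
proof -
  obtain \<phi> where \<phi>: "\<phi> \<in> fms L ({..<Suc n} <+> A)"
    "\<And>xs. length xs = Suc n \<Longrightarrow> Q xs = holds S (case_sum (nth xs) id) \<phi>"
    using assms unfolding dfn_def by blast
  \<comment> \<open>The last coordinate becomes the index bound by the new quantifier. There is no
    dangling index to open, so the value of \<open>undefined\<close> is irrelevant.\<close>
  define g :: "nat + 'm \<Rightarrow> (nat + 'm) + nat" where
    "g v = (if v = Inl n then Inr 0 else Inl v)" for v
  let ?\<psi> = "Neg (Forall (Neg (sb_fm 0 g undefined \<phi>)))"
  have wf: "wf_fm L (0 + 0) \<phi>" using \<phi>(1) by (simp add: fms_def)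
  have "wf_fm L (0 + Suc 0) (sb_fm 0 g undefined \<phi>)"
    by (rule wf_sb_fm[OF wf]) (auto simp: g_def split: if_splits)
  moreover have "fv (sb_fm 0 g undefined \<phi>) \<subseteq> {..<n} <+> A"
    using fv_sb_fm[OF wf, of g undefined] \<phi>(1)
    by (fastforce simp: fms_def g_def split: if_splits)
  ultimately have "?\<psi> \<in> fms L ({..<n} <+> A)" by (simp add: fms_def)
  moreover have "(\<exists>y. Q (xs @ [y])) = holds S (case_sum (nth xs) id) ?\<psi>" if xs: "length xs = n" for xs
  proof -
    have "Q (xs @ [y]) = sat UNIV S (case_sum (nth xs) id) [y] (sb_fm 0 g undefined \<phi>)" for y
    proof -
      have "sat UNIV S (case_sum (nth xs) id) ([] @ [y]) (sb_fm (length ([]::'m list)) g undefined \<phi>)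
        = sat UNIV S (\<lambda>v. case g v of Inl w \<Rightarrow> case_sum (nth xs) id w | Inr j \<Rightarrow> [y] ! j) ([] @ []) \<phi>"
        by (rule sat_sb[where L = L]) (use wf in auto)
      also have "\<dots> = sat UNIV S (case_sum (nth (xs @ [y])) id) [] \<phi>"
        unfolding append_Nil
      proof (rule sat_cong)
        fix v assume "v \<in> fv \<phi>"
        then have "v \<in> {..<Suc n} <+> A" using \<phi>(1) by (auto simp: fms_def)
        then show "(case g v of Inl w \<Rightarrow> case_sum (nth xs) id w | Inr j \<Rightarrow> [y] ! j) = case_sum (nth (xs @ [y])) id v"
          using xs by (auto simp: g_def nth_append less_Suc_eq)
      qed
      finally show ?thesis using \<phi>(2)[of "xs @ [y]"] xs by simp
    qed
    then show ?thesis by simp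
  qed
  ultimately show ?thesis unfolding dfn_def by blast
qed

lemma dfn_ex: "dfn A (n + m) Q \<Longrightarrow> dfn A n (\<lambda>xs. \<exists>ys. length ys = m \<and> Q (xs @ ys))"
proof (induction m arbitrary: Q)
  case (Suc m)
  have "dfn A (n + m) (\<lambda>xs. \<exists>y. Q (xs @ [y]))" using Suc.prems by (intro dfn_ex1) simp
  from Suc.IH[OF this] have "dfn A n (\<lambda>xs. \<exists>ys. length ys = m \<and> (\<exists>y. Q ((xs @ ys) @ [y])))" .
  then show ?case
  proof (rule dfn_cong)
    fix xs
    show "(\<exists>ys. length ys = m \<and> (\<exists>y. Q ((xs @ ys) @ [y]))) = (\<exists>ys. length ys = Suc m \<and> Q (xs @ ys))"
      (is "?l = ?r")
    proof
      assume ?l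
      then obtain ys y where "length ys = m" "Q ((xs @ ys) @ [y])" by blast
      then show ?r by (intro exI[of _ "ys @ [y]"]) simp
    next
      assume ?r
      then obtain zs where zs: "length zs = Suc m" "Q (xs @ zs)" by blast
      then obtain ys y where "zs = ys @ [y]" by (cases zs rule: rev_cases) auto
      with zs show ?l by (intro exI[of _ ys] conjI exI[of _ y]) auto
    qed
  qed
qed simp

lemma dfn_all:
  assumes "dfn A (n + m) Q" shows "dfn A n (\<lambda>xs. \<forall>ys. length ys = m \<longrightarrow> Q (xs @ ys))"
  using dfn_not[OF dfn_ex[OF dfn_not[OF assms]]] by simp

text \<open>A parameter from \<open>ys\<close> outside \<open>A\<close> is replaced by a coordinate
  at which it occurs in \<open>ys\<close>; a parameter that also lies in \<open>A\<close> stays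
  where it is.\<close>

lemma dfn_params:
  assumes "dfn (A \<union> set ys) n Q"
  shows "\<exists>Q'. dfn A (n + length ys) Q' \<and> (\<forall>xs. length xs = n \<longrightarrow> Q xs = Q' (xs @ ys))"
proof -
  obtain \<phi> where \<phi>: "\<phi> \<in> fms L ({..<n} <+> (A \<union> set ys))"
    "\<And>xs. length xs = n \<Longrightarrow> Q xs = holds S (case_sum (nth xs) id) \<phi>"
    using assms unfolding dfn_def by blast
  have "\<forall>a\<in>set ys. \<exists>i. i < length ys \<and> ys ! i = a" by (auto simp: in_set_conv_nth)
  from bchoice[OF this] obtain idx where idx: "\<And>a. a \<in> set ys \<Longrightarrow> idx a < length ys \<and> ys ! idx a = a"
    by auto
  define e where "e zs w = (case w of Inl j \<Rightarrow> zs ! j | Inr a \<Rightarrow> if a \<in> A then a else zs ! (n + idx a))"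
    for zs :: "'m list" and w
  have "dfn A (n + length ys) (\<lambda>zs. holds S (e zs) \<phi>)"
  proof (rule dfn_fm[OF \<phi>(1)])
    fix w assume w: "w \<in> {..<n} <+> (A \<union> set ys)"
    consider (1) j where "w = Inl j" "j < n" | (2) a where "w = Inr a" "a \<in> A"
      | (3) a where "w = Inr a" "a \<notin> A" "a \<in> set ys" using w by auto
    then show "(\<exists>j<n + length ys. \<forall>xs. length xs = n + length ys \<longrightarrow> e xs w = xs ! j)
            \<or> (\<exists>a\<in>A. \<forall>xs. length xs = n + length ys \<longrightarrow> e xs w = a)"
    proof cases
      case 1 then show ?thesis by (intro disjI1 exI[of _ j]) (auto simp: e_def)
    next
      case 2 then show ?thesis by (intro disjI2 bexI[of _ a]) (auto simp: e_def)
    next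
      case 3 then show ?thesis
        using idx[of a] by (intro disjI1 exI[of _ "n + idx a"]) (auto simp: e_def)
    qed
  qed
  moreover have "Q xs = holds S (e (xs @ ys)) \<phi>" if "length xs = n" for xs
    unfolding \<phi>(2)[OF that] using \<phi>(1) that idx
    by (intro sat_cong) (auto simp: fms_def e_def nth_append subset_iff split: sum.split)
  ultimately show ?thesis by blast
qed

lemma dfn_finite:
  assumes "dfn (A \<union> B) n Q"
  shows "\<exists>ys. set ys \<subseteq> B \<and> dfn (A \<union> set ys) n Q"
proof -
  obtain \<phi> where \<phi>: "\<phi> \<in> fms L ({..<n} <+> (A \<union> B))"
    "\<forall>xs. length xs = n \<longrightarrow> Q xs = holds S (case_sum (nth xs) id) \<phi>"
    using assms unfolding dfn_def by blast
  have "finite {a \<in> B. Inr a \<in> fv \<phi>}"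
    by (rule finite_surj[OF finite_fv[of \<phi>], of _ "\<lambda>v. case v of Inr a \<Rightarrow> a"]) (force split: sum.split)
  then obtain ys where ys: "set ys = {a \<in> B. Inr a \<in> fv \<phi>}" using finite_list by blast
  then have "\<phi> \<in> fms L ({..<n} <+> (A \<union> set ys))" using \<phi>(1) by (fastforce simp: fms_def)
  then show ?thesis using \<phi>(2) ys unfolding dfn_def by blast
qed


section \<open>Equality of types\<close>

definition eqt :: "'m set \<Rightarrow> 'm list \<Rightarrow> 'm list \<Rightarrow> bool" where
  "eqt A xs ys \<longleftrightarrow> length xs = length ys \<and> (\<forall>Q. dfn A (length xs) Q \<longrightarrow> Q xs = Q ys)"

lemma eqt_refl: "eqt A xs xs" by (simp add: eqt_def)

lemma eqt_sym: "eqt A xs ys \<Longrightarrow> eqt A ys xs" by (auto simp: eqt_def)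

lemma eqt_trans: "eqt A xs ys \<Longrightarrow> eqt A ys zs \<Longrightarrow> eqt A xs zs"
  unfolding eqt_def by metis

lemma eqt_length: "eqt A xs ys \<Longrightarrow> length xs = length ys" by (simp add: eqt_def)

lemma eqtD: "eqt A xs ys \<Longrightarrow> dfn A (length xs) Q \<Longrightarrow> Q xs = Q ys" by (simp add: eqt_def)

lemma eqt_mono: "eqt B xs ys \<Longrightarrow> A \<subseteq> B \<Longrightarrow> eqt A xs ys"
  unfolding eqt_def using dfn_mono by blast

lemma eqtI:
  assumes "length xs = length ys" "\<And>Q. dfn A (length xs) Q \<Longrightarrow> Q xs \<Longrightarrow> Q ys"
  shows "eqt A xs ys"
  unfolding eqt_def using assms dfn_not by metis

lemma eqt_sub:
  assumes "eqt A xs ys" "sub A (length xs) m F"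
  shows "eqt A (F xs) (F ys)"
proof -
  have l: "length (F xs) = m" "length (F ys) = m" using assms by (auto simp: sub_def eqt_def)
  have "Q (F xs) = Q (F ys)" if "dfn A m Q" for Q
    using eqtD[OF assms(1) dfn_sub[OF that assms(2)]] by simp
  then show ?thesis using l by (simp add: eqt_def)
qed

lemma eqt_append_const: "eqt A xs ys \<Longrightarrow> set cs \<subseteq> A \<Longrightarrow> eqt A (xs @ cs) (ys @ cs)"
  by (rule eqt_sub[of A xs ys "length xs + length cs" "\<lambda>xs. xs @ cs"])
     (auto intro: sub_append sub_id sub_const)

text \<open>Parameters and appended constant coordinates are interchangeable. Almost all later
  comparisons over finite extensions of M are carried out over M in this way.\<close>

lemma eqt_params: "eqt (A \<union> set cs) xs ys \<longleftrightarrow> eqt A (xs @ cs) (ys @ cs)"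
proof
  assume "eqt (A \<union> set cs) xs ys"
  then show "eqt A (xs @ cs) (ys @ cs)" by (rule eqt_mono[OF eqt_append_const]) auto
next
  assume e: "eqt A (xs @ cs) (ys @ cs)"
  then have l: "length xs = length ys" using eqt_length by fastforce
  have "Q xs = Q ys" if "dfn (A \<union> set cs) (length xs) Q" for Q
  proof -
    obtain Q' where "dfn A (length xs + length cs) Q'" "\<forall>zs. length zs = length xs \<longrightarrow> Q zs = Q' (zs @ cs)"
      using dfn_params[OF \<open>dfn (A \<union> set cs) (length xs) Q\<close>] by blast
    then show ?thesis using eqtD[OF e] l by simp
  qed
  then show "eqt (A \<union> set cs) xs ys" using l by (simp add: eqt_def)
qed

lemma eqt_appendD1: "eqt A (xs @ us) (ys @ vs) \<Longrightarrow> length xs = length ys \<Longrightarrow> eqt A xs ys"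
  using eqt_sub[of A "xs @ us" "ys @ vs" _ "take (length xs)", OF _ sub_take] by simp

lemma eqt_appendD2: "eqt A (xs @ us) (ys @ vs) \<Longrightarrow> length xs = length ys \<Longrightarrow> eqt A us vs"
  using eqt_sub[of A "xs @ us" "ys @ vs" _ "drop (length xs)", OF _ sub_drop[OF refl]] by simp

lemma eqt_swap:
  assumes "eqt A (xs @ us) (ys @ vs)" "length xs = length ys"
  shows "eqt A (us @ xs) (vs @ ys)"
  using eqt_sub[of A "xs @ us" "ys @ vs" _ "\<lambda>zs. drop (length xs) zs @ take (length xs) zs",
      OF assms(1) sub_append[OF sub_drop[OF refl] sub_take]] assms(2) by simp


section \<open>Small sets and saturation\<close>

text \<open>Measured by the number of formulas and not by \<open>\<kappa>\<close>: regularity of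
  \<open>\<kappa>\<close> is not assumed, while this bound is stable under countable unions and
  finite sequences, as Skolem hulls require.\<close>

definition small :: "'a set \<Rightarrow> bool" where
  "small A \<longleftrightarrow> |A| \<le>o |fms L (UNIV :: nat set)|"

lemma infinite_fms: "infinite (fms L (UNIV :: nat set))"
proof
  assume f: "finite (fms L (UNIV :: nat set))"
  have "inj (\<lambda>i::nat. Eq (Free i) (Free i) :: ('f, 'r, nat) fm)" by (auto intro: injI)
  moreover have "range (\<lambda>i::nat. Eq (Free i) (Free i)) \<subseteq> fms L UNIV" by (auto simp: fms_def)
  ultimately show False using f by (meson finite_imageD finite_subset infinite_UNIV_nat)
qed

lemma small_less: "small A \<Longrightarrow> |A| <o \<kappa>"
  unfolding small_def by (rule ordLeq_ordLess_trans[OF _ fms_less_\<kappa>])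

lemma small_mono: "small B \<Longrightarrow> A \<subseteq> B \<Longrightarrow> small A"
  unfolding small_def using card_of_mono1 ordLeq_transitive by blast

lemma small_image: "small A \<Longrightarrow> small (h ` A)"
  unfolding small_def using card_of_image ordLeq_transitive by blast

lemma small_countable_UN:
  assumes "\<And>i::nat. small (F i)" shows "small (\<Union>i. F i)"
  unfolding small_def
proof (rule card_of_UNION_ordLeq_infinite[OF infinite_fms])
  show "|UNIV :: nat set| \<le>o |fms L (UNIV :: nat set)|"
    using infinite_fms infinite_iff_card_of_nat by blast
qed (use assms in \<open>auto simp: small_def\<close>)

lemma small_finite: "finite A \<Longrightarrow> small A"
  unfolding small_def using infinite_fms
  using finite_ordLess_infinite[OF card_of_Well_order card_of_Well_order, of A "fms L UNIV"]
  by (metis Field_card_of ordLess_imp_ordLeq)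

lemma small_Un: "small A \<Longrightarrow> small B \<Longrightarrow> small (A \<union> B)"
  unfolding small_def using infinite_fms
  using card_of_Un_ordLeq_infinite_Field[OF _ _ _ card_of_Card_order, of "fms L UNIV" A B]
  by (simp add: Field_card_of)

text \<open>The saturation hypothesis concerns complete syntactic types. An ultrafilter on lists
  containing all the sets defined by \<open>F\<close> completes the family; the set of all lists of
  length \<open>n\<close> is added so that the ultrafilter sees only those.\<close>

lemma saturation:
  assumes "small A" "\<And>Q. Q \<in> F \<Longrightarrow> dfn A n Q"
    and fin: "\<And>G. finite G \<Longrightarrow> G \<subseteq> F \<Longrightarrow> \<exists>x. length x = n \<and> (\<forall>Q\<in>G. Q x)"
  shows "\<exists>x. length x = n \<and> (\<forall>Q\<in>F. Q x)"
proof -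
  define X where "X Q = {x. length x = n \<and> Q x}" for Q :: "'m list \<Rightarrow> bool"
  have "fip (insert (X (\<lambda>_. True)) (X ` F))"
    unfolding fip_def
  proof (intro allI impI)
    fix H assume H: "H \<subseteq> insert (X (\<lambda>_. True)) (X ` F)" "finite H"
    then have "H - {X (\<lambda>_. True)} \<subseteq> X ` F" "finite (H - {X (\<lambda>_. True)})" by auto
    then obtain G where G: "G \<subseteq> F" "finite G" "H - {X (\<lambda>_. True)} = X ` G" by (meson finite_subset_image)
    obtain x where x: "length x = n" "\<forall>Q\<in>G. Q x" using fin[OF G(2,1)] by (elim exE conjE)
    have "x \<in> X Q" if "Q \<in> G" for Q using x(1) bspec[OF x(2) that] by (simp add: X_def)
    then have "x \<in> Y" if "Y \<in> X ` G" for Y using that by (elim imageE) simp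
    moreover have "x \<in> X (\<lambda>_. True)" using x(1) by (simp add: X_def)
    moreover have "Y = X (\<lambda>_. True) \<or> Y \<in> X ` G" if "Y \<in> H" for Y
      unfolding G(3)[symmetric] using that by simp
    ultimately have "\<forall>Y\<in>H. x \<in> Y" by metis
    then show "\<Inter>H \<noteq> {}" by auto
  qed
  from ultra_extends[OF this] obtain U where U: "ultra U" "insert (X (\<lambda>_. True)) (X ` F) \<subseteq> U"
    by (elim exE conjE)
  have UT: "X (\<lambda>_. True) \<in> U" using U(2) by simp
  have UF: "X Q \<in> U" if "Q \<in> F" for Q
    using that by (intro subsetD[OF U(2)] insertI2 imageI)
  define p :: "('f, 'r, nat + 'm) fm set" where
    "p = {\<phi> \<in> fms L ({..<n} <+> A). X (\<lambda>x. holds S (case_sum (nth x) id) \<phi>) \<in> U}"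
  have fin_p: "\<exists>x. length x = n \<and> (\<forall>\<phi>\<in>H. holds S (case_sum (nth x) id) \<phi>)" if H: "finite H" "H \<subseteq> p" for H
  proof -
    have "\<Inter>(insert (X (\<lambda>_. True)) ((\<lambda>\<phi>. X (\<lambda>x. holds S (case_sum (nth x) id) \<phi>)) ` H)) \<noteq> {}"
      by (rule fipD[OF ultra_fip[OF U(1)]]) (use H UT in \<open>auto simp: p_def\<close>)
    then obtain x where "x \<in> X (\<lambda>_. True)" "\<forall>\<phi>\<in>H. x \<in> X (\<lambda>x. holds S (case_sum (nth x) id) \<phi>)"
      by auto
    then show ?thesis by (intro exI[of _ x]) (simp add: X_def)
  qed
  have "is_type L S {..<n} A p"
    unfolding is_type_def
  proof (intro conjI ballI)
    show "p \<subseteq> fms L ({..<n} <+> A)" by (auto simp: p_def)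
    show "consistent S p"
      unfolding consistent_def realizes_def
    proof (intro allI impI)
      fix H assume "H \<subseteq> p" "finite H"
      from fin_p[OF this(2,1)] obtain x where "\<forall>\<phi>\<in>H. holds S (case_sum (nth x) id) \<phi>" by (elim exE conjE)
      then show "\<exists>a. \<forall>\<phi>\<in>H. holds S (case_sum a id) \<phi>" by (intro exI[of _ "nth x"])
    qed
    fix \<phi> assume \<phi>: "\<phi> \<in> fms L ({..<n} <+> A)"
    show "\<phi> \<in> p \<or> Neg \<phi> \<in> p"
    proof (cases "\<phi> \<in> p")
      case False
      then have "- X (\<lambda>x. holds S (case_sum (nth x) id) \<phi>) \<in> U"
        using \<phi> ultra_not[OF U(1)] by (auto simp: p_def)
      then have "X (\<lambda>_. True) \<inter> - X (\<lambda>x. holds S (case_sum (nth x) id) \<phi>) \<in> U"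
        using UT unfolding ultra_Int[OF U(1)] by simp
      moreover have "X (\<lambda>_. True) \<inter> - X (\<lambda>x. holds S (case_sum (nth x) id) \<phi>)
         = X (\<lambda>x. holds S (case_sum (nth x) id) (Neg \<phi>))" by (auto simp: X_def)
      ultimately show ?thesis using \<phi> by (auto simp: p_def fms_def)
    qed auto
  qed
  with small_less[OF assms(1)] have "|A| <o \<kappa> \<and> is_type L S {..<n} A p" ..
  from saturated[unfolded saturated_def, THEN spec, THEN spec, THEN spec, THEN mp, OF this]
  obtain a where a: "realizes S a p" ..
  let ?x = "map a [0..<n]"
  have "Q ?x" if Q: "Q \<in> F" for Q
  proof -
    obtain \<phi> where \<phi>: "\<phi> \<in> fms L ({..<n} <+> A)"
      "\<And>xs. length xs = n \<Longrightarrow> Q xs = holds S (case_sum (nth xs) id) \<phi>"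
      using assms(2)[OF Q] unfolding dfn_def by blast
    have "X Q = X (\<lambda>x. holds S (case_sum (nth x) id) \<phi>)" using \<phi>(2) by (auto simp: X_def)
    then have "\<phi> \<in> p" using UF[OF Q] \<phi>(1) by (simp add: p_def)
    then have "holds S (case_sum a id) \<phi>" using a by (simp add: realizes_def)
    also have "holds S (case_sum a id) \<phi> = holds S (case_sum (nth ?x) id) \<phi>"
      using \<phi>(1) by (intro sat_cong) (auto simp: fms_def)
    finally show ?thesis using \<phi>(2) by simp
  qed
  then show ?thesis by (intro exI[of _ ?x]) auto
qed

lemma saturation_family:
  assumes "small A" and dfn: "\<And>i. i \<in> I \<Longrightarrow> dfn A n (Q i)"
    and fin: "\<And>J. finite J \<Longrightarrow> J \<subseteq> I \<Longrightarrow> \<exists>x. length x = n \<and> (\<forall>i\<in>J. Q i x)"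
  shows "\<exists>x. length x = n \<and> (\<forall>i\<in>I. Q i x)"
proof -
  have "\<exists>x. length x = n \<and> (\<forall>R\<in>Q ` I. R x)"
  proof (rule saturation[OF assms(1)])
    fix R assume "R \<in> Q ` I" then show "dfn A n R" by (elim imageE) (simp add: dfn)
  next
    fix G assume "finite G" "G \<subseteq> Q ` I"
    then obtain J where J: "finite J" "J \<subseteq> I" "G = Q ` J" by (meson finite_subset_image)
    obtain x where x: "length x = n" "\<forall>i\<in>J. Q i x" using fin[OF J(1,2)] by (elim exE conjE)
    then show "\<exists>x. length x = n \<and> (\<forall>R\<in>G. R x)"
      unfolding J(3) by (intro exI[of _ x]) simp
  qed
  then obtain x where "length x = n" "\<forall>R\<in>Q ` I. R x" by (elim exE conjE)
  then show ?thesis by (intro exI[of _ x]) simp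
qed

text \<open>Homogeneity for finite tuples, obtained from saturation: copy the type of
  \<open>u\<close> over \<open>xs\<close> to \<open>ys\<close>. Finitely many of its conditions are
  satisfiable there because their solvability is a definable property shared by \<open>xs\<close>
  and \<open>ys\<close>.\<close>

lemma eqt_extend:
  assumes "small A" "eqt A xs ys"
  obtains v where "length v = length u" "eqt A (xs @ u) (ys @ v)"
proof -
  let ?I = "{Q. dfn A (length xs + length u) Q \<and> Q (xs @ u)}"
  have l: "length ys = length xs" using assms(2) by (simp add: eqt_def)
  have sm: "small (A \<union> set ys)" by (intro small_Un assms(1) small_finite) simp
  have "\<exists>v. length v = length u \<and> (\<forall>Q\<in>?I. Q (ys @ v))"
  proof (rule saturation_family[OF sm, of ?I "length u" "\<lambda>Q v. Q (ys @ v)"])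
    fix Q assume "Q \<in> ?I"
    then have "dfn A (length xs + length u) Q" by simp
    then show "dfn (A \<union> set ys) (length u) (\<lambda>v. Q (ys @ v))"
      by (rule dfn_sub) (use l in \<open>auto intro!: sub_append sub_const sub_id\<close>)
  next
    fix J assume J: "finite J" "J \<subseteq> ?I"
    let ?Q = "\<lambda>zs. \<exists>v. length v = length u \<and> (\<forall>R\<in>J. R (zs @ v))"
    have "dfn A (length xs) ?Q"
    proof (intro dfn_ex dfn_ball J(1))
      fix R assume "R \<in> J"
      then have "R \<in> ?I" by (rule subsetD[OF J(2)])
      then show "dfn A (length xs + length u) R" by simp
    qed
    moreover have "?Q xs"
    proof (intro exI[of _ u] conjI refl ballI)
      fix R assume "R \<in> J"
      then have "R \<in> ?I" by (rule subsetD[OF J(2)])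
      then show "R (xs @ u)" by simp
    qed
    ultimately have "?Q ys" using eqtD[OF assms(2), of ?Q] by simp
    then show "\<exists>v. length v = length u \<and> (\<forall>R\<in>J. R (ys @ v))" .
  qed
  then obtain v where v: "length v = length u" "\<forall>Q\<in>?I. Q (ys @ v)" by (elim exE conjE)
  have "eqt A (xs @ u) (ys @ v)"
  proof (rule eqtI)
    fix Q assume "dfn A (length (xs @ u)) Q" "Q (xs @ u)"
    then have "Q \<in> ?I" by simp
    from bspec[OF v(2) this] show "Q (ys @ v)" .
  qed (use v(1) l in simp)
  with v(1) show ?thesis by (rule that)
qed


section \<open>Small elementary substructures\<close>

lemma small_Times: "small X \<Longrightarrow> small Y \<Longrightarrow> small (X \<times> Y)"
  unfolding small_def using infinite_fms card_of_Times_ordLeq_infinite_Field[OF _ _ _ card_of_Card_order, of "fms L UNIV" X Y]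
  by (simp add: Field_card_of)

lemma small_lists:
  assumes "small X" shows "small (lists X)"
proof -
  have "small {xs \<in> lists X. length xs = n}" for n
  proof (induction n)
    case 0
    have "{xs \<in> lists X. length xs = 0} \<subseteq> {[]}" by auto
    then show ?case by (rule small_mono[rotated]) (rule small_finite, simp)
  next
    case (Suc n)
    have "{xs \<in> lists X. length xs = Suc n} \<subseteq> (\<lambda>(x, xs). x # xs) ` (X \<times> {xs \<in> lists X. length xs = n})"
      by (auto simp: length_Suc_conv image_iff)
    then show ?case by (rule small_mono[rotated]) (intro small_image small_Times assms Suc)
  qed
  then have "small (\<Union>n. {xs \<in> lists X. length xs = n})" by (rule small_countable_UN)
  moreover have "lists X \<subseteq> (\<Union>n. {xs \<in> lists X. length xs = n})" by auto
  ultimately show ?thesis by (rule small_mono)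
qed

text \<open>A formula over \<open>X\<close> is a formula in number variables together with a finite
  list that names them.\<close>

lemma small_fms:
  assumes "small X" shows "small (fms L X)"
proof -
  have "fms L X \<subseteq> (\<lambda>(\<phi>, xs). map_fm (nth xs) \<phi>) ` (fms L (UNIV :: nat set) \<times> lists X)"
  proof
    fix \<phi> assume \<phi>: "\<phi> \<in> fms L X"
    from finite_list[OF finite_fv[of \<phi>]] obtain xs where xs: "set xs = fv \<phi>" ..
    have "\<forall>a\<in>set xs. \<exists>i. xs ! i = a" by (auto simp: in_set_conv_nth)
    from bchoice[OF this] obtain idx where idx: "\<forall>a\<in>set xs. xs ! idx a = a" by blast
    have "map_fm (nth xs) (map_fm idx \<phi>) = \<phi>"
      unfolding fm.map_comp by (rule fm.map_ident_strong) (use idx xs in auto)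
    moreover have "map_fm idx \<phi> \<in> fms L UNIV" using \<phi> by (simp add: map_fm_in_fms) (simp add: fms_def)
    moreover have "xs \<in> lists X" using xs \<phi> by (auto simp: fms_def)
    ultimately show "\<phi> \<in> (\<lambda>(\<phi>, xs). map_fm (nth xs) \<phi>) ` (fms L (UNIV :: nat set) \<times> lists X)"
      by (intro image_eqI[of _ _ "(map_fm idx \<phi>, xs)"]) auto
  qed
  moreover have "small (fms L (UNIV :: nat set))"
    unfolding small_def by (rule ordLeq_refl[OF card_of_Card_order])
  ultimately show ?thesis by (elim small_mono[rotated]) (intro small_image small_Times small_lists assms)
qed

text \<open>The Tarski-Vaught criterion for one variable.\<close>

definition closed :: "'m set \<Rightarrow> bool" where
  "closed M \<longleftrightarrow> (\<forall>Q. dfn M 1 Q \<longrightarrow> (\<exists>y. Q [y]) \<longrightarrow> (\<exists>y\<in>M. Q [y]))"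

lemma closedD: "closed M \<Longrightarrow> dfn M 1 Q \<Longrightarrow> Q [y] \<Longrightarrow> \<exists>y\<in>M. Q [y]"
  unfolding closed_def by meson

text \<open>A definition uses finitely many parameters, hence a single stage of the chain. Witnesses
  are demanded only in the union, so the lemma serves the stages of a Skolem hull, which are not
  closed themselves, as well as chains of closed sets.\<close>

lemma closed_UN:
  fixes F :: "nat \<Rightarrow> 'm set"
  assumes "mono F" and step: "\<And>n Q y. dfn (F n) 1 Q \<Longrightarrow> Q [y] \<Longrightarrow> \<exists>y\<in>\<Union>n. F n. Q [y]"
  shows "closed (\<Union>n. F n)"
  unfolding closed_def
proof (intro allI impI)
  fix Q :: "'m list \<Rightarrow> bool" assume "dfn (\<Union>n. F n) 1 Q" "\<exists>y. Q [y]"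
  then have "dfn ({} \<union> (\<Union>n. F n)) 1 Q" by simp
  from dfn_finite[OF this] obtain ys where ys: "set ys \<subseteq> (\<Union>n. F n)" "dfn (set ys) 1 Q" by auto
  have "\<exists>n. set ys \<subseteq> F n"
    using ys(1)
  proof (induction ys)
    case (Cons y ys)
    then obtain n where n: "set ys \<subseteq> F n" by auto
    obtain m where m: "y \<in> F m" using Cons.prems by auto
    have "F n \<subseteq> F (max n m)" "F m \<subseteq> F (max n m)" using assms(1) by (auto simp: mono_def)
    with n m have "set (y # ys) \<subseteq> F (max n m)" by auto
    then show ?case by blast
  qed simp
  then obtain n where "set ys \<subseteq> F n" by blast
  with ys(2) have "dfn (F n) 1 Q" by (rule dfn_mono)
  moreover obtain y where "Q [y]" using \<open>\<exists>y. Q [y]\<close> by (elim exE)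
  ultimately show "\<exists>y\<in>\<Union>n. F n. Q [y]" by (rule step)
qed

text \<open>A Skolem function chosen once per formula, whatever set the parameters are taken from;
  this makes \<open>hull\<close> monotone.\<close>

definition wit :: "('f, 'r, nat + 'm) fm \<Rightarrow> 'm" where
  "wit \<phi> = (SOME y. holds S (case_sum (\<lambda>_. y) id) \<phi>)"

definition hull_step :: "'m set \<Rightarrow> 'm set" where
  "hull_step A = A \<union> wit ` fms L ({..<1} <+> A)"

definition hull :: "'m set \<Rightarrow> 'm set" where
  "hull A = (\<Union>n. (hull_step ^^ n) A)"

lemma hull_step_mono: "A \<subseteq> B \<Longrightarrow> hull_step A \<subseteq> hull_step B"
  unfolding hull_step_def fms_def by (intro Un_mono image_mono) auto

lemma hull_mono: assumes "A \<subseteq> B" shows "hull A \<subseteq> hull B"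
proof -
  have "(hull_step ^^ n) A \<subseteq> (hull_step ^^ n) B" for n
    by (induction n) (use assms in \<open>auto intro: hull_step_mono[THEN subsetD]\<close>)
  then show ?thesis unfolding hull_def by (intro UN_mono) auto
qed

lemma hull_superset: "A \<subseteq> hull A"
  unfolding hull_def by (rule subset_trans[OF _ UN_upper[of 0]]) auto

lemma small_hull:
  assumes "small A" shows "small (hull A)"
proof -
  have "small ({..<1::nat} <+> B)" if "small B" for B :: "'m set"
    unfolding Plus_def by (rule small_Un[OF small_finite small_image[OF that]]) simp
  then have "small ((hull_step ^^ n) A)" for n
    by (induction n) (auto simp: assms hull_step_def intro!: small_Un small_image small_fms)
  then show ?thesis unfolding hull_def by (rule small_countable_UN)
qed

lemma closed_hull: "closed (hull A)"
  unfolding hull_def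
proof (rule closed_UN)
  show "mono (\<lambda>n. (hull_step ^^ n) A)"
    unfolding mono_iff_le_Suc by (auto simp: hull_step_def)
next
  fix n Q y assume Q: "dfn ((hull_step ^^ n) A) 1 Q" "Q [y]"
  then obtain \<phi> where \<phi>: "\<phi> \<in> fms L ({..<1} <+> (hull_step ^^ n) A)"
    "\<And>xs. length xs = 1 \<Longrightarrow> Q xs = holds S (case_sum (nth xs) id) \<phi>"
    unfolding dfn_def by blast
  have eq: "Q [z] = holds S (case_sum (\<lambda>_. z) id) \<phi>" for z
    unfolding \<phi>(2)[of "[z]", simplified] using \<phi>(1) by (intro sat_cong) (auto simp: fms_def)
  have "holds S (case_sum (\<lambda>_. wit \<phi>) id) \<phi>"
    unfolding wit_def by (rule someI[of _ y]) (use Q(2) eq in simp)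
  then have "Q [wit \<phi>]" using eq by simp
  moreover have "wit \<phi> \<in> (hull_step ^^ Suc n) A" using \<phi>(1) by (auto simp: hull_step_def)
  then have "wit \<phi> \<in> (\<Union>n. (hull_step ^^ n) A)" by (rule UN_I[OF UNIV_I])
  ultimately show "\<exists>y\<in>\<Union>n. (hull_step ^^ n) A. Q [y]" by (rule bexI)
qed

lemma closed_sat:
  assumes "closed M"
  shows "wf_fm L (length \<rho>) \<phi> \<Longrightarrow> fv \<phi> \<subseteq> M \<Longrightarrow> set \<rho> \<subseteq> M \<Longrightarrow> sat M S id \<rho> \<phi> = sat UNIV S id \<rho> \<phi>"
proof (induction \<phi> arbitrary: \<rho>)
  case (Forall \<phi>)
  define g :: "'m \<Rightarrow> (nat + 'm) + nat" where "g v = Inl (Inr v)" for v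
  \<comment> \<open>The index of the quantifier becomes the single variable; the values of the outer
    binders, which lie in \<open>M\<close>, become parameters, shifted by one. The negation is taken
    because \<open>closed\<close> supplies witnesses for existential statements.\<close>
  define h :: "nat \<Rightarrow> nat + 'm" where "h i = (if i = 0 then Inl 0 else Inr (\<rho> ! (i - 1)))" for i
  let ?\<psi> = "Neg (sb_fm 0 g h \<phi>)"
  have wf: "wf_fm L (0 + Suc (length \<rho>)) \<phi>" using Forall.prems by simp
  have "wf_fm L (0 + 0) (sb_fm 0 g h \<phi>)" by (rule wf_sb_fm[OF wf]) (simp add: g_def)
  moreover have "fv (sb_fm 0 g h \<phi>) \<subseteq> {..<1} <+> M"
    using fv_sb_fm[OF wf, of g h] Forall.prems by (fastforce simp: g_def h_def)
  ultimately have \<psi>: "?\<psi> \<in> fms L ({..<1} <+> M)" by (simp add: fms_def)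
  have holds_\<psi>: "holds S (case_sum (nth [d]) id) ?\<psi> \<longleftrightarrow> \<not> sat UNIV S id (d # \<rho>) \<phi>" for d
  proof -
    have "sat UNIV S (case_sum (nth [d]) id) ([] @ []) (sb_fm (length ([]::'m list)) g h \<phi>)
      = sat UNIV S (\<lambda>v. case g v of Inl w \<Rightarrow> case_sum (nth [d]) id w | Inr j \<Rightarrow> [] ! j) ([] @ (d # \<rho>)) \<phi>"
    proof (rule sat_sb[where L = L])
      fix j assume "j < length (d # \<rho>)"
      then show "case_sum (nth [d]) id (h j) = (d # \<rho>) ! j" by (cases j) (auto simp: h_def)
    qed (use wf in simp)
    also have "\<dots> = sat UNIV S id (d # \<rho>) \<phi>" unfolding append_Nil by (rule sat_cong) (simp add: g_def)
    finally show ?thesis by simp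
  qed
  have "dfn M 1 (\<lambda>xs. holds S (case_sum (nth xs) id) ?\<psi>)" using \<psi> unfolding dfn_def by blast
  from closedD[OF assms this] have "\<not> sat UNIV S id (d # \<rho>) \<phi> \<Longrightarrow> \<exists>d\<in>M. \<not> sat UNIV S id (d # \<rho>) \<phi>" for d
    using holds_\<psi> by blast
  moreover have "sat M S id (d # \<rho>) \<phi> = sat UNIV S id (d # \<rho>) \<phi>" if "d \<in> M" for d
    using Forall.prems that by (intro Forall.IH) auto
  ultimately show ?case unfolding sat.simps by blast
next
  case (Eq s t)
  then show ?case by simp
next
  case (Rel r ts)
  then show ?case by simp
next
  case (Neg \<phi>)
  then show ?case by simp
next
  case (Conj \<phi> \<psi>)
  then show ?case by simp
qed

lemma closed_elem_sub:
  assumes "closed M" shows "elem_sub L S M"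
  unfolding elem_sub_def
proof (intro conjI)
  show "M \<noteq> {}" using closedD[OF assms dfn_True] by blast
next
  show "\<forall>(f, n)\<in>funs L. \<forall>xs. length xs = n \<and> set xs \<subseteq> M \<longrightarrow> fun_of S f xs \<in> M"
  proof (clarify)
    fix f and xs :: "'m list" assume f: "(f, length xs) \<in> funs L" "set xs \<subseteq> M"
    \<comment> \<open>The value of the function is the only solution of this formula over
      \<open>M\<close>, so the witness in \<open>M\<close> must be that value.\<close>
    let ?\<phi> = "Eq (Free (Inl 0)) (Fn f (map (\<lambda>x. Free (Inr x)) xs)) :: ('f, 'r, nat + 'm) fm"
    have "?\<phi> \<in> fms L ({..<1} <+> M)" using f by (auto simp: fms_def)
    then have d: "dfn M 1 (\<lambda>ys. holds S (case_sum (nth ys) id) ?\<phi>)" unfolding dfn_def by blast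
    have e: "holds S (case_sum (nth [y]) id) ?\<phi> \<longleftrightarrow> y = fun_of S f xs" for y
      by (simp add: comp_def)
    show "fun_of S f xs \<in> M" using closedD[OF assms d, of "fun_of S f xs"] unfolding e by simp
  qed
next
  show "\<forall>\<phi>\<in>fms L M. sat M S id [] \<phi> = holds S id \<phi>"
    using closed_sat[OF assms, of "[]"] by (simp add: fms_def)
qed


section \<open>Invariant types and Morley sequences\<close>

text \<open>A global type is given semantically, by the definable predicates that it contains.\<close>

definition inv_type :: "'m set \<Rightarrow> nat \<Rightarrow> (('m list \<Rightarrow> bool) \<Rightarrow> bool) \<Rightarrow> bool" where
  "inv_type M n p \<longleftrightarrow>
     (\<forall>Q. dfn UNIV n Q \<longrightarrow> p (\<lambda>x. \<not> Q x) = (\<not> p Q))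
   \<and> (\<forall>Q R. dfn UNIV n Q \<longrightarrow> dfn UNIV n R \<longrightarrow> p Q \<longrightarrow> p R \<longrightarrow> p (\<lambda>x. Q x \<and> R x))
   \<and> (\<forall>Q. dfn UNIV n Q \<longrightarrow> p Q \<longrightarrow> (\<exists>x. length x = n \<and> Q x))
   \<and> (\<forall>R ys ys'. dfn {} (n + length ys) R \<longrightarrow> eqt M ys ys' \<longrightarrow> p (\<lambda>x. R (x @ ys)) \<longrightarrow> p (\<lambda>x. R (x @ ys')))"

definition realizer :: "(('m list \<Rightarrow> bool) \<Rightarrow> bool) \<Rightarrow> nat \<Rightarrow> 'm set \<Rightarrow> 'm list \<Rightarrow> bool" where
  "realizer p n A c \<longleftrightarrow> length c = n \<and> (\<forall>Q. dfn A n Q \<longrightarrow> p Q \<longrightarrow> Q c)"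

lemma inv_not: "inv_type M n p \<Longrightarrow> dfn UNIV n Q \<Longrightarrow> p (\<lambda>x. \<not> Q x) = (\<not> p Q)"
  unfolding inv_type_def by (elim conjE) simp

lemma inv_conj: "inv_type M n p \<Longrightarrow> dfn UNIV n Q \<Longrightarrow> dfn UNIV n R \<Longrightarrow> p Q \<Longrightarrow> p R \<Longrightarrow> p (\<lambda>x. Q x \<and> R x)"
  unfolding inv_type_def by (elim conjE) simp

lemma inv_sat: "inv_type M n p \<Longrightarrow> dfn UNIV n Q \<Longrightarrow> p Q \<Longrightarrow> \<exists>x. length x = n \<and> Q x"
  unfolding inv_type_def by (elim conjE) simp

lemma inv_inv0:
  assumes "inv_type M n p" "dfn {} (n + length ys) R" "eqt M ys ys'"
  shows "p (\<lambda>x. R (x @ ys)) = p (\<lambda>x. R (x @ ys'))"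
proof -
  from assms(1) have *: "\<forall>R ys ys'. dfn {} (n + length ys) R \<longrightarrow> eqt M ys ys' \<longrightarrow> p (\<lambda>x. R (x @ ys)) \<longrightarrow> p (\<lambda>x. R (x @ ys'))"
    unfolding inv_type_def by (elim conjE)
  show ?thesis
    using *[THEN spec[of _ R], THEN spec[of _ ys], THEN spec[of _ ys']]
      *[THEN spec[of _ R], THEN spec[of _ ys'], THEN spec[of _ ys]] assms(2,3) eqt_sym eqt_length[OF assms(3)]
    by auto
qed

lemma inv_mono:
  assumes "inv_type M n p" "dfn UNIV n Q" "dfn UNIV n R" "\<And>x. length x = n \<Longrightarrow> Q x \<Longrightarrow> R x" "p Q"
  shows "p R"
proof (rule ccontr)
  assume "\<not> p R"
  then have "p (\<lambda>x. \<not> R x)" using inv_not[OF assms(1,3)] by simp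
  from inv_conj[OF assms(1,2) dfn_not[OF assms(3)] assms(5) this]
  have "\<exists>x. length x = n \<and> Q x \<and> \<not> R x"
    by (rule inv_sat[OF assms(1) dfn_conj[OF assms(2) dfn_not[OF assms(3)]]])
  then obtain x where "length x = n" "Q x" "\<not> R x" by (elim exE conjE)
  then show False using assms(4)[of x] by simp
qed

text \<open>Predicates that agree on lists of the right length need not be equal as functions;
  satisfiability of \<open>p\<close> prevents it from separating them.\<close>

lemma inv_cong:
  assumes "inv_type M n p" "dfn UNIV n Q" "\<And>x. length x = n \<Longrightarrow> Q x = R x"
  shows "p Q = p R"
proof -
  have R: "dfn UNIV n R" by (rule dfn_cong[OF assms(2,3)])
  show ?thesis
  proof
    assume "p Q" then show "p R" using assms(3) by (intro inv_mono[OF assms(1,2) R]) auto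
  next
    assume "p R" then show "p Q" using assms(3) by (intro inv_mono[OF assms(1) R assms(2)]) auto
  qed
qed

lemma inv_True: "inv_type M n p \<Longrightarrow> p (\<lambda>x. True)"
  using inv_not[of M n p "\<lambda>x. True"] inv_sat[of M n p "\<lambda>x. \<not> True"] dfn_True[of UNIV n] dfn_const[of UNIV n False] by auto

lemma inv_ball:
  assumes "inv_type M n p" "finite J" "\<And>i. i \<in> J \<Longrightarrow> dfn UNIV n (Q i)" "\<And>i. i \<in> J \<Longrightarrow> p (Q i)"
  shows "p (\<lambda>x. \<forall>i\<in>J. Q i x)"
  using assms(2,3,4)
proof (induction J rule: finite_induct)
  case empty then show ?case using inv_True[OF assms(1)] by simp
next
  case (insert j J)
  have "p (\<lambda>x. Q j x \<and> (\<forall>i\<in>J. Q i x))"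
    using insert by (intro inv_conj[OF assms(1)] dfn_ball) auto
  then show ?case by simp
qed

text \<open>The parameters of \<open>R\<close> from \<open>M\<close> are appended to both
  \<open>ys\<close> and \<open>ys'\<close>, which keeps the two types over \<open>M\<close> equal
  and leaves a parameter-free predicate.\<close>

lemma inv_inv:
  assumes "inv_type M n p" "dfn M (n + length ys) R" "eqt M ys ys'"
  shows "p (\<lambda>x. R (x @ ys)) = p (\<lambda>x. R (x @ ys'))"
proof -
  have l: "length ys' = length ys" using eqt_length[OF assms(3)] by simp
  have "dfn ({} \<union> M) (n + length ys) R" using assms(2) by simp
  from dfn_finite[OF this] obtain ms where ms: "set ms \<subseteq> M" "dfn ({} \<union> set ms) (n + length ys) R" by auto
  from dfn_params[OF ms(2)] obtain R' where R': "dfn {} (n + length ys + length ms) R'"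
    "\<forall>xs. length xs = n + length ys \<longrightarrow> R xs = R' (xs @ ms)" by (elim exE conjE)
  have d: "dfn UNIV n (\<lambda>x. R (x @ zs))" if "length zs = length ys" for zs
    by (rule dfn_sub[OF assms(2)]) (use that in \<open>auto intro!: sub_append sub_id sub_const\<close>)
  have "p (\<lambda>x. R (x @ ys)) = p (\<lambda>x. R' (x @ (ys @ ms)))"
    using R'(2) by (intro inv_cong[OF assms(1) d]) auto
  also have "\<dots> = p (\<lambda>x. R' (x @ (ys' @ ms)))"
    by (rule inv_inv0[OF assms(1)]) (use R'(1) eqt_append_const[OF assms(3) ms(1)] in \<open>auto simp: add.assoc\<close>)
  also have "\<dots> = p (\<lambda>x. R (x @ ys'))"
    using R'(2) l by (intro inv_cong[OF assms(1) d, symmetric]) auto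
  finally show ?thesis .
qed

lemma real_length: "realizer p n A c \<Longrightarrow> length c = n"
  by (simp add: realizer_def)

lemma realD:
  assumes "realizer p n A c" "dfn A n Q" "p Q" shows "Q c"
proof -
  have "\<forall>Q. dfn A n Q \<longrightarrow> p Q \<longrightarrow> Q c" using assms(1) unfolding realizer_def ..
  from this[THEN spec[of _ Q]] assms(2,3) show ?thesis by simp
qed

lemma realI:
  assumes "length c = n" "\<And>Q. dfn A n Q \<Longrightarrow> p Q \<Longrightarrow> Q c" shows "realizer p n A c"
  unfolding realizer_def
proof (intro conjI allI impI)
  fix Q assume "dfn A n Q" "p Q" then show "Q c" by (rule assms(2))
qed (rule assms(1))

lemma real_iff: "inv_type M n p \<Longrightarrow> realizer p n A c \<Longrightarrow> dfn A n Q \<Longrightarrow> p Q = Q c"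
  using realD[of p n A c Q] realD[of p n A c "\<lambda>x. \<not> Q x"] inv_not[of M n p Q] dfn_not[of A n Q] dfn_mono[of A n Q UNIV] by auto

lemma real_mono:
  assumes "realizer p n B c" "A \<subseteq> B" shows "realizer p n A c"
proof (rule realI)
  fix Q assume Q: "dfn A n Q" "p Q"
  show "Q c" by (rule realD[OF assms(1) dfn_mono[OF Q(1) assms(2)] Q(2)])
qed (rule real_length[OF assms(1)])

lemma real_exists:
  assumes "inv_type M n p" "small A"
  shows "\<exists>c. realizer p n A c"
proof -
  have "\<exists>x. length x = n \<and> (\<forall>Q\<in>{Q. dfn A n Q \<and> p Q}. Q x)"
  proof (rule saturation_family[OF assms(2), where Q = "\<lambda>Q. Q"])
    fix Q assume "Q \<in> {Q. dfn A n Q \<and> p Q}" then show "dfn A n Q" by simp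
  next
    fix J assume J: "finite J" "J \<subseteq> {Q. dfn A n Q \<and> p Q}"
    have *: "dfn UNIV n Q \<and> p Q" if "Q \<in> J" for Q
      using subsetD[OF J(2) that] dfn_mono[of A n Q UNIV] by simp
    have "p (\<lambda>x. \<forall>Q\<in>J. Q x)" by (rule inv_ball[OF assms(1) J(1)]) (use * in simp_all)
    moreover have "dfn UNIV n (\<lambda>x. \<forall>Q\<in>J. Q x)" by (rule dfn_ball[OF J(1)]) (use * in simp)
    ultimately show "\<exists>x. length x = n \<and> (\<forall>Q\<in>J. Q x)" using inv_sat[OF assms(1), of "\<lambda>x. \<forall>Q\<in>J. Q x"] by simp
  qed
  then obtain x where "length x = n" "\<forall>Q\<in>{Q. dfn A n Q \<and> p Q}. Q x" by (elim exE conjE)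
  have "realizer p n A x"
  proof (rule realI)
    fix Q assume "dfn A n Q" "p Q"
    then have "Q \<in> {Q. dfn A n Q \<and> p Q}" by simp
    from bspec[OF \<open>\<forall>Q\<in>{Q. dfn A n Q \<and> p Q}. Q x\<close> this] show "Q x" .
  qed fact
  then show ?thesis ..
qed

text \<open>Stationarity: by invariance, membership in \<open>p\<close> of a condition with
  parameters \<open>ys\<close> depends only on the type of \<open>ys\<close> over
  \<open>M\<close>.\<close>

lemma real_eqt:
  assumes "inv_type M n p" "eqt M ys ys'" "realizer p n (M \<union> set ys) c" "realizer p n (M \<union> set ys') c'"
  shows "eqt M (c @ ys) (c' @ ys')"
proof (rule eqtI)
  have l: "length c = n" "length c' = n" "length ys' = length ys"
    using real_length[OF assms(3)] real_length[OF assms(4)] eqt_length[OF assms(2)] by auto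
  show "length (c @ ys) = length (c' @ ys')" using l by simp
  fix Q assume Q: "dfn M (length (c @ ys)) Q" "Q (c @ ys)"
  have d: "dfn (M \<union> set zs) n (\<lambda>x. Q (x @ zs))" if "length zs = length ys" for zs
    by (rule dfn_sub[OF Q(1)]) (use that l in \<open>auto intro!: sub_append sub_id sub_const\<close>)
  have "p (\<lambda>x. Q (x @ ys))" using real_iff[OF assms(1,3) d[OF refl]] Q(2) by simp
  then have "p (\<lambda>x. Q (x @ ys'))" using inv_inv[OF assms(1) _ assms(2), of Q] Q(1) l by simp
  then show "Q (c' @ ys')" using real_iff[OF assms(1,4) d[OF l(3)]] by simp
qed

text \<open>Morley sequences are kept finite; by compactness only finite initial segments matter for
  consistency.\<close>

definition mor :: "'m set \<Rightarrow> nat \<Rightarrow> (('m list \<Rightarrow> bool) \<Rightarrow> bool) \<Rightarrow> 'm list list \<Rightarrow> bool" where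
  "mor M n p cs \<longleftrightarrow> (\<forall>i<length cs. realizer p n (M \<union> set (concat (take i cs))) (cs ! i))"

lemma mor_Nil: "mor M n p []" by (simp add: mor_def)

lemma mor_snoc: "mor M n p (cs @ [c]) \<longleftrightarrow> mor M n p cs \<and> realizer p n (M \<union> set (concat cs)) c"
  unfolding mor_def by (auto simp: nth_append less_Suc_eq)

lemma mor_filter: "mor M n p cs \<Longrightarrow> mor M n p (filter P cs)"
proof (induction cs rule: rev_induct)
  case (snoc c cs)
  then have *: "mor M n p (filter P cs)" "realizer p n (M \<union> set (concat cs)) c" by (auto simp: mor_snoc)
  have "realizer p n (M \<union> set (concat (filter P cs))) c" by (rule real_mono[OF *(2)]) auto
  with * show ?case by (simp add: mor_snoc)
qed simp

lemma mor_take: "mor M n p cs \<Longrightarrow> mor M n p (take k cs)"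
  unfolding mor_def by (auto simp: min_def)

lemma mor_real: "mor M n p cs \<Longrightarrow> c \<in> set cs \<Longrightarrow> realizer p n M c"
  unfolding mor_def by (metis in_set_conv_nth real_mono Un_upper1)

text \<open>Dependent choice in which each choice sees the whole history; \<open>g\<close> builds
  the histories first and \<open>f\<close> reads off their last entries.\<close>

lemma exists_seq:
  assumes "\<And>l. \<exists>x. P l x"
  shows "\<exists>f. \<forall>i::nat. P (map f [0..<i]) (f i)"
proof -
  define g where "g = rec_nat [] (\<lambda>_ l. l @ [SOME x. P l x])"
  define f where "f i = (SOME x. P (g i) x)" for i
  have "g i = map f [0..<i]" for i
    by (induction i) (simp_all add: g_def f_def)
  moreover have "P (g i) (f i)" for i
    unfolding f_def using assms by (rule someI_ex)
  ultimately show ?thesis by (intro exI[of _ f]) simp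
qed

lemma morley_exists:
  assumes "inv_type M n p" "small M" "realizer p n M b"
  shows "\<exists>f. f 0 = b \<and> (\<forall>N. mor M n p (map f [0..<N]))"
proof -
  have "\<exists>x. if l = [] then x = b else realizer p n (M \<union> set (concat l)) x" for l
    using real_exists[OF assms(1), of "M \<union> set (concat l)"] small_Un[OF assms(2) small_finite] by (cases "l = []") auto
  from exists_seq[of "\<lambda>l x. if l = [] then x = b else realizer p n (M \<union> set (concat l)) x", OF this]
  obtain f where f: "\<forall>i. if map f [0..<i] = [] then f i = b else realizer p n (M \<union> set (concat (map f [0..<i]))) (f i)"
    by blast
  have f0: "f 0 = b" using f[THEN spec, of 0] by simp
  have "realizer p n (M \<union> set (concat (map f [0..<i]))) (f i)" for i
    using f[THEN spec, of i] assms(3) by (cases i) auto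
  then have "mor M n p (map f [0..<N])" for N
    by (induction N) (simp_all add: mor_Nil mor_snoc)
  with f0 show ?thesis by blast
qed

lemma mor_exists:
  assumes "inv_type M n p" "small M"
  shows "\<exists>cs. mor M n p cs \<and> length cs = N"
proof -
  obtain b where "realizer p n M b" using real_exists[OF assms] ..
  from morley_exists[OF assms this] obtain f where "mor M n p (map f [0..<N])" by blast
  then show ?thesis by (intro exI[of _ "map f [0..<N]"]) simp
qed

lemma mor_eqt:
  assumes "inv_type M n p"
  shows "mor M n p cs \<Longrightarrow> mor M n p cs' \<Longrightarrow> length cs = length cs' \<Longrightarrow> eqt M (concat cs) (concat cs')"
proof (induction cs arbitrary: cs' rule: rev_induct)
  case Nil then show ?case by (simp add: eqt_refl)
next
  case (snoc c cs)
  then obtain ds d where cs': "cs' = ds @ [d]" by (cases cs' rule: rev_cases) auto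
  have *: "mor M n p cs" "realizer p n (M \<union> set (concat cs)) c" "mor M n p ds" "realizer p n (M \<union> set (concat ds)) d"
    using snoc.prems unfolding cs' mor_snoc by auto
  have e: "eqt M (concat cs) (concat ds)" using snoc.IH[OF *(1,3)] snoc.prems(3) cs' by simp
  have "eqt M (c @ concat cs) (d @ concat ds)" by (rule real_eqt[OF assms e *(2,4)])
  then have "eqt M (concat cs @ c) (concat ds @ d)"
    by (rule eqt_swap) (use real_length[OF *(2)] real_length[OF *(4)] in simp)
  then show ?case by (simp add: cs')
qed


section \<open>Consistency along Morley sequences\<close>

text \<open>The negation of dividing along \<open>p\<close>: the first \<open>k\<close> coordinates
  of \<open>R\<close> are the object variables, the other \<open>n\<close> the parameter that runs
  through Morley sequences.\<close>

definition CP :: "'m set \<Rightarrow> nat \<Rightarrow> (('m list \<Rightarrow> bool) \<Rightarrow> bool) \<Rightarrow> nat \<Rightarrow> ('m list \<Rightarrow> bool) \<Rightarrow> bool" where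
  "CP M n p k R \<longleftrightarrow> (\<forall>cs. mor M n p cs \<longrightarrow> (\<exists>x. length x = k \<and> (\<forall>c\<in>set cs. R (x @ c))))"

lemma CPD: "CP M n p k R \<Longrightarrow> mor M n p cs \<Longrightarrow> \<exists>x. length x = k \<and> (\<forall>c\<in>set cs. R (x @ c))"
  by (simp add: CP_def)

lemma take_drop_concat:
  "(\<forall>c\<in>set cs. length c = n) \<Longrightarrow> i < length cs \<Longrightarrow> take n (drop (i * n) (concat cs)) = cs ! i"
proof (induction cs arbitrary: i)
  case (Cons c cs)
  then show ?case by (cases i) (auto simp: drop_append)
qed simp

text \<open>Having a common solution is a definable property of the concatenated sequence, and
  Morley sequences of equal length have the same type over \<open>M\<close>.\<close>

lemma mor_transfer:
  assumes p: "inv_type M n p" and R: "dfn M (k + n) R"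
    and cs: "mor M n p cs" "mor M n p cs'" "length cs = length cs'"
    and x: "\<exists>x. length x = k \<and> (\<forall>c\<in>set cs. R (x @ c))"
  shows "\<exists>x. length x = k \<and> (\<forall>c\<in>set cs'. R (x @ c))"
proof -
  let ?N = "length cs"
  let ?Q = "\<lambda>z. \<exists>x. length x = k \<and> (\<forall>i\<in>{..<?N}. R (take k (drop (?N * n) (z @ x)) @ take n (drop (i * n) (z @ x))))"
  have l: "\<forall>c\<in>set cs. length c = n" "\<forall>c\<in>set cs'. length c = n"
    by (auto dest!: mor_real[OF cs(1)] mor_real[OF cs(2)] real_length)
  have lc: "length (concat ds) = length ds * n" if "\<forall>c\<in>set ds. length c = n" for ds :: "'m list list"
    using that by (induction ds) auto
  have "dfn M (?N * n) ?Q"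
  proof (intro dfn_ex dfn_ball finite_lessThan dfn_sub[OF R])
    fix i assume "i \<in> {..<?N}"
    then have "i * n + n \<le> ?N * n" by (metis lessThan_iff mult_Suc add.commute mult_le_mono1 Suc_leI)
    then show "sub M (?N * n + k) (k + n) (\<lambda>xs. take k (drop (?N * n) xs) @ take n (drop (i * n) xs))"
      by (intro sub_append sub_mid) auto
  qed simp
  moreover have Q: "?Q (concat ds) \<longleftrightarrow> (\<exists>x. length x = k \<and> (\<forall>c\<in>set ds. R (x @ c)))"
    if "length ds = ?N" "\<forall>c\<in>set ds. length c = n" for ds
  proof -
    have "(\<forall>i\<in>{..<?N}. R (take k (drop (?N * n) (concat ds @ x)) @ take n (drop (i * n) (concat ds @ x))))
       \<longleftrightarrow> (\<forall>c\<in>set ds. R (x @ c))" if "length x = k" for x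
    proof -
      have "take n (drop (i * n) (concat ds @ x)) = ds ! i" if "i < ?N" for i
      proof -
        have "i * n + n \<le> ?N * n" using that by (metis mult_Suc add.commute mult_le_mono1 Suc_leI)
        then show ?thesis
          using take_drop_concat[of ds n i] lc[of ds] \<open>length ds = ?N\<close> \<open>\<forall>c\<in>set ds. length c = n\<close> \<open>i < ?N\<close>
          by simp
      qed
      moreover have "take k (drop (?N * n) (concat ds @ x)) = x"
        using lc[of ds] \<open>length ds = ?N\<close> \<open>\<forall>c\<in>set ds. length c = n\<close> \<open>length x = k\<close> by simp
      ultimately show ?thesis
        using \<open>length ds = ?N\<close> by (simp del: drop_append take_append add: all_set_conv_all_nth) auto
    qed
    then show ?thesis by auto
  qed
  moreover have "eqt M (concat cs) (concat cs')" by (rule mor_eqt[OF p cs])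
  ultimately have "?Q (concat cs) = ?Q (concat cs')"
    using eqtD[of M "concat cs" "concat cs'" ?Q] lc[OF l(1)] by simp
  with x show ?thesis using Q[of cs] Q[of cs'] l cs(3) by simp
qed

lemma CPI:
  assumes "inv_type M n p" "dfn M (k + n) R"
    and "\<And>N. \<exists>cs. mor M n p cs \<and> length cs = N \<and> (\<exists>x. length x = k \<and> (\<forall>c\<in>set cs. R (x @ c)))"
  shows "CP M n p k R"
  unfolding CP_def
proof (intro allI impI)
  fix cs assume "mor M n p cs"
  from assms(3)[of "length cs"]
  obtain ds where "mor M n p ds \<and> length ds = length cs \<and> (\<exists>x. length x = k \<and> (\<forall>c\<in>set ds. R (x @ c)))" ..
  then have ds: "mor M n p ds" "length ds = length cs" "\<exists>x. length x = k \<and> (\<forall>c\<in>set ds. R (x @ c))" by simp_all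
  show "\<exists>x. length x = k \<and> (\<forall>c\<in>set cs. R (x @ c))"
    by (rule mor_transfer[OF assms(1,2) ds(1) \<open>mor M n p cs\<close> ds(2,3)])
qed

lemma CP_mono:
  assumes "CP M n p k R" "\<And>x c. length x = k \<Longrightarrow> realizer p n M c \<Longrightarrow> R (x @ c) \<Longrightarrow> R' (x @ c)"
  shows "CP M n p k R'"
  unfolding CP_def
proof (intro allI impI)
  fix cs assume cs: "mor M n p cs"
  obtain x where x: "length x = k" "\<forall>c\<in>set cs. R (x @ c)" using CPD[OF assms(1) cs] by (elim exE conjE)
  have "R' (x @ c)" if "c \<in> set cs" for c
    by (rule assms(2)[OF x(1) mor_real[OF cs that] bspec[OF x(2) that]])
  with x(1) show "\<exists>x. length x = k \<and> (\<forall>c\<in>set cs. R' (x @ c))" by (intro exI[of _ x]) simp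
qed

text \<open>If one Morley sequence has no common solution, every one that is at least as long has
  none, since its initial segment has the same type. This gives the uniform bound needed for a
  pigeonhole argument.\<close>

lemma not_CP:
  assumes "inv_type M n p" "dfn M (k + n) R" "\<not> CP M n p k R"
  shows "\<exists>N. \<forall>cs. mor M n p cs \<longrightarrow> N \<le> length cs \<longrightarrow> (\<nexists>x. length x = k \<and> (\<forall>c\<in>set cs. R (x @ c)))"
proof -
  obtain ds where ds: "mor M n p ds" "\<nexists>x. length x = k \<and> (\<forall>c\<in>set ds. R (x @ c))"
    using assms(3) unfolding CP_def by (simp only: not_all not_imp) (elim exE conjE)
  have False if cs: "mor M n p cs" "length ds \<le> length cs" and x: "length x = k" "\<forall>c\<in>set cs. R (x @ c)" for cs x
  proof -
    have "\<exists>x. length x = k \<and> (\<forall>c\<in>set (take (length ds) cs). R (x @ c))"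
      using x by (intro exI[of _ x]) (auto dest!: in_set_takeD)
    from mor_transfer[OF assms(1,2) mor_take[OF cs(1)] ds(1) _ this] show False using ds(2) cs(2) by simp
  qed
  then show ?thesis by (intro exI[of _ "length ds"]) auto
qed

text \<open>Take a Morley sequence of length \<open>N1 + N2\<close> and colour its entries by the
  disjunct satisfied at a common solution. Subsequences of Morley sequences are again Morley, so one
  colour class exceeds its bound.\<close>

lemma CP_disj:
  assumes "inv_type M n p" "small M" "dfn M (k + n) R1" "dfn M (k + n) R2" "CP M n p k (\<lambda>z. R1 z \<or> R2 z)"
  shows "CP M n p k R1 \<or> CP M n p k R2"
proof (rule ccontr)
  assume "\<not> (CP M n p k R1 \<or> CP M n p k R2)"
  then have n1: "\<not> CP M n p k R1" and n2: "\<not> CP M n p k R2" by auto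
  obtain N1 where N1: "\<forall>cs. mor M n p cs \<longrightarrow> N1 \<le> length cs \<longrightarrow> (\<nexists>x. length x = k \<and> (\<forall>c\<in>set cs. R1 (x @ c)))"
    using not_CP[OF assms(1,3) n1] by (elim exE)
  obtain N2 where N2: "\<forall>cs. mor M n p cs \<longrightarrow> N2 \<le> length cs \<longrightarrow> (\<nexists>x. length x = k \<and> (\<forall>c\<in>set cs. R2 (x @ c)))"
    using not_CP[OF assms(1,4) n2] by (elim exE)
  obtain cs where cs: "mor M n p cs" "length cs = N1 + N2" using mor_exists[OF assms(1,2), of "N1 + N2"] by (elim exE conjE)
  obtain x where x: "length x = k" "\<forall>c\<in>set cs. R1 (x @ c) \<or> R2 (x @ c)" using CPD[OF assms(5) cs(1)] by (elim exE conjE)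
  let ?P = "\<lambda>c. R1 (x @ c)"
  have "length (filter ?P cs) + length (filter (\<lambda>c. \<not> ?P c) cs) = N1 + N2"
    using sum_length_filter_compl[of ?P cs] cs(2) by simp
  then consider "N1 \<le> length (filter ?P cs)" | "N2 \<le> length (filter (\<lambda>c. \<not> ?P c) cs)" by linarith
  then show False
  proof cases
    case 1
    have "\<exists>x. length x = k \<and> (\<forall>c\<in>set (filter ?P cs). R1 (x @ c))" using x(1) by (intro exI[of _ x]) simp
    then show False using N1[THEN spec, of "filter ?P cs"] mor_filter[OF cs(1)] 1 by simp
  next
    case 2
    have "\<exists>x. length x = k \<and> (\<forall>c\<in>set (filter (\<lambda>c. \<not> ?P c) cs). R2 (x @ c))" using x by (intro exI[of _ x]) auto
    then show False using N2[THEN spec, of "filter (\<lambda>c. \<not> ?P c) cs"] mor_filter[OF cs(1)] 2 by simp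
  qed
qed


section \<open>Push-forwards and squares of invariant types\<close>

definition push :: "('m list \<Rightarrow> 'm list) \<Rightarrow> (('m list \<Rightarrow> bool) \<Rightarrow> bool) \<Rightarrow> ('m list \<Rightarrow> bool) \<Rightarrow> bool" where
  "push F p Q = p (\<lambda>x. Q (F x))"

lemma sub_length: "sub A n m F \<Longrightarrow> length x = n \<Longrightarrow> length (F x) = m"
  by (simp add: sub_def)

lemma inv_push:
  assumes "inv_type M n p" "sub M n m F"
  shows "inv_type M m (push F p)"
proof -
  have d: "dfn UNIV n (\<lambda>x. Q (F x))" if "dfn UNIV m Q" for Q
    by (rule dfn_sub[OF that sub_mono[OF assms(2)]]) auto
  show ?thesis
    unfolding inv_type_def push_def
  proof (intro conjI allI impI)
    fix Q assume "dfn UNIV m Q"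
    then show "p (\<lambda>x. \<not> Q (F x)) = (\<not> p (\<lambda>x. Q (F x)))" using inv_not[OF assms(1) d] by simp
  next
    fix Q R assume "dfn UNIV m Q" "dfn UNIV m R" "p (\<lambda>x. Q (F x))" "p (\<lambda>x. R (F x))"
    then show "p (\<lambda>x. Q (F x) \<and> R (F x))" using inv_conj[OF assms(1) d d, of Q R] by simp
  next
    fix Q assume Q: "dfn UNIV m Q" "p (\<lambda>x. Q (F x))"
    obtain x where "length x = n" "Q (F x)" using inv_sat[OF assms(1) d[OF Q(1)] Q(2)] by (elim exE conjE)
    then show "\<exists>x. length x = m \<and> Q x" using sub_length[OF assms(2)] by (intro exI[of _ "F x"]) simp
  next
    fix R ys ys' assume R: "dfn {} (m + length ys) R" "eqt M ys ys'" "p (\<lambda>x. R (F x @ ys))"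
    let ?R = "\<lambda>z. R (F (take n z) @ drop n z)"
    have dR: "dfn M (n + length ys) ?R"
      by (rule dfn_sub[OF R(1)])
         (auto intro!: sub_append sub_comp[OF _ assms(2)] sub_take sub_drop)
    have du: "dfn UNIV n (\<lambda>x. R (F x @ zs))" if "length zs = length ys" for zs
      by (rule dfn_sub[OF R(1)]) (use that in \<open>auto intro!: sub_append sub_mono[OF assms(2)] sub_const\<close>)
    have "p (\<lambda>x. R (F x @ ys)) = p (\<lambda>x. ?R (x @ ys))"
      by (rule inv_cong[OF assms(1) du]) auto
    also have "\<dots> = p (\<lambda>x. ?R (x @ ys'))" by (rule inv_inv[OF assms(1) dR R(2)])
    also have "\<dots> = p (\<lambda>x. R (F x @ ys'))"
      by (rule inv_cong[OF assms(1) du, symmetric]) (use eqt_length[OF R(2)] in auto)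
    finally show "p (\<lambda>x. R (F x @ ys'))" using R(3) by simp
  qed
qed

lemma real_push:
  assumes "sub M n m F" "M \<subseteq> A" "realizer p n A c"
  shows "realizer (push F p) m A (F c)"
proof (rule realI)
  show "length (F c) = m" by (rule sub_length[OF assms(1) real_length[OF assms(3)]])
  fix Q assume Q: "dfn A m Q" "push F p Q"
  have "dfn A n (\<lambda>x. Q (F x))" by (rule dfn_sub[OF Q(1) sub_mono[OF assms(1,2)]]) auto
  from realD[OF assms(3) this] Q(2) show "Q (F c)" by (simp add: push_def)
qed

lemma sub_set: "sub M n m F \<Longrightarrow> length x = n \<Longrightarrow> set (F x) \<subseteq> M \<union> set x"
proof
  fix y assume F: "sub M n m F" "length x = n" and "y \<in> set (F x)"
  then obtain i where "i < m" "y = F x ! i" by (auto simp: in_set_conv_nth sub_length)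
  then show "y \<in> M \<union> set x" using F unfolding sub_def by force
qed

lemma mor_push:
  assumes "sub M n m F"
  shows "mor M n p cs \<Longrightarrow> mor M m (push F p) (map F cs)"
proof (induction cs rule: rev_induct)
  case Nil then show ?case by (simp add: mor_Nil)
next
  case (snoc c cs)
  then have *: "mor M n p cs" "realizer p n (M \<union> set (concat cs)) c" by (auto simp: mor_snoc)
  have "set (F c) \<subseteq> M \<union> set c" if "c \<in> set cs" for c
    by (rule sub_set[OF assms real_length[OF mor_real[OF *(1) that]]])
  then have "M \<union> set (concat (map F cs)) \<subseteq> M \<union> set (concat cs)" by fastforce
  from real_mono[OF real_push[OF assms _ *(2)] this]
  show ?case using snoc.IH[OF *(1)] by (simp add: mor_snoc)
qed

text \<open>Images of Morley sequences are Morley in the push-forward. The converse need not hold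
  for arbitrary sequences there, but one sequence of each length suffices for consistency.\<close>

lemma CP_push:
  assumes p: "inv_type M n p" "small M" and F: "sub M n m F" and R: "dfn M (k + m) R"
  shows "CP M m (push F p) k R \<longleftrightarrow> CP M n p k (\<lambda>z. R (take k z @ F (drop k z)))"
proof
  assume *: "CP M m (push F p) k R"
  show "CP M n p k (\<lambda>z. R (take k z @ F (drop k z)))"
    unfolding CP_def
  proof (intro allI impI)
    fix cs assume "mor M n p cs"
    from CPD[OF * mor_push[OF F this]] obtain x where "length x = k" "\<forall>c\<in>set (map F cs). R (x @ c)"
      by (elim exE conjE)
    then show "\<exists>x. length x = k \<and> (\<forall>c\<in>set cs. R (take k (x @ c) @ F (drop k (x @ c))))"
      by (intro exI[of _ x]) simp
  qed
next
  assume *: "CP M n p k (\<lambda>z. R (take k z @ F (drop k z)))"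
  show "CP M m (push F p) k R"
  proof (rule CPI[OF inv_push[OF p(1) F] R])
    fix N
    obtain cs where cs: "mor M n p cs" "length cs = N" using mor_exists[OF p, of N] by (elim exE conjE)
    from CPD[OF * cs(1)] obtain x where x: "length x = k"
      "\<forall>c\<in>set cs. R (take k (x @ c) @ F (drop k (x @ c)))" by (elim exE conjE)
    show "\<exists>cs. mor M m (push F p) cs \<and> length cs = N \<and> (\<exists>x. length x = k \<and> (\<forall>c\<in>set cs. R (x @ c)))"
      by (rule exI[of _ "map F cs"], intro conjI exI[of _ x] mor_push[OF F cs(1)]) (use cs x in auto)
  qed
qed

text \<open>The Morley square of \<open>p\<close>: the first half realizes \<open>p\<close> over the
  parameters of \<open>Q\<close>, and the second half realizes \<open>p\<close> over the first half
  in addition. The support \<open>F\<close> is finite so that a realization \<open>c\<close>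
  exists.\<close>

definition sq :: "'m set \<Rightarrow> nat \<Rightarrow> (('m list \<Rightarrow> bool) \<Rightarrow> bool) \<Rightarrow> ('m list \<Rightarrow> bool) \<Rightarrow> bool" where
  "sq M n p Q \<longleftrightarrow> (\<exists>F c. finite F \<and> dfn F (n + n) Q \<and> realizer p n (M \<union> F) c \<and> p (\<lambda>y. Q (c @ y)))"

text \<open>Two realizations of \<open>p\<close> over the support have the same type over
  \<open>M\<close> together with the support, and \<open>p\<close> is invariant.\<close>

lemma sq_indep:
  assumes p: "inv_type M n p"
    and Q: "dfn F (n + n) Q" "finite F" and c: "realizer p n (M \<union> F) c" and c': "realizer p n (M \<union> F) c'"
  shows "p (\<lambda>y. Q (c @ y)) = p (\<lambda>y. Q (c' @ y))"
proof -
  obtain fs where fs: "set fs = F" using finite_list[OF Q(2)] ..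
  have "dfn ({} \<union> set fs) (n + n) Q" using Q(1) fs by simp
  from dfn_params[OF this] obtain Q' where Q': "dfn {} (n + n + length fs) Q'"
    "\<forall>xs. length xs = n + n \<longrightarrow> Q xs = Q' (xs @ fs)" by (elim exE conjE)
  \<comment> \<open>Invariance of \<open>p\<close> is stated with the variable block in front,
    whereas in \<open>Q\<close> the parameter \<open>c\<close> precedes it; \<open>?R\<close>
    exchanges the two blocks.\<close>
  let ?R = "\<lambda>z. Q' ((take n (drop n z) @ take n z) @ drop (n + n) z)"
  have dR: "dfn {} (n + length (c @ fs)) ?R"
    by (rule dfn_sub[OF Q'(1)], intro sub_append sub_mid sub_take sub_drop) (simp_all add: real_length[OF c])
  have du: "dfn UNIV n (\<lambda>y. Q (d @ y))" if "length d = n" for d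
    by (rule dfn_sub[OF Q(1)]) (use that in \<open>auto intro!: sub_append sub_id sub_const\<close>)
  have e: "eqt M (c @ fs) (c' @ fs)" by (rule real_eqt[OF p eqt_refl]) (use c c' fs in auto)
  have "p (\<lambda>y. Q (c @ y)) = p (\<lambda>y. ?R (y @ (c @ fs)))"
    by (rule inv_cong[OF p du]) (use Q'(2) real_length[OF c] in auto)
  also have "\<dots> = p (\<lambda>y. ?R (y @ (c' @ fs)))" by (rule inv_inv0[OF p dR e])
  also have "\<dots> = p (\<lambda>y. Q (c' @ y))"
    by (rule inv_cong[OF p du, symmetric]) (use Q'(2) real_length[OF c'] in auto)
  finally show ?thesis .
qed

text \<open>Two different supports are compared through a realization of \<open>p\<close> over
  both.\<close>

lemma sq_iff:
  assumes p: "inv_type M n p" "small M"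
    and Q: "dfn F (n + n) Q" "finite F" and c: "realizer p n (M \<union> F) c"
  shows "sq M n p Q = p (\<lambda>y. Q (c @ y))"
proof
  assume "p (\<lambda>y. Q (c @ y))" then show "sq M n p Q" unfolding sq_def using Q c by blast
next
  assume "sq M n p Q"
  then obtain F' c' where *: "finite F'" "dfn F' (n + n) Q" "realizer p n (M \<union> F') c'" "p (\<lambda>y. Q (c' @ y))"
    unfolding sq_def by (elim exE conjE)
  have "small (M \<union> (F \<union> F'))" using *(1) Q(2) by (intro small_Un p(2) small_finite) simp_all
  from real_exists[OF p(1) this] obtain d where d: "realizer p n (M \<union> (F \<union> F')) d" ..
  have "p (\<lambda>y. Q (c' @ y)) = p (\<lambda>y. Q (d @ y))"
    by (rule sq_indep[OF p(1) *(2,1,3)]) (rule real_mono[OF d], auto)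
  also have "\<dots> = p (\<lambda>y. Q (c @ y))"
    by (rule sq_indep[OF p(1) Q _ c]) (rule real_mono[OF d], auto)
  finally show "p (\<lambda>y. Q (c @ y))" using *(4) by simp
qed

lemma dfn_support: "dfn UNIV n Q \<Longrightarrow> \<exists>F. finite F \<and> dfn F n Q"
proof -
  assume "dfn UNIV n Q"
  then have "dfn ({} \<union> UNIV) n Q" by simp
  from dfn_finite[OF this] obtain ys where "dfn ({} \<union> set ys) n Q" by (elim exE conjE)
  then show ?thesis by (intro exI[of _ "set ys"]) simp
qed

lemma inv_sq:
  assumes p: "inv_type M n p" "small M"
  shows "inv_type M (n + n) (sq M n p)"
proof -
  have ex: "\<exists>c. realizer p n (M \<union> F) c" if "finite F" for F
    by (rule real_exists[OF p(1)]) (intro small_Un p(2) small_finite that)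
  have du: "dfn UNIV n (\<lambda>y. Q (d @ y))" if "length d = n" "dfn F (n + n) Q" for d F Q
    by (rule dfn_sub[OF that(2)]) (use that in \<open>auto intro!: sub_append sub_id sub_const\<close>)
  show ?thesis
    unfolding inv_type_def
  proof (intro conjI allI impI)
    fix Q assume "dfn UNIV (n + n) Q"
    from dfn_support[OF this] obtain F where F: "finite F" "dfn F (n + n) Q" by (elim exE conjE)
    obtain c where c: "realizer p n (M \<union> F) c" using ex[OF F(1)] ..
    show "sq M n p (\<lambda>x. \<not> Q x) = (\<not> sq M n p Q)"
      using inv_not[OF p(1) du[OF real_length[OF c] F(2)]]
      unfolding sq_iff[OF p F(2,1) c] sq_iff[OF p dfn_not[OF F(2)] F(1) c] .
  next
    fix Q R assume "dfn UNIV (n + n) Q" "dfn UNIV (n + n) R" and *: "sq M n p Q" "sq M n p R"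
    from dfn_support[OF this(1)] obtain F1 where F1: "finite F1" "dfn F1 (n + n) Q" by (elim exE conjE)
    from dfn_support[OF \<open>dfn UNIV (n + n) R\<close>] obtain F2 where F2: "finite F2" "dfn F2 (n + n) R" by (elim exE conjE)
    let ?F = "F1 \<union> F2"
    have F: "finite ?F" "dfn ?F (n + n) Q" "dfn ?F (n + n) R"
      using F1 F2 dfn_mono[OF F1(2), of ?F] dfn_mono[OF F2(2), of ?F] by simp_all
    obtain c where c: "realizer p n (M \<union> ?F) c" using ex[OF F(1)] ..
    have "p (\<lambda>y. Q (c @ y) \<and> R (c @ y))"
      by (rule inv_conj[OF p(1) du[OF real_length[OF c] F(2)] du[OF real_length[OF c] F(3)]])
         (use * in \<open>simp_all only: sq_iff[OF p F(2,1) c] sq_iff[OF p F(3,1) c]\<close>)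
    then show "sq M n p (\<lambda>x. Q x \<and> R x)"
      using sq_iff[OF p dfn_conj[OF F(2,3)] F(1) c] by simp
  next
    fix Q assume "dfn UNIV (n + n) Q" and *: "sq M n p Q"
    from dfn_support[OF this(1)] obtain F where F: "finite F" "dfn F (n + n) Q" by (elim exE conjE)
    obtain c where c: "realizer p n (M \<union> F) c" using ex[OF F(1)] ..
    have "p (\<lambda>y. Q (c @ y))" using * sq_iff[OF p F(2,1) c] by simp
    from inv_sat[OF p(1) du[OF real_length[OF c] F(2)] this] obtain y where "length y = n" "Q (c @ y)"
      by (elim exE conjE)
    then show "\<exists>x. length x = n + n \<and> Q x" using real_length[OF c] by (intro exI[of _ "c @ y"]) simp
  next
    fix R ys ys'
    assume R: "dfn {} (n + n + length ys) R" and e: "eqt M ys ys'" and *: "sq M n p (\<lambda>x. R (x @ ys))"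
    have l: "length ys' = length ys" using eqt_length[OF e] by simp
    have F: "dfn (set zs) (n + n) (\<lambda>x. R (x @ zs))" if "length zs = length ys" for zs
      by (rule dfn_sub[OF R]) (use that in \<open>auto intro!: sub_append sub_id sub_const\<close>)
    obtain c where c: "realizer p n (M \<union> set ys) c" using ex[of "set ys"] by auto
    obtain c' where c': "realizer p n (M \<union> set ys') c'" using ex[of "set ys'"] by auto
    let ?R = "\<lambda>z. R ((take n (drop n z) @ take n z) @ drop (n + n) z)"
    have dR: "dfn {} (n + length (c @ ys)) ?R"
      by (rule dfn_sub[OF R], intro sub_append sub_mid sub_take sub_drop) (simp_all add: real_length[OF c])
    have du: "dfn UNIV n (\<lambda>y. R ((d @ y) @ zs))" if "length d = n" "length zs = length ys" for d zs
      by (rule dfn_sub[OF R], intro sub_append sub_id sub_const) (use that in auto)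
    have "p (\<lambda>y. R ((c @ y) @ ys)) = p (\<lambda>y. ?R (y @ (c @ ys)))"
      by (rule inv_cong[OF p(1) du]) (use real_length[OF c] in auto)
    also have "\<dots> = p (\<lambda>y. ?R (y @ (c' @ ys')))"
      by (rule inv_inv0[OF p(1) dR real_eqt[OF p(1) e c c']])
    also have "\<dots> = p (\<lambda>y. R ((c' @ y) @ ys'))"
      by (rule inv_cong[OF p(1) du, symmetric]) (use real_length[OF c'] l in auto)
    finally show "sq M n p (\<lambda>x. R (x @ ys'))"
      using * sq_iff[OF p F[OF refl] finite_set c] sq_iff[OF p F[OF l] finite_set c'] by simp
  qed
qed

lemma real_sq:
  assumes p: "inv_type M n p" "small M" and "M \<subseteq> A" and c: "realizer p n A c" and d: "realizer p n (A \<union> set c) d"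
  shows "realizer (sq M n p) (n + n) A (c @ d)"
proof (rule realI)
  show "length (c @ d) = n + n" using real_length[OF c] real_length[OF d] by simp
  fix Q assume Q: "dfn A (n + n) Q" "sq M n p Q"
  have "dfn ({} \<union> A) (n + n) Q" using Q(1) by simp
  from dfn_finite[OF this] obtain fs where fs: "set fs \<subseteq> A" "dfn (set fs) (n + n) Q" by auto
  have "realizer p n (M \<union> set fs) c" by (rule real_mono[OF c]) (use fs assms(3) in auto)
  from sq_iff[OF p fs(2) finite_set this] Q(2) have *: "p (\<lambda>y. Q (c @ y))" by simp
  have "dfn (A \<union> set c) n (\<lambda>y. Q (c @ y))"
    by (rule dfn_sub[OF Q(1)]) (use real_length[OF c] in \<open>auto intro!: sub_append sub_id sub_const\<close>)
  from realD[OF d this *] show "Q (c @ d)" .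
qed

text \<open>Consecutive pairs of a Morley sequence in \<open>p\<close> form a Morley sequence in its
  square.\<close>

lemma mor_sq_exists:
  assumes p: "inv_type M n p" "small M"
  shows "\<exists>cs ds. mor M n p cs \<and> mor M (n + n) (sq M n p) ds \<and> length ds = N \<and> set (concat ds) \<subseteq> set (concat cs)
     \<and> (\<forall>d\<in>set ds. \<exists>c\<in>set cs. \<exists>c'\<in>set cs. d = c @ c')"
proof (induction N)
  case 0 then show ?case by (intro exI[of _ "[]"]) (simp add: mor_Nil)
next
  case (Suc N)
  then obtain cs ds where IH: "mor M n p cs" "mor M (n + n) (sq M n p) ds" "length ds = N"
    "set (concat ds) \<subseteq> set (concat cs)" "\<forall>d\<in>set ds. \<exists>c\<in>set cs. \<exists>c'\<in>set cs. d = c @ c'" by (elim exE conjE)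
  have "small (M \<union> set (concat cs))" by (intro small_Un p(2) small_finite) simp
  from real_exists[OF p(1) this] obtain c where c: "realizer p n (M \<union> set (concat cs)) c" ..
  have "small (M \<union> set (concat cs) \<union> set c)" by (intro small_Un p(2) small_finite) simp_all
  from real_exists[OF p(1) this] obtain d where d: "realizer p n (M \<union> set (concat cs) \<union> set c) d" ..
  have "realizer (sq M n p) (n + n) (M \<union> set (concat cs)) (c @ d)" by (rule real_sq[OF p _ c d]) simp
  then have "realizer (sq M n p) (n + n) (M \<union> set (concat ds)) (c @ d)" by (rule real_mono) (use IH(4) in auto)
  then have 1: "mor M (n + n) (sq M n p) (ds @ [c @ d])" using IH(2) by (simp add: mor_snoc)
  have "mor M n p (cs @ [c])" using IH(1) c by (simp add: mor_snoc)
  moreover have "realizer p n (M \<union> set (concat (cs @ [c]))) d" by (rule real_mono[OF d]) auto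
  ultimately have 2: "mor M n p ((cs @ [c]) @ [d])" by (simp only: mor_snoc)
  have 3: "\<forall>e\<in>set (ds @ [c @ d]). \<exists>c'\<in>set ((cs @ [c]) @ [d]). \<exists>c''\<in>set ((cs @ [c]) @ [d]). e = c' @ c''"
  proof
    fix e assume "e \<in> set (ds @ [c @ d])"
    then consider "e \<in> set ds" | "e = c @ d" by auto
    then show "\<exists>c'\<in>set ((cs @ [c]) @ [d]). \<exists>c''\<in>set ((cs @ [c]) @ [d]). e = c' @ c''"
    proof cases
      case 1
      then obtain c' c'' where "c' \<in> set cs" "c'' \<in> set cs" "e = c' @ c''" using IH(5) by blast
      then show ?thesis by (intro bexI[of _ c'] bexI[of _ c'']) auto
    next
      case 2 then show ?thesis by (intro bexI[of _ c] bexI[of _ d]) auto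
    qed
  qed
  have 4: "set (concat (ds @ [c @ d])) \<subseteq> set (concat ((cs @ [c]) @ [d]))" using IH(4) by auto
  have 5: "length (ds @ [c @ d]) = Suc N" using IH(3) by simp
  show ?case using 1 2 3 4 5 by blast
qed

text \<open>A common solution along a sequence in \<open>p\<close> solves both instances at each
  pair cut from it, so two instances stay jointly consistent along the square.\<close>

lemma CP_sq:
  assumes p: "inv_type M n p" "small M" and R: "dfn M (k + n) R" and cp: "CP M n p k R"
  shows "CP M (n + n) (sq M n p) k (\<lambda>z. R (take k z @ take n (drop k z)) \<and> R (take k z @ drop (k + n) z))"
    (is "CP M _ _ _ ?R2")
proof (rule CPI[OF inv_sq[OF p]])
  show "dfn M (k + (n + n)) ?R2"
  proof (rule dfn_conj)
    show "dfn M (k + (n + n)) (\<lambda>z. R (take k z @ take n (drop k z)))"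
      by (rule dfn_sub[OF R], intro sub_append sub_mid sub_take) simp_all
    show "dfn M (k + (n + n)) (\<lambda>z. R (take k z @ drop (k + n) z))"
      by (rule dfn_sub[OF R], intro sub_append sub_drop sub_take) simp_all
  qed
  fix N
  obtain cs ds where *: "mor M n p cs" "mor M (n + n) (sq M n p) ds" "length ds = N"
     "\<forall>d\<in>set ds. \<exists>c\<in>set cs. \<exists>c'\<in>set cs. d = c @ c'" using mor_sq_exists[OF p, of N] by (elim exE conjE)
  obtain x where x: "length x = k" "\<forall>c\<in>set cs. R (x @ c)" using CPD[OF cp *(1)] by (elim exE conjE)
  have "?R2 (x @ d)" if d: "d \<in> set ds" for d
  proof -
    from bspec[OF *(4) d] obtain c c' where c: "c \<in> set cs" "c' \<in> set cs" "d = c @ c'" by (elim bexE)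
    have "length c = n" using real_length[OF mor_real[OF *(1) c(1)]] .
    then show ?thesis using x c by simp
  qed
  then show "\<exists>ds. mor M (n + n) (sq M n p) ds \<and> length ds = N \<and> (\<exists>x. length x = k \<and> (\<forall>c\<in>set ds. ?R2 (x @ c)))"
    using *(2,3) x(1) by (intro exI[of _ ds] conjI exI[of _ x]) simp_all
qed


section \<open>Comparing realizations, reindexing tuples, finite disjunctions\<close>

lemma real_eqt0:
  assumes "inv_type M n p" "realizer p n A c" "realizer p n A c'"
  shows "eqt A c c'"
proof (rule eqtI)
  show "length c = length c'" using real_length[OF assms(2)] real_length[OF assms(3)] by simp
  fix Q assume Q: "dfn A (length c) Q" "Q c"
  then have Q': "dfn A n Q" using real_length[OF assms(2)] by simp
  have "p Q" using real_iff[OF assms(1,2) Q'] Q(2) by simp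
  from realD[OF assms(3) Q' this] show "Q c'" .
qed

lemma real_of_eqt:
  assumes "realizer p n A c" "eqt A c c'"
  shows "realizer p n A c'"
proof (rule realI)
  show "length c' = n" using real_length[OF assms(1)] eqt_length[OF assms(2)] by simp
  fix Q assume Q: "dfn A n Q" "p Q"
  have "dfn A (length c) Q" using Q(1) real_length[OF assms(1)] by simp
  from eqtD[OF assms(2) this] realD[OF assms(1) Q] show "Q c'" by simp
qed

text \<open>Equality with a constant from \<open>A\<close> is definable over
  \<open>A\<close>.\<close>

lemma eqt_in_set:
  assumes "eqt A xs ys" "i < length xs" "xs ! i \<in> A"
  shows "ys ! i = xs ! i"
proof -
  have "dfn A (length xs) (\<lambda>zs. [zs ! i, xs ! i] ! 0 = [zs ! i, xs ! i] ! 1)"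
  proof (rule dfn_sub[OF dfn_eq[of 0 2 1 "{}"]])
    show "sub A (length xs) 2 (\<lambda>zs. [zs ! i, xs ! i])"
      using assms(2,3) by (auto simp: sub_def less_2_cases_iff)
  qed auto
  from eqtD[OF assms(1) this] show ?thesis by simp
qed

lemma eqt_swap23:
  assumes "eqt A (x @ y @ z) (x' @ y' @ z')" "length x = length x'" "length y = length y'"
  shows "eqt A (x @ z @ y) (x' @ z' @ y')"
proof -
  let ?F = "\<lambda>w. take (length x) w @ drop (length x + length y) w @ take (length y) (drop (length x) w)"
  have "sub A (length (x @ y @ z)) (length x + (length z + length y)) ?F"
    by (intro sub_append sub_take sub_drop sub_mid) auto
  from eqt_sub[OF assms(1) this] show ?thesis using assms(2,3) by simp
qed

lemma set_sub:
  assumes "set ys \<subseteq> set xs"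
  shows "\<exists>F. sub {} (length xs) (length ys) F \<and> F xs = ys"
proof -
  have "\<forall>y\<in>set ys. \<exists>i. i < length xs \<and> xs ! i = y" using assms by (auto simp: in_set_conv_nth subset_iff)
  from bchoice[OF this] obtain idx where idx: "\<forall>y\<in>set ys. idx y < length xs \<and> xs ! idx y = y" ..
  have "map (nth xs) (map idx ys) = ys" using idx by (simp add: map_idI)
  moreover have "sub {} (length xs) (length (map idx ys)) (\<lambda>zs. map (nth zs) (map idx ys))"
    by (rule sub_map_nth) (use idx in auto)
  ultimately show ?thesis by (intro exI[of _ "\<lambda>zs. map (nth zs) (map idx ys)"]) simp
qed

text \<open>Induction on binary disjunctions. For the empty disjunction, a Morley sequence of length
  one already has no solution.\<close>

lemma CP_finite_disj:
  assumes p: "inv_type M n p" "small M"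
  shows "finite J \<Longrightarrow> (\<And>i. i \<in> J \<Longrightarrow> dfn M (k + n) (R i)) \<Longrightarrow> CP M n p k (\<lambda>z. \<exists>i\<in>J. R i z) \<Longrightarrow> \<exists>i\<in>J. CP M n p k (R i)"
proof (induction J rule: finite_induct)
  case empty
  obtain cs where cs: "mor M n p cs" "length cs = 1" using mor_exists[OF p, of 1] by (elim exE conjE)
  from CPD[OF empty(2) cs(1)] cs(2) show ?case by (cases cs) auto
next
  case (insert j J)
  have "dfn M (k + n) (\<lambda>z. \<not> (\<forall>i\<in>J. \<not> R i z))"
    by (intro dfn_not dfn_ball insert.hyps insert.prems) simp
  then have d: "dfn M (k + n) (\<lambda>z. \<exists>i\<in>J. R i z)" by simp
  have "CP M n p k (\<lambda>z. R j z \<or> (\<exists>i\<in>J. R i z))" using insert.prems(2) by simp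
  from CP_disj[OF p insert.prems(1) d this] show ?case
    using insert.IH insert.prems(1) by auto
qed

end

section \<open>Least types and independence over a fixed model\<close>

text \<open>What strong witnessing provides at one model: \<open>r b\<close> is the part of the
  global type in the variables of \<open>b\<close>. \<open>r_sub\<close> expresses that all these
  types come from one global type, also when coordinates are repeated or dropped.
  \<open>least0\<close> has parameter-free \<open>R\<close> because the formulas compared by the
  Kim-dividing order carry no parameters besides the tuple itself.\<close>

locale witness = monster L \<kappa> S
  for L :: "('f, 'r) lang" and \<kappa> :: "'k rel" and S :: "('f, 'r, 'm) interp" +
  fixes M :: "'m set" and r :: "'m list \<Rightarrow> ('m list \<Rightarrow> bool) \<Rightarrow> bool"
  assumes small_M: "small M"
    and r_inv: "inv_type M (length b) (r b)"
    and r_real: "realizer (r b) (length b) M b"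
    and r_sub: "sub {} (length b) m F \<Longrightarrow> r (F b) = push F (r b)"
    and least0: "inv_type M (length b) p \<Longrightarrow> realizer p (length b) M b \<Longrightarrow> dfn {} (k + length b) R
      \<Longrightarrow> CP M (length b) p k R \<Longrightarrow> CP M (length b) (r b) k R"
begin

abbreviation "CPr b \<equiv> CP M (length b) (r b)"

text \<open>No formula in the type of \<open>a\<close> over \<open>M\<close> and \<open>b\<close>
  divides along \<open>r b\<close>. Leastness and extension make this Conant-independence of finite
  tuples, see \<open>ind_iff_conant_indep\<close>.\<close>

definition ind :: "'m list \<Rightarrow> 'm list \<Rightarrow> bool" where
  "ind a b \<longleftrightarrow> (\<forall>R. dfn M (length a + length b) R \<longrightarrow> R (a @ b) \<longrightarrow> CPr b (length a) R)"

lemma indD: 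
  assumes "ind a b" "dfn M (length a + length b) R" "R (a @ b)" shows "CPr b (length a) R"
  using assms(1)[unfolded ind_def, THEN spec[of _ R]] assms(2,3) by simp

lemma CPr_sub:
  assumes F: "sub {} (length b) m F" and R: "dfn M (k + m) R"
  shows "CPr (F b) k R \<longleftrightarrow> CPr b k (\<lambda>z. R (take k z @ F (drop k z)))"
  using CP_push[OF r_inv small_M sub_mono[OF F] R] sub_length[OF F refl] by (simp add: r_sub[OF F])

text \<open>A realization of \<open>r (b @ ms)\<close> over \<open>M\<close> ends in
  \<open>ms\<close> itself, because equality with an element of \<open>M\<close> is part of the
  type. Hence \<open>R0\<close> along \<open>b @ ms\<close> is \<open>R\<close> along
  \<open>b\<close>, and coherence removes \<open>ms\<close>.\<close>

lemma CPr_params: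
  assumes ms: "set ms \<subseteq> M" and R: "dfn M (k + length b) R"
    and R0: "\<forall>xs. length xs = k + length b \<longrightarrow> R xs = R0 (xs @ ms)" and cp: "CPr (b @ ms) k R0"
  shows "CPr b k R"
proof -
  let ?n = "length b"
  have T: "sub {} (length (b @ ms)) ?n (take ?n)" by (rule sub_take) simp
  have tb: "take ?n (b @ ms) = b" by simp
  have "CPr (b @ ms) k (\<lambda>z. R (take k z @ take ?n (drop k z)))"
  proof (rule CP_mono[OF cp])
    fix x c assume x: "length x = k" and c: "realizer (r (b @ ms)) (length (b @ ms)) M c" and "R0 (x @ c)"
    have e: "eqt M (b @ ms) c" by (rule real_eqt0[OF r_inv r_real c])
    have l: "length c = ?n + length ms" using eqt_length[OF e] by simp
    have "drop ?n c = ms"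
    proof (rule nth_equalityI)
      fix i assume "i < length (drop ?n c)"
      then have i: "i < length ms" using l by simp
      have "(b @ ms) ! (?n + i) = ms ! i" by simp
      then have "c ! (?n + i) = ms ! i" using eqt_in_set[OF e, of "?n + i"] i subsetD[OF ms nth_mem[OF i]] by simp
      then show "drop ?n c ! i = ms ! i" using l i by simp
    qed (use l in simp)
    then have "c = take ?n c @ ms" by (metis append_take_drop_id)
    then have "R0 ((x @ take ?n c) @ ms)" using \<open>R0 (x @ c)\<close> by (metis append_assoc)
    then have "R (x @ take ?n c)" using R0[THEN spec, of "x @ take ?n c"] x l by simp
    then show "R (take k (x @ c) @ take ?n (drop k (x @ c)))" using x by simp
  qed
  then show ?thesis using CPr_sub[OF T R] unfolding tb by simp
qed

text \<open>Parameters of \<open>R\<close> from \<open>M\<close> are absorbed into the tuple: push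
  \<open>p\<close> forward along appending \<open>ms\<close>, use leastness at
  \<open>b @ ms\<close>, and return to \<open>b\<close>.\<close>

lemma least:
  assumes p: "inv_type M (length b) p" "realizer p (length b) M b" and R: "dfn M (k + length b) R"
    and cp: "CP M (length b) p k R"
  shows "CPr b k R"
proof -
  let ?n = "length b"
  have "dfn ({} \<union> M) (k + ?n) R" using R by simp
  from dfn_finite[OF this] obtain ms where ms: "set ms \<subseteq> M" "dfn ({} \<union> set ms) (k + ?n) R" by (elim exE conjE)
  from dfn_params[OF ms(2)] obtain R0 where R0: "dfn {} (k + ?n + length ms) R0"
    "\<forall>xs. length xs = k + ?n \<longrightarrow> R xs = R0 (xs @ ms)" by (elim exE conjE)
  have R0': "dfn {} (k + length (b @ ms)) R0" "dfn M (k + length (b @ ms)) R0"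
    using R0(1) dfn_mono[OF R0(1), of M] by (simp_all add: add.assoc)
  let ?G = "\<lambda>x. x @ ms"
  have G: "sub M ?n (length (b @ ms)) ?G" using ms(1) by (auto intro!: sub_append sub_id sub_const)
  have "CP M ?n p k (\<lambda>z. R0 (take k z @ ?G (drop k z)))"
  proof (rule CP_mono[OF cp])
    fix x c assume "length x = k" "realizer p ?n M c" "R (x @ c)"
    then show "R0 (take k (x @ c) @ ?G (drop k (x @ c)))"
      using R0(2)[THEN spec, of "x @ c"] real_length[of p ?n M c] by simp
  qed
  then have "CP M (length (b @ ms)) (push ?G p) k R0"
    unfolding CP_push[OF p(1) small_M G R0'(2)] .
  from least0[OF inv_push[OF p(1) G] real_push[OF G subset_refl p(2)] R0'(1) this]
  have "CPr (b @ ms) k R0" .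
  then show ?thesis by (rule CPr_params[OF ms(1) R R0(2)])
qed

text \<open>\<open>r b\<close> and \<open>r b'\<close> may be different types, but
  \<open>r b\<close> also extends the type of \<open>b'\<close>, so leastness of \<open>r b'\<close>
  transfers consistency.\<close>

lemma ind_eqt:
  assumes "ind a b" "eqt M (a @ b) (a' @ b')" "length a = length a'"
  shows "ind a' b'"
  unfolding ind_def
proof (intro allI impI)
  fix R assume R: "dfn M (length a' + length b') R" "R (a' @ b')"
  have l: "length b' = length b" using eqt_length[OF assms(2)] assms(3) by simp
  have R': "dfn M (length a + length b) R" using R(1) l assms(3) by simp
  have "R (a @ b)" using eqtD[OF assms(2), of R] R' R(2) by simp
  from indD[OF assms(1) R' this] have cp: "CP M (length b') (r b) (length a') R" using l assms(3) by simp
  have "realizer (r b) (length b') M b'"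
    using real_of_eqt[OF r_real eqt_appendD2[OF assms(2,3)]] l by simp
  moreover have "inv_type M (length b') (r b)" using r_inv[of b] l by simp
  ultimately show "CPr b' (length a') R" using least[OF _ _ R(1) cp] by simp
qed

lemma ind_mono:
  assumes "ind a b" "set a' \<subseteq> set a" "set b' \<subseteq> set b"
  shows "ind a' b'"
  unfolding ind_def
proof (intro allI impI)
  fix R assume R: "dfn M (length a' + length b') R" "R (a' @ b')"
  from set_sub[OF assms(2)] obtain G where G: "sub {} (length a) (length a') G" "G a = a'" by (elim exE conjE)
  from set_sub[OF assms(3)] obtain F where F: "sub {} (length b) (length b') F" "F b = b'" by (elim exE conjE)
  let ?k = "length a"
  let ?R = "\<lambda>z. R (G (take ?k z) @ F (drop ?k z))"
  have "dfn M (?k + length b) ?R"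
  proof (rule dfn_sub[OF R(1)])
    show "sub M (?k + length b) (length a' + length b') (\<lambda>z. G (take ?k z) @ F (drop ?k z))"
      by (intro sub_append sub_comp[OF _ sub_mono[OF G(1)]] sub_comp[OF _ sub_mono[OF F(1)]] sub_take sub_drop) simp_all
  qed simp
  moreover have "?R (a @ b)" using R(2) G(2) F(2) by simp
  ultimately have cp: "CPr b ?k ?R" by (rule indD[OF assms(1)])
  have "CPr b (length a') (\<lambda>z. R (take (length a') z @ F (drop (length a') z)))"
    unfolding CP_def
  proof (intro allI impI)
    fix cs assume "mor M (length b) (r b) cs"
    from CPD[OF cp this] obtain x where x: "length x = ?k" "\<forall>c\<in>set cs. ?R (x @ c)" by (elim exE conjE)
    then show "\<exists>x. length x = length a' \<and> (\<forall>c\<in>set cs. R (take (length a') (x @ c) @ F (drop (length a') (x @ c))))"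
      using sub_length[OF G(1) x(1)] by (intro exI[of _ "G x"]) simp
  qed
  then show "CPr b' (length a') R" using CPr_sub[OF F(1) R(1)] unfolding F(2) by simp
qed

text \<open>Independence treats one formula at a time; it is preserved by conjunction, so saturation
  gives a single tuple with the full type over each member of a Morley sequence. With
  \<open>indI\<close> this characterizes \<open>ind\<close>.\<close>

lemma ind_real:
  assumes "ind a b" "mor M (length b) (r b) cs"
  shows "\<exists>a'. length a' = length a \<and> (\<forall>c\<in>set cs. eqt M (a @ b) (a' @ c))"
proof -
  let ?I = "{R. dfn M (length a + length b) R \<and> R (a @ b)}"
  have l: "\<forall>c\<in>set cs. length c = length b" by (auto dest!: mor_real[OF assms(2)] real_length)
  have sm: "small (M \<union> set (concat cs))" by (intro small_Un small_M small_finite) simp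
  have "\<exists>x. length x = length a \<and> (\<forall>R\<in>?I. \<forall>c\<in>set cs. R (x @ c))"
  proof (rule saturation_family[OF sm])
    fix R assume "R \<in> ?I"
    then have R: "dfn M (length a + length b) R" by simp
    show "dfn (M \<union> set (concat cs)) (length a) (\<lambda>x. \<forall>c\<in>set cs. R (x @ c))"
    proof (rule dfn_ball)
      fix c assume "c \<in> set cs"
      then show "dfn (M \<union> set (concat cs)) (length a) (\<lambda>x. R (x @ c))"
        by (intro dfn_sub[OF R] sub_append sub_id sub_const) (use l in auto)
    qed simp
  next
    fix J assume J: "finite J" "J \<subseteq> ?I"
    have *: "dfn M (length a + length b) R" "R (a @ b)" if "R \<in> J" for R using subsetD[OF J(2) that] by simp_all
    have "dfn M (length a + length b) (\<lambda>z. \<forall>R\<in>J. R z)" by (rule dfn_ball[OF J(1) *(1)])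
    moreover have "\<forall>R\<in>J. R (a @ b)"
    proof
      fix R assume "R \<in> J"
      from *(2)[OF this] show "R (a @ b)" .
    qed
    ultimately have "CPr b (length a) (\<lambda>z. \<forall>R\<in>J. R z)" by (rule indD[OF assms(1)])
    from CPD[OF this assms(2)] obtain x where x: "length x = length a" "\<forall>c\<in>set cs. \<forall>R\<in>J. R (x @ c)"
      by (elim exE conjE)
    show "\<exists>x. length x = length a \<and> (\<forall>R\<in>J. \<forall>c\<in>set cs. R (x @ c))"
    proof (intro exI[of _ x] conjI ballI)
      fix R c assume "R \<in> J" "c \<in> set cs"
      from bspec[OF bspec[OF x(2) this(2)] this(1)] show "R (x @ c)" .
    qed (rule x(1))
  qed
  then obtain x where x: "length x = length a" "\<forall>R\<in>?I. \<forall>c\<in>set cs. R (x @ c)" by (elim exE conjE)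
  have "eqt M (a @ b) (x @ c)" if c: "c \<in> set cs" for c
  proof (rule eqtI)
    show "length (a @ b) = length (x @ c)" using x(1) l c by simp
    fix Q assume "dfn M (length (a @ b)) Q" "Q (a @ b)"
    then have "Q \<in> ?I" by simp
    from bspec[OF bspec[OF x(2) this] c] show "Q (x @ c)" .
  qed
  with x(1) show ?thesis by (intro exI[of _ x]) simp
qed

lemma indI:
  assumes "\<And>cs. mor M (length b) (r b) cs \<Longrightarrow> \<exists>a'. length a' = length a \<and> (\<forall>c\<in>set cs. eqt M (a @ b) (a' @ c))"
  shows "ind a b"
  unfolding ind_def CP_def
proof (intro allI impI)
  fix R cs assume R: "dfn M (length a + length b) R" "R (a @ b)" and "mor M (length b) (r b) cs"
  from assms[OF this(3)] obtain a' where a': "length a' = length a" "\<forall>c\<in>set cs. eqt M (a @ b) (a' @ c)"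
    by (elim exE conjE)
  have "R (a' @ c)" if "c \<in> set cs" for c
    using eqtD[OF bspec[OF a'(2) that], of R] R by simp
  with a'(1) show "\<exists>x. length x = length a \<and> (\<forall>c\<in>set cs. R (x @ c))" by (intro exI[of _ a']) simp
qed

lemma ind_Nil: "ind [] b"
proof (rule indI)
  fix cs assume cs: "mor M (length b) (r b) cs"
  have "eqt M b c" if "c \<in> set cs" for c by (rule real_eqt0[OF r_inv r_real mor_real[OF cs that]])
  then show "\<exists>a'. length a' = length [] \<and> (\<forall>c\<in>set cs. eqt M ([] @ b) (a' @ c))" by (intro exI[of _ "[]"]) simp
qed

text \<open>
  If the extension failed, a formula over \<open>a\<close> true of \<open>d\<close> would make the consistent
  \<open>R\<close>'s imply a disjunction of dividing formulas; realize both along the same Morley sequence.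
\<close>

lemma ind_extend:
  assumes da: "ind d a" and R: "\<And>i. i \<in> I \<Longrightarrow> dfn M (k + length a) (R i)"
    and cp: "\<And>J. finite J \<Longrightarrow> J \<subseteq> I \<Longrightarrow> CPr a k (\<lambda>z. \<forall>i\<in>J. R i z)"
  shows "\<exists>x. length x = k \<and> (\<forall>i\<in>I. R i (x @ a)) \<and> ind (x @ d) a"
proof -
  let ?n = "length a" and ?m = "length d"
  \<comment> \<open>All predicates that divide along \<open>r a\<close>; avoiding each of them at
    \<open>(x, d, a)\<close> is exactly the desired independence.\<close>
  let ?N = "{N. dfn M ((k + ?m) + ?n) N \<and> \<not> CPr a (k + ?m) N}"
  let ?Q = "\<lambda>i x. case i of Inl i \<Rightarrow> R i (x @ a) | Inr N \<Rightarrow> \<not> N ((x @ d) @ a)"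
  have sm: "small (M \<union> set (d @ a))" by (intro small_Un small_M small_finite) simp
  have "\<exists>x. length x = k \<and> (\<forall>i\<in>I <+> ?N. ?Q i x)"
  proof (rule saturation_family[OF sm])
    fix i assume i: "i \<in> I <+> ?N"
    show "dfn (M \<union> set (d @ a)) k (?Q i)"
    proof (cases i)
      case (Inl j)
      then have "dfn M (k + ?n) (R j)" using i by (auto intro: R)
      then have "dfn (M \<union> set (d @ a)) k (\<lambda>x. R j (x @ a))"
        by (rule dfn_sub, intro sub_append sub_id sub_const) auto
      then show ?thesis using Inl by simp
    next
      case (Inr N)
      then have "dfn M ((k + ?m) + ?n) N" using i by auto
      then have "dfn (M \<union> set (d @ a)) k (\<lambda>x. N ((x @ d) @ a))"
        by (rule dfn_sub, intro sub_append sub_id sub_const) auto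
      from dfn_not[OF this] show ?thesis using Inr by simp
    qed
  next
    fix J assume J: "finite J" "J \<subseteq> I <+> ?N"
    define J1 where "J1 = Inl -` J"
    define J2 where "J2 = Inr -` J"
    have f: "finite J1" "finite J2" unfolding J1_def J2_def by (auto intro: finite_vimageI[OF J(1)])
    have J1: "J1 \<subseteq> I" unfolding J1_def using J(2) by auto
    have J2: "dfn M ((k + ?m) + ?n) N" "\<not> CPr a (k + ?m) N" if "N \<in> J2" for N
    proof -
      have "Inr N \<in> I <+> ?N" using that J(2) unfolding J2_def by auto
      then have "N \<in> ?N" by auto
      then show "dfn M ((k + ?m) + ?n) N" "\<not> CPr a (k + ?m) N" by simp_all
    qed
    have dJ1: "dfn M (k + ?n) (\<lambda>z. \<forall>i\<in>J1. R i z)"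
      by (rule dfn_ball[OF f(1)]) (rule R, use J1 in auto)
    have "dfn M ((k + ?m) + ?n) (\<lambda>z. \<not> (\<forall>N\<in>J2. \<not> N z))"
      by (rule dfn_not, rule dfn_ball[OF f(2)], rule dfn_not, rule J2(1))
    then have dJ2: "dfn M ((k + ?m) + ?n) (\<lambda>z. \<exists>N\<in>J2. N z)" by (simp only: ball_simps bex_simps not_not)
    show "\<exists>x. length x = k \<and> (\<forall>i\<in>J. ?Q i x)"
    proof (rule ccontr)
      assume no: "\<not> ?thesis"
      \<comment> \<open>For \<open>w = (y,c)\<close>: every solution of \<open>J1\<close> over
        \<open>c\<close> makes \<open>(x,y,c)\<close> satisfy some dividing predicate in
        \<open>J2\<close>. Failure of finite satisfiability says that this holds of
        \<open>(d,a)\<close>, so it does not divide along \<open>r a\<close>.\<close>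
      let ?\<chi> = "\<lambda>w. \<forall>x. length x = k \<longrightarrow> ((\<forall>i\<in>J1. R i (take k (drop (?m + ?n) (w @ x)) @ take ?n (drop ?m (w @ x))))
          \<longrightarrow> (\<exists>N\<in>J2. N ((take k (drop (?m + ?n) (w @ x)) @ take ?m (w @ x)) @ take ?n (drop ?m (w @ x)))))"
      have \<chi>: "?\<chi> (y @ c) \<longleftrightarrow> (\<forall>x. length x = k \<longrightarrow> ((\<forall>i\<in>J1. R i (x @ c)) \<longrightarrow> (\<exists>N\<in>J2. N ((x @ y) @ c))))"
        if "length y = ?m" "length c = ?n" for y c
      proof -
        have "take k (drop (?m + ?n) ((y @ c) @ x)) = x" "take ?n (drop ?m ((y @ c) @ x)) = c"
          "take ?m ((y @ c) @ x) = y" if "length x = k" for x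
          using that \<open>length y = ?m\<close> \<open>length c = ?n\<close> by simp_all
        then show ?thesis by simp
      qed
      have "dfn M (?m + ?n) ?\<chi>"
      proof (rule dfn_all, rule dfn_imp)
        show "dfn M (?m + ?n + k) (\<lambda>z. \<forall>i\<in>J1. R i (take k (drop (?m + ?n) z) @ take ?n (drop ?m z)))"
          by (rule dfn_sub[OF dJ1], intro sub_append sub_mid) simp_all
        show "dfn M (?m + ?n + k) (\<lambda>z. \<exists>N\<in>J2. N ((take k (drop (?m + ?n) z) @ take ?m z) @ take ?n (drop ?m z)))"
          by (rule dfn_sub[OF dJ2], intro sub_append sub_mid sub_take) simp_all
      qed
      moreover have "?\<chi> (d @ a)"
        unfolding \<chi>[OF refl refl]
      proof (intro allI impI)
        fix x assume x: "length x = k" "\<forall>i\<in>J1. R i (x @ a)"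
        show "\<exists>N\<in>J2. N ((x @ d) @ a)"
        proof (rule ccontr)
          assume c: "\<not> (\<exists>N\<in>J2. N ((x @ d) @ a))"
          have "?Q i x" if i: "i \<in> J" for i
          proof (cases i)
            case (Inl j)
            then have "j \<in> J1" using i by (simp add: J1_def)
            from bspec[OF x(2) this] show ?thesis using Inl by simp
          next
            case (Inr N)
            then have "N \<in> J2" using i by (simp add: J2_def)
            then have "\<not> N ((x @ d) @ a)" using c by blast
            then show ?thesis using Inr by simp
          qed
          with no x(1) show False by blast
        qed
      qed
      ultimately have cp\<chi>: "CPr a ?m ?\<chi>" by (rule indD[OF da])
      \<comment> \<open>Along one Morley sequence, \<open>x\<close> solves \<open>J1\<close> and
        \<open>y\<close> solves \<open>?\<chi>\<close> at every entry; the two may be chosen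
        separately because \<open>?\<chi>\<close> speaks about all solutions
        \<open>x\<close>.\<close>
      have "CPr a (k + ?m) (\<lambda>z. \<exists>N\<in>J2. N z)"
        unfolding CP_def
      proof (intro allI impI)
        fix cs assume cs: "mor M ?n (r a) cs"
        obtain x where x: "length x = k" "\<forall>c\<in>set cs. \<forall>i\<in>J1. R i (x @ c)"
          using CPD[OF cp[OF f(1) J1] cs] by (elim exE conjE)
        obtain y where y: "length y = ?m" "\<forall>c\<in>set cs. ?\<chi> (y @ c)" using CPD[OF cp\<chi> cs] by (elim exE conjE)
        have "\<exists>N\<in>J2. N ((x @ y) @ c)" if c: "c \<in> set cs" for c
        proof -
          have "length c = ?n" using real_length[OF mor_real[OF cs c]] .
          from bspec[OF y(2) c] have "\<forall>x. length x = k \<longrightarrow> ((\<forall>i\<in>J1. R i (x @ c)) \<longrightarrow> (\<exists>N\<in>J2. N ((x @ y) @ c)))"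
            unfolding \<chi>[OF y(1) \<open>length c = ?n\<close>] .
          from this[THEN spec[of _ x]] x(1) bspec[OF x(2) c] show ?thesis by simp
        qed
        then show "\<exists>z. length z = k + ?m \<and> (\<forall>c\<in>set cs. \<exists>N\<in>J2. N (z @ c))"
          using x(1) y(1) by (intro exI[of _ "x @ y"]) simp
      qed
      have "\<exists>N\<in>J2. CPr a (k + ?m) N"
        by (rule CP_finite_disj[OF r_inv small_M f(2) _ \<open>CPr a (k + ?m) (\<lambda>z. \<exists>N\<in>J2. N z)\<close>]) (erule J2(1))
      then obtain N where "N \<in> J2" "CPr a (k + ?m) N" by (elim bexE)
      with J2(2) show False by simp
    qed
  qed
  then obtain x where x: "length x = k" "\<forall>i\<in>I <+> ?N. ?Q i x" by (elim exE conjE)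
  have 1: "R i (x @ a)" if "i \<in> I" for i using bspec[OF x(2) InlI[OF that]] by simp
  have 2: "ind (x @ d) a"
    unfolding ind_def
  proof (intro allI impI)
    fix N assume N: "dfn M (length (x @ d) + ?n) N" "N ((x @ d) @ a)"
    show "CPr a (length (x @ d)) N"
    proof (rule ccontr)
      assume "\<not> CPr a (length (x @ d)) N"
      then have "N \<in> ?N" using N(1) x(1) by simp
      then have "Inr N \<in> I <+> ?N" by (rule InrI)
      from bspec[OF x(2) this] N(2) show False by simp
    qed
  qed
  show ?thesis by (intro exI[of _ x] conjI ballI x(1) 2) (rule 1)
qed

text \<open>The extension property on the right, for a conjugate of \<open>a\<close>. By coherence
  the formulas in the type of \<open>a\<close> over \<open>b\<close> still do not divide along
  \<open>r (b @ E)\<close>, so \<open>ind_extend\<close> applies with the empty tuple as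
  \<open>d\<close>.\<close>

lemma ind_right_extend:
  assumes "ind a b" shows "\<exists>x. eqt M (a @ b) (x @ b) \<and> ind x (b @ E)"
proof -
  let ?k = "length a" and ?n = "length b"
  let ?I = "{R. dfn M (?k + ?n) R \<and> R (a @ b)}"
  have T: "sub {} (length (b @ E)) ?n (take ?n)" by (rule sub_take) simp
  have tb: "take ?n (b @ E) = b" by simp
  have "\<exists>x. length x = ?k \<and> (\<forall>R\<in>?I. R (take ?k (x @ b @ E) @ take ?n (drop ?k (x @ b @ E)))) \<and> ind (x @ []) (b @ E)"
  proof (rule ind_extend[OF ind_Nil, where R = "\<lambda>R z. R (take ?k z @ take ?n (drop ?k z))"])
    fix R assume "R \<in> ?I"
    then have "dfn M (?k + ?n) R" by simp
    then show "dfn M (?k + length (b @ E)) (\<lambda>z. R (take ?k z @ take ?n (drop ?k z)))"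
      by (rule dfn_sub, intro sub_append sub_mid sub_take) simp_all
  next
    fix J assume J: "finite J" "J \<subseteq> ?I"
    have *: "dfn M (?k + ?n) R" "R (a @ b)" if "R \<in> J" for R using subsetD[OF J(2) that] by simp_all
    have d: "dfn M (?k + ?n) (\<lambda>z. \<forall>R\<in>J. R z)" by (rule dfn_ball[OF J(1) *(1)])
    have "\<forall>R\<in>J. R (a @ b)"
    proof
      fix R assume "R \<in> J"
      from *(2)[OF this] show "R (a @ b)" .
    qed
    then have "CPr (take ?n (b @ E)) ?k (\<lambda>z. \<forall>R\<in>J. R z)" unfolding tb by (rule indD[OF assms d])
    then show "CPr (b @ E) ?k (\<lambda>z. \<forall>R\<in>J. R (take ?k z @ take ?n (drop ?k z)))"
      unfolding CPr_sub[OF T d] .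
  qed
  then obtain x where x: "length x = ?k" "\<forall>R\<in>?I. R (take ?k (x @ b @ E) @ take ?n (drop ?k (x @ b @ E)))"
    "ind (x @ []) (b @ E)" by (elim exE conjE)
  have "eqt M (a @ b) (x @ b)"
  proof (rule eqtI)
    fix Q assume "dfn M (length (a @ b)) Q" "Q (a @ b)"
    then have "Q \<in> ?I" by simp
    from bspec[OF x(2) this] show "Q (x @ b)" using x(1) by simp
  qed (use x(1) in simp)
  then show ?thesis using x(3) by (intro exI[of _ x]) simp
qed

text \<open>Realize \<open>p\<close> over a common \<open>D'\<close> and the whole Morley sequence
  at once; by stationarity the new entry stands to each term as \<open>d\<close> stands to
  \<open>D\<close> and \<open>C\<close>.\<close>

lemma ind_inv:
  assumes "ind D C" "inv_type M n p" "realizer p n (M \<union> set (D @ C)) d"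
  shows "ind (D @ d) C"
proof (rule indI)
  fix cs assume cs: "mor M (length C) (r C) cs"
  from ind_real[OF assms(1) this] obtain D' where D': "length D' = length D"
    "\<forall>c\<in>set cs. eqt M (D @ C) (D' @ c)" by (elim exE conjE)
  have "small (M \<union> set (D' @ concat cs))" by (intro small_Un small_M small_finite) simp
  from real_exists[OF assms(2) this] obtain d' where d': "realizer p n (M \<union> set (D' @ concat cs)) d'" ..
  have l: "length d = n" "length d' = n" using real_length[OF assms(3)] real_length[OF d'] .
  have "eqt M ((D @ d) @ C) ((D' @ d') @ c)" if c: "c \<in> set cs" for c
  proof -
    have "realizer p n (M \<union> set (D' @ c)) d'" by (rule real_mono[OF d']) (use c in auto)
    from real_eqt[OF assms(2) bspec[OF D'(2) c] assms(3) this]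
    have "eqt M (d @ D @ C) (d' @ D' @ c)" .
    from eqt_swap[OF this] have "eqt M (D @ C @ d) (D' @ c @ d')" using l by simp
    from eqt_swap23[OF this] have "eqt M (D @ d @ C) (D' @ d' @ c)"
      using D'(1) real_length[OF mor_real[OF cs c]] by simp
    then show ?thesis by simp
  qed
  then show "\<exists>a'. length a' = length (D @ d) \<and> (\<forall>c\<in>set cs. eqt M ((D @ d) @ C) (a' @ c))"
    using l D'(1) by (intro exI[of _ "D' @ d'"]) simp
qed

end

section \<open>Amalgamation and the half graph\<close>

locale sym_witness = witness L \<kappa> S M r
  for L :: "('f, 'r) lang" and \<kappa> :: "'k rel" and S :: "('f, 'r, 'm) interp" and M r +
  assumes ind_sym: "ind a b \<Longrightarrow> ind b a"
begin

text \<open>Symmetry puts \<open>c\<close> and \<open>d\<close> on the left over the common tuple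
  \<open>a\<close>, where \<open>ind_extend\<close> can add a conjugate of \<open>c\<close> to
  \<open>d\<close>; symmetry then returns both to the right side.\<close>

lemma ind_joint:
  assumes "ind a c" "ind a d"
  shows "\<exists>c'. eqt M (c @ a) (c' @ a) \<and> ind a (c' @ d)"
proof -
  let ?I = "{R. dfn M (length c + length a) R \<and> R (c @ a)}"
  have "\<exists>x. length x = length c \<and> (\<forall>R\<in>?I. R (x @ a)) \<and> ind (x @ d) a"
  proof (rule ind_extend[OF ind_sym[OF assms(2)]])
    fix R assume "R \<in> ?I" then show "dfn M (length c + length a) R" by simp
  next
    fix J assume J: "finite J" "J \<subseteq> ?I"
    have *: "dfn M (length c + length a) R" "R (c @ a)" if "R \<in> J" for R using subsetD[OF J(2) that] by simp_all
    have "dfn M (length c + length a) (\<lambda>z. \<forall>R\<in>J. R z)" by (rule dfn_ball[OF J(1) *(1)])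
    moreover have "\<forall>R\<in>J. R (c @ a)"
    proof
      fix R assume "R \<in> J"
      from *(2)[OF this] show "R (c @ a)" .
    qed
    ultimately show "CPr a (length c) (\<lambda>z. \<forall>R\<in>J. R z)" by (rule indD[OF ind_sym[OF assms(1)]])
  qed
  then obtain x where x: "length x = length c" "\<forall>R\<in>?I. R (x @ a)" "ind (x @ d) a" by (elim exE conjE)
  have "eqt M (c @ a) (x @ a)"
  proof (rule eqtI)
    show "length (c @ a) = length (x @ a)" using x(1) by simp
    fix Q assume "dfn M (length (c @ a)) Q" "Q (c @ a)"
    then have "Q \<in> ?I" by simp
    from bspec[OF x(2) this] show "Q (x @ a)" .
  qed
  with ind_sym[OF x(3)] show ?thesis by (intro exI[of _ x]) simp
qed

text \<open>\<open>(B0, B1)\<close> realizes the Morley square of \<open>r B\<close>, along which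
  pairs of instances remain consistent. The square need not be \<open>r (B0 @ B1)\<close>, but
  leastness of the latter carries the consistency over, and extension realizes it
  independently.\<close>

lemma ind_pair:
  assumes "ind a B" and B0: "realizer (r B) (length B) M B0" and B1: "realizer (r B) (length B) (M \<union> set B0) B1"
  shows "\<exists>x. eqt M (a @ B) (x @ B0) \<and> eqt M (a @ B) (x @ B1) \<and> ind x (B0 @ B1)"
proof -
  let ?n = "length B" and ?k = "length a"
  let ?p = "sq M ?n (r B)"
  let ?I = "{R. dfn M (?k + ?n) R \<and> R (a @ B)}"
  let ?two = "\<lambda>R z. R (take ?k z @ take ?n (drop ?k z)) \<and> R (take ?k z @ drop (?k + ?n) z)"
  have l: "length B0 = ?n" "length B1 = ?n" using real_length[OF B0] real_length[OF B1] .
  have lE: "length (B0 @ B1) = ?n + ?n" using l by simp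
  have inv: "inv_type M (length (B0 @ B1)) ?p" unfolding lE by (rule inv_sq[OF r_inv small_M])
  have re: "realizer ?p (length (B0 @ B1)) M (B0 @ B1)"
    unfolding lE by (rule real_sq[OF r_inv small_M subset_refl B0 B1])
  have dtwo: "dfn M (?k + length (B0 @ B1)) (?two R)" if R: "dfn M (?k + ?n) R" for R
  proof (rule dfn_conj)
    show "dfn M (?k + length (B0 @ B1)) (\<lambda>z. R (take ?k z @ take ?n (drop ?k z)))"
      unfolding lE by (rule dfn_sub[OF R], intro sub_append sub_mid sub_take) simp_all
    show "dfn M (?k + length (B0 @ B1)) (\<lambda>z. R (take ?k z @ drop (?k + ?n) z))"
      unfolding lE by (rule dfn_sub[OF R], intro sub_append sub_drop sub_take) simp_all
  qed
  have "\<exists>x. length x = ?k \<and> (\<forall>R\<in>?I. ?two R (x @ (B0 @ B1))) \<and> ind (x @ []) (B0 @ B1)"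
  proof (rule ind_extend[OF ind_Nil, where R = "\<lambda>R. ?two R"])
    fix R assume "R \<in> ?I" then show "dfn M (?k + length (B0 @ B1)) (?two R)" by (intro dtwo) simp
  next
    fix J assume J: "finite J" "J \<subseteq> ?I"
    have *: "dfn M (?k + ?n) R" "R (a @ B)" if "R \<in> J" for R using subsetD[OF J(2) that] by simp_all
    let ?RJ = "\<lambda>z. \<forall>R\<in>J. R z"
    have d: "dfn M (?k + ?n) ?RJ" by (rule dfn_ball[OF J(1) *(1)])
    have "?RJ (a @ B)"
    proof
      fix R assume "R \<in> J"
      from *(2)[OF this] show "R (a @ B)" .
    qed
    then have "CPr B ?k ?RJ" by (rule indD[OF assms(1) d])
    from CP_sq[OF r_inv small_M d this] have "CP M (length (B0 @ B1)) ?p ?k (?two ?RJ)" unfolding lE .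
    from least[OF inv re dtwo[OF d] this] have "CPr (B0 @ B1) ?k (?two ?RJ)" .
    moreover have "?two ?RJ = (\<lambda>z. \<forall>R\<in>J. ?two R z)" by (rule ext) blast
    ultimately show "CPr (B0 @ B1) ?k (\<lambda>z. \<forall>R\<in>J. ?two R z)" by simp
  qed
  then obtain x where x: "length x = ?k" "\<forall>R\<in>?I. ?two R (x @ (B0 @ B1))" "ind (x @ []) (B0 @ B1)" by (elim exE conjE)
  have tw: "R (x @ B0) \<and> R (x @ B1)" if "dfn M (?k + ?n) R" "R (a @ B)" for R
  proof -
    have "R \<in> ?I" using that by simp
    from bspec[OF x(2) this] show ?thesis using x(1) l by simp
  qed
  have "eqt M (a @ B) (x @ B0)"
  proof (rule eqtI)
    fix Q assume "dfn M (length (a @ B)) Q" "Q (a @ B)"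
    then show "Q (x @ B0)" using tw[of Q] by simp
  qed (use x(1) l in simp)
  moreover have "eqt M (a @ B) (x @ B1)"
  proof (rule eqtI)
    fix Q assume "dfn M (length (a @ B)) Q" "Q (a @ B)"
    then show "Q (x @ B1)" using tw[of Q] by simp
  qed (use x(1) l in simp)
  ultimately show ?thesis using x(3) by (intro exI[of _ x]) simp
qed

text \<open>
  The two types of \<open>a\<close> have some common independent realization by \<open>ind_joint\<close>, over \<open>C'b\<close> say; in a
  Morley sequence of \<open>C'b\<close> the first copy of \<open>C'\<close> and the second copy of \<open>b\<close> are in the position of
  \<open>C\<close> and \<open>e\<close>.
\<close>

lemma weak_independence:
  assumes aC: "ind a C" and ab: "ind a' b" and aa: "eqt M a a'" and e: "realizer (r b) (length b) (M \<union> set C) e"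
  shows "\<exists>x. eqt (M \<union> set C) a x \<and> eqt M (a' @ b) (x @ e) \<and> ind x (C @ e)"
proof -
  have la: "length a = length a'" by (rule eqt_length[OF aa])
  \<comment> \<open>Conjugating \<open>C\<close> gives both hypotheses the same left-hand tuple
    \<open>a'\<close>, as joint extension requires.\<close>
  obtain C2 where C2: "length C2 = length C" "eqt M (a @ C) (a' @ C2)" by (rule eqt_extend[OF small_M aa])
  have "ind a' C2" by (rule ind_eqt[OF aC C2(2) la])
  from ind_joint[OF this ab] obtain C' where C': "eqt M (C2 @ a') (C' @ a')" "ind a' (C' @ b)" by (elim exE conjE)
  have lC': "length C' = length C" using eqt_length[OF C'(1)] C2(1) by simp
  let ?B = "C' @ b"
  obtain B0 where B0: "realizer (r ?B) (length ?B) M B0" using real_exists[OF r_inv small_M] ..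
  have "small (M \<union> set B0)" by (intro small_Un small_M small_finite) simp
  from real_exists[OF r_inv this] obtain B1 where B1: "realizer (r ?B) (length ?B) (M \<union> set B0) B1" ..
  from ind_pair[OF C'(2) B0 B1] obtain x where x: "eqt M (a' @ ?B) (x @ B0)" "eqt M (a' @ ?B) (x @ B1)"
    "ind x (B0 @ B1)" by (elim exE conjE)
  have l: "length B0 = length C + length b" "length B1 = length C + length b"
    using real_length[OF B0] real_length[OF B1] lC' by simp_all
  have lx: "length x = length a'" using eqt_length[OF x(1)] l lC' by simp
  define C0 where "C0 = take (length C) B0"
  define e1 where "e1 = drop (length C) B1"
  have lC0: "length C0 = length C" and le1: "length e1 = length b" using l by (simp_all add: C0_def e1_def)
  have "eqt M (a' @ (C' @ b)) (x @ (C0 @ drop (length C) B0))" using x(1) by (simp add: C0_def)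
  then have "eqt M ((a' @ C') @ b) ((x @ C0) @ drop (length C) B0)" by simp
  from eqt_appendD1[OF this] have xC0': "eqt M (a' @ C') (x @ C0)" using lx lC' lC0 by simp
  have "eqt M (a' @ C2) (a' @ C')" by (rule eqt_swap[OF C'(1)]) (use lC' C2(1) in simp)
  with C2(2) xC0' have xC0: "eqt M (a @ C) (x @ C0)" using eqt_trans by blast
  have "eqt M (a' @ (C' @ b)) (x @ (take (length C) B1 @ e1))" using x(2) by (simp add: e1_def)
  from eqt_swap23[OF this] have "eqt M (a' @ (b @ C')) (x @ (e1 @ take (length C) B1))" using lx lC' l by simp
  then have "eqt M ((a' @ b) @ C') ((x @ e1) @ take (length C) B1)" by simp
  from eqt_appendD1[OF this] have xe1: "eqt M (a' @ b) (x @ e1)" using lx le1 by simp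
  have indx: "ind x (C0 @ e1)"
    by (rule ind_mono[OF x(3)]) (auto simp: C0_def e1_def dest: in_set_takeD in_set_dropD)
  have F: "sub {} (length ?B) (length b) (drop (length C))" by (rule sub_drop) (simp add: lC')
  \<comment> \<open>Coherence is essential here: the second copy of \<open>b\<close> inside a Morley
    sequence in \<open>r (C' @ b)\<close> realizes \<open>r b\<close> itself, and not merely some
    invariant extension.\<close>
  have rb: "r b = push (drop (length C)) (r ?B)" using r_sub[OF F] lC' by simp
  have e1: "realizer (r b) (length b) (M \<union> set C0) e1"
  proof -
    have "realizer (r b) (length b) (M \<union> set B0) e1"
      unfolding rb e1_def by (rule real_push[OF sub_mono[OF F, of M] _ B1]) simp_all
    then show ?thesis by (rule real_mono) (use set_take_subset[of "length C" B0] in \<open>auto simp: C0_def\<close>)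
  qed
  have C0: "eqt M C0 C" by (rule eqt_sym[OF eqt_appendD2[OF xC0]]) (use lx la in simp)
  \<comment> \<open>The position of \<open>e\<close> over \<open>C\<close> is determined by
    stationarity; this is the only place where the freeness of \<open>e\<close> over
    \<open>C\<close> enters. The tuple \<open>x\<close> is then moved along to
    \<open>v\<close>.\<close>
  have "eqt M (e1 @ C0) (e @ C)" by (rule real_eqt[OF r_inv C0 e1 e])
  from eqt_extend[OF small_M this, of x] obtain v where v: "length v = length x" "eqt M ((e1 @ C0) @ x) (e @ C @ v)"
    by (metis append_assoc)
  have le: "length e = length b" by (rule real_length[OF e])
  have "eqt M ((e1 @ C0) @ x) ((e @ C) @ v)" using v(2) by simp
  from eqt_swap[OF this] have 1: "eqt M (x @ e1 @ C0) (v @ e @ C)" using le le1 lC0 by simp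
  from eqt_swap23[OF 1] have 2: "eqt M (x @ C0 @ e1) (v @ C @ e)" using le le1 v(1) by simp
  have "eqt M ((x @ e1) @ C0) ((v @ e) @ C)" using 1 by simp
  from eqt_appendD1[OF this] have "eqt M (x @ e1) (v @ e)" using le le1 v(1) by simp
  with xe1 have R2: "eqt M (a' @ b) (v @ e)" by (rule eqt_trans)
  have "eqt M ((x @ C0) @ e1) ((v @ C) @ e)" using 2 by simp
  from eqt_appendD1[OF this] have "eqt M (x @ C0) (v @ C)" using lC0 v(1) by simp
  with xC0 have "eqt M (a @ C) (v @ C)" by (rule eqt_trans)
  then have R1: "eqt (M \<union> set C) a v" by (simp add: eqt_params)
  have "ind v (C @ e)" by (rule ind_eqt[OF indx 2]) (use v(1) in simp)
  with R1 R2 show ?thesis by blast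
qed

text \<open>The invariant for finite stages holds more than the conclusion. \<open>good\<close>
  keeps a realization of each mixed sequence that is independent of it, so that weak independence
  can prolong it. Independence of \<open>Cs\<close> and \<open>Ds\<close>, and a conjugate
  \<open>u\<close> of \<open>b'\<close> standing to each entry of \<open>Ds\<close> as
  \<open>b'\<close> stands to \<open>b\<close>, are what the choice of the next \<open>c\<close>
  consumes.\<close>

lemma half_graph:
  fixes \<Phi> :: "'m list \<Rightarrow> bool"
  assumes \<Phi>: "dfn {} (k + length b) \<Phi>" and a: "length a = k" "\<Phi> (a @ b)" "ind a b"
    and b': "eqt M b b'" "ind b' b" "\<nexists>x. length x = k \<and> \<Phi> (x @ b') \<and> \<Phi> (x @ b)"
  shows "\<exists>c d :: nat \<Rightarrow> 'm list. (\<forall>i. length (c i) = length b \<and> length (d i) = length b)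
    \<and> (\<forall>i N. \<exists>x. length x = k \<and> (\<forall>j<i. \<Phi> (x @ c j)) \<and> (\<forall>j. i \<le> j \<and> j < N \<longrightarrow> \<Phi> (x @ d j)))
    \<and> (\<forall>i j. j \<le> i \<longrightarrow> (\<nexists>x. length x = k \<and> \<Phi> (x @ c i) \<and> \<Phi> (x @ d j)))"
proof -
  let ?n = "length b"
  have lb': "length b' = ?n" using eqt_length[OF b'(1)] by simp
  define mix where "mix i Cs Ds = take i Cs @ drop i Ds" for i and Cs Ds :: "'m list list"
  define good where "good E \<longleftrightarrow> (\<exists>u. eqt M u a \<and> ind u (concat E) \<and> (\<forall>c\<in>set E. \<Phi> (u @ c)))" for E
  define Inv where "Inv Cs Ds \<longleftrightarrow> length Cs = length Ds \<and> (\<forall>c\<in>set Cs \<union> set Ds. length c = ?n)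
    \<and> ind (concat Cs) (concat Ds)
    \<and> (\<exists>u. eqt M u b' \<and> ind u (concat Ds) \<and> (\<forall>d\<in>set Ds. eqt M (b' @ b) (u @ d)))
    \<and> (\<forall>i\<le>length Cs. good (mix i Cs Ds))
    \<and> (\<forall>i<length Cs. \<forall>j\<le>i. \<nexists>x. length x = k \<and> \<Phi> (x @ Cs ! i) \<and> \<Phi> (x @ Ds ! j))" for Cs Ds
  have restr: "eqt M (u @ d) (u' @ d)" if "eqt (M \<union> set (concat Ds)) u u'" "d \<in> set Ds" for u u' d Ds
    unfolding eqt_params[symmetric] by (rule eqt_mono[OF that(1)]) (use that(2) in auto)
  have \<Phi>_eqt: "\<Phi> (u @ c) = \<Phi> (u' @ c')" if "eqt M (u @ c) (u' @ c')" "length u = k" "length c = ?n" for u u' c c'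
    using eqtD[OF that(1), of \<Phi>] dfn_mono[OF \<Phi>, of M] that(2,3) by simp
  \<comment> \<open>The old realization over \<open>E\<close> is amalgamated with \<open>a\<close>
    over \<open>b\<close>; this needs \<open>e\<close> to realize \<open>r b\<close> over all of
    \<open>E\<close>.\<close>
  have good_step: "good (E @ [e])"
    if E: "good E" "\<forall>c\<in>set E. length c = ?n" "realizer (r b) ?n (M \<union> set (concat E)) e" for E e
  proof -
    obtain u where u: "eqt M u a" "ind u (concat E)" "\<forall>c\<in>set E. \<Phi> (u @ c)"
      using E(1) unfolding good_def by (elim exE conjE)
    have lu: "length u = k" using eqt_length[OF u(1)] a(1) by simp
    from weak_independence[OF u(2) a(3) u(1) E(3)] obtain x where
      x: "eqt (M \<union> set (concat E)) u x" "eqt M (a @ b) (x @ e)" "ind x (concat E @ e)" by (elim exE conjE)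
    have "eqt M x a" using eqt_trans[OF eqt_sym[OF eqt_mono[OF x(1)]] u(1)] by simp
    moreover have "\<Phi> (x @ c)" if c: "c \<in> set E" for c
      using \<Phi>_eqt[OF restr[OF x(1) c] lu] u(3) c \<open>\<forall>c\<in>set E. length c = ?n\<close> by simp
    moreover have "\<Phi> (x @ e)" using \<Phi>_eqt[OF x(2) a(1) refl] a(2) by simp
    ultimately show ?thesis unfolding good_def using x(3) by (intro exI[of _ x]) auto
  qed
  have step: "\<exists>c d. Inv (Cs @ [c]) (Ds @ [d])" if inv: "Inv Cs Ds" for Cs Ds
  proof -
    let ?C = "concat Cs" and ?D = "concat Ds"
    have len: "length Cs = length Ds" "\<forall>c\<in>set Cs \<union> set Ds. length c = ?n" and CD: "ind ?C ?D"
      and good: "\<forall>i\<le>length Cs. good (mix i Cs Ds)"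
      and bad: "\<forall>i<length Cs. \<forall>j\<le>i. \<nexists>x. length x = k \<and> \<Phi> (x @ Cs ! i) \<and> \<Phi> (x @ Ds ! j)"
      using inv unfolding Inv_def by simp_all
    obtain u where u: "eqt M u b'" "ind u ?D" "\<forall>d\<in>set Ds. eqt M (b' @ b) (u @ d)"
      using inv unfolding Inv_def by (elim exE conjE)
    have "small (M \<union> set (?D @ ?C))" by (intro small_Un small_M small_finite) simp
    from real_exists[OF r_inv this] obtain d where d: "realizer (r b) ?n (M \<union> set (?D @ ?C)) d" ..
    let ?D' = "?D @ d"
    have ld: "length d = ?n" by (rule real_length[OF d])
    have DC: "ind ?D' ?C" by (rule ind_inv[OF ind_sym[OF CD] r_inv d])
    have dD: "realizer (r b) ?n (M \<union> set ?D) d" by (rule real_mono[OF d]) auto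
    \<comment> \<open>\<open>v\<close> keeps the position of \<open>u\<close> over the old
      \<open>Ds\<close> and acquires over \<open>d\<close> the position of \<open>b'\<close> over
      \<open>b\<close>.\<close>
    from weak_independence[OF u(2) b'(2) u(1) dD] obtain v where
      v: "eqt (M \<union> set ?D) u v" "eqt M (b' @ b) (v @ d)" "ind v ?D'" by (elim exE conjE)
    have vb': "eqt M v b'" using eqt_trans[OF eqt_sym[OF eqt_mono[OF v(1)]] u(1)] by simp
    have vd: "eqt M (b' @ b) (v @ d')" if d': "d' \<in> set (Ds @ [d])" for d'
    proof (cases "d' \<in> set Ds")
      case True
      from eqt_trans[OF bspec[OF u(3) True] restr[OF v(1) True]] show ?thesis .
    next
      case False
      then have "d' = d" using d' by simp
      then show ?thesis using v(2) by simp
    qed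
    have goodd: "good (mix i Cs (Ds @ [d]))" if i: "i \<le> length Cs" for i
    proof -
      have eq: "mix i Cs (Ds @ [d]) = mix i Cs Ds @ [d]" using i len(1) by (simp add: mix_def)
      have sub: "set (mix i Cs Ds) \<subseteq> set Cs \<union> set Ds" by (auto simp: mix_def dest: in_set_takeD in_set_dropD)
      show ?thesis
        unfolding eq
      proof (rule good_step)
        show "good (mix i Cs Ds)" using good i by simp
        show "\<forall>c\<in>set (mix i Cs Ds). length c = ?n" using sub len(2) by blast
        show "realizer (r b) ?n (M \<union> set (concat (mix i Cs Ds))) d" by (rule real_mono[OF d]) (use sub in auto)
      qed
    qed
    \<comment> \<open>\<open>v\<close> itself cannot be the next \<open>c\<close>, as its position
      over \<open>Cs\<close> is not under control. The roles are therefore exchanged: by symmetry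
      the conjugate \<open>D2\<close> of \<open>?D'\<close> is independent of \<open>b\<close>, and
      it is \<open>?D'\<close> that will be amalgamated over \<open>?C\<close> and
      \<open>b\<close>.\<close>
    have "eqt M v b" by (rule eqt_trans[OF vb' eqt_sym[OF b'(1)]])
    then obtain D2 where D2: "length D2 = length ?D'" "eqt M (v @ ?D') (b @ D2)" by (rule eqt_extend[OF small_M])
    have lv: "length v = ?n" using eqt_length[OF vb'] lb' by simp
    have Dv: "eqt M (?D' @ v) (D2 @ b)" by (rule eqt_swap[OF D2(2) lv])
    have iD2: "ind D2 b" by (rule ind_eqt[OF ind_sym[OF v(3)] Dv]) (use D2(1) in simp)
    have eD2: "eqt M ?D' D2" by (rule eqt_appendD1[OF Dv]) (use D2(1) in simp)
    have smC: "small (M \<union> set ?C)" by (intro small_Un small_M small_finite) simp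
    from real_exists[OF r_inv this] obtain e0 where e0: "realizer (r b) ?n (M \<union> set ?C) e0" ..
    from weak_independence[OF DC iD2 eD2 e0] obtain D3 where D3: "eqt (M \<union> set ?C) ?D' D3" "eqt M (D2 @ b) (D3 @ e0)" "ind D3 (?C @ e0)"
      by (elim exE conjE)
    \<comment> \<open>Moving \<open>D3\<close> back to \<open>?D'\<close> over \<open>?C\<close>
      carries \<open>e0\<close> to the next \<open>c\<close>: it still realizes \<open>r b\<close>
      over \<open>?C\<close> and has the type of \<open>v\<close> over \<open>?D'\<close>.\<close>
    from eqt_extend[OF smC eqt_sym[OF D3(1)], of e0] obtain e where
      e: "length e = length e0" "eqt (M \<union> set ?C) (D3 @ e0) (?D' @ e)" .
    have lD3: "length D3 = length ?D'" using eqt_length[OF D3(1)] by simp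
    have "eqt (M \<union> set ?C) e0 e" by (rule eqt_appendD2[OF e(2) lD3])
    from real_of_eqt[OF e0 this] have re: "realizer (r b) ?n (M \<union> set ?C) e" .
    have le: "length e = ?n" by (rule real_length[OF re])
    have "eqt M (?D' @ v) (?D' @ e)"
      using eqt_trans[OF Dv eqt_trans[OF D3(2) eqt_mono[OF e(2)]]] by simp
    from eqt_swap[OF this refl] have "eqt (M \<union> set ?D') v e" unfolding eqt_params .
    then have ve: "eqt (M \<union> set (concat (Ds @ [d]))) v e" by simp
    have ed: "eqt M (b' @ b) (e @ d')" if d': "d' \<in> set (Ds @ [d])" for d'
      by (rule eqt_trans[OF vd[OF d'] restr[OF ve d']])
    have "eqt M ((D3 @ e0) @ ?C) ((?D' @ e) @ ?C)" using e(2) unfolding eqt_params .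
    then have "eqt M (D3 @ e0 @ ?C) (?D' @ e @ ?C)" by simp
    from eqt_swap23[OF this lD3 e(1)[symmetric]] have "eqt M (D3 @ (?C @ e0)) (?D' @ (?C @ e))" by simp
    from ind_eqt[OF D3(3) this lD3] have DCe: "ind ?D' (?C @ e)" .
    \<comment> \<open>Only the cut past the end contains \<open>e\<close>, and there
      \<open>e\<close> follows \<open>Cs\<close> alone, over which it is free. Every other cut omits
      \<open>e\<close> and was treated when \<open>d\<close> was added.\<close>
    have goode: "good (mix i (Cs @ [e]) (Ds @ [d]))" if i: "i \<le> Suc (length Cs)" for i
    proof (cases "i = Suc (length Cs)")
      case True
      then have eq: "mix i (Cs @ [e]) (Ds @ [d]) = mix (length Cs) Cs Ds @ [e]" using len(1) by (simp add: mix_def)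
      have eq2: "mix (length Cs) Cs Ds = Cs" using len(1) by (simp add: mix_def)
      show ?thesis
        unfolding eq
      proof (rule good_step)
        show "good (mix (length Cs) Cs Ds)" using good by simp
      qed (use eq2 len(2) re in auto)
    next
      case False
      then have "i \<le> length Cs" using i by simp
      moreover from this have "mix i (Cs @ [e]) (Ds @ [d]) = mix i Cs (Ds @ [d])" by (simp add: mix_def)
      ultimately show ?thesis using goodd by simp
    qed
    have bade: "\<nexists>x. length x = k \<and> \<Phi> (x @ e) \<and> \<Phi> (x @ d')" if d': "d' \<in> set (Ds @ [d])" for d'
    proof -
      have ld': "length d' = ?n" using d' len(2) ld by auto
      \<comment> \<open>Joint solvability of the two instances is definable in the pair, so its
        failure at \<open>(b', b)\<close> passes to every pair of the same type over
        \<open>M\<close>.\<close>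
      let ?Q = "\<lambda>z. \<exists>x. length x = k \<and> (\<Phi> (take k (drop (?n + ?n) (z @ x)) @ take ?n (z @ x)) \<and>
          \<Phi> (take k (drop (?n + ?n) (z @ x)) @ take ?n (drop ?n (z @ x))))"
      have "dfn M (?n + ?n) ?Q"
      proof (rule dfn_ex, rule dfn_conj)
        show "dfn M (?n + ?n + k) (\<lambda>z. \<Phi> (take k (drop (?n + ?n) z) @ take ?n z))"
          by (rule dfn_sub[OF \<Phi>], intro sub_append sub_mid sub_take) simp_all
        show "dfn M (?n + ?n + k) (\<lambda>z. \<Phi> (take k (drop (?n + ?n) z) @ take ?n (drop ?n z)))"
          by (rule dfn_sub[OF \<Phi>], intro sub_append sub_mid sub_take) simp_all
      qed
      then have *: "?Q (b' @ b) = ?Q (e @ d')"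
        by (rule eqtD[OF ed[OF d'], where Q = ?Q, unfolded length_append lb'])
      have Q: "?Q (y @ z) \<longleftrightarrow> (\<exists>x. length x = k \<and> \<Phi> (x @ y) \<and> \<Phi> (x @ z))"
        if "length y = ?n" "length z = ?n" for y z
        using that by (intro ex_cong) simp
      show ?thesis using * b'(3) unfolding Q[OF lb' refl] Q[OF le ld'] by simp
    qed
    have "Inv (Cs @ [e]) (Ds @ [d])"
      unfolding Inv_def
    proof (intro conjI)
      show "length (Cs @ [e]) = length (Ds @ [d])" using len(1) by simp
      show "\<forall>c\<in>set (Cs @ [e]) \<union> set (Ds @ [d]). length c = ?n" using len(2) le ld by auto
      show "ind (concat (Cs @ [e])) (concat (Ds @ [d]))" using ind_sym[OF DCe] by simp
      show "\<exists>u. eqt M u b' \<and> ind u (concat (Ds @ [d])) \<and> (\<forall>d'\<in>set (Ds @ [d]). eqt M (b' @ b) (u @ d'))"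
      proof (intro exI[of _ v] conjI ballI)
        show "ind v (concat (Ds @ [d]))" using v(3) by simp
      qed (use vb' vd in simp_all)
      show "\<forall>i\<le>length (Cs @ [e]). good (mix i (Cs @ [e]) (Ds @ [d]))" using goode by simp
      show "\<forall>i<length (Cs @ [e]). \<forall>j\<le>i. \<nexists>x. length x = k \<and> \<Phi> (x @ (Cs @ [e]) ! i) \<and> \<Phi> (x @ (Ds @ [d]) ! j)"
      proof (intro allI impI)
        fix i j assume i: "i < length (Cs @ [e])" and j: "j \<le> i"
        show "\<nexists>x. length x = k \<and> \<Phi> (x @ (Cs @ [e]) ! i) \<and> \<Phi> (x @ (Ds @ [d]) ! j)"
        proof (cases "i < length Cs")
          case True
          have "j < length Ds" using True j len(1) by simp
          with bad True j show ?thesis by (simp add: nth_append)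
        next
          case False
          then have "i = length Cs" using i by simp
          moreover have "(Ds @ [d]) ! j \<in> set (Ds @ [d])" using j len(1) \<open>i = length Cs\<close> by (intro nth_mem) simp
          ultimately show ?thesis using bade by simp
        qed
      qed
    qed
    then show ?thesis by blast
  qed
  have Inv0: "Inv [] []"
    unfolding Inv_def
  proof (intro conjI)
    show "ind (concat []) (concat [])" by (rule ind_mono[OF a(3)]) auto
    show "\<exists>u. eqt M u b' \<and> ind u (concat []) \<and> (\<forall>d\<in>set []. eqt M (b' @ b) (u @ d))"
      by (intro exI[of _ b'] conjI eqt_refl ind_mono[OF b'(2)]) auto
    show "\<forall>i\<le>length []. good (mix i [] [])"
      unfolding good_def by (intro allI impI exI[of _ a] conjI eqt_refl ind_mono[OF a(3)]) (auto simp: mix_def)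
  qed auto
  \<comment> \<open>The implication makes \<open>?P\<close> satisfiable for every history, as
    dependent choice demands.\<close>
  let ?P = "\<lambda>l p. Inv (map fst l) (map snd l) \<longrightarrow> Inv (map fst l @ [fst p]) (map snd l @ [snd p])"
  have "\<exists>p. ?P l p" for l
  proof (cases "Inv (map fst l) (map snd l)")
    case True
    from step[OF this] obtain c d where "Inv (map fst l @ [c]) (map snd l @ [d])" by (elim exE)
    then show ?thesis by (intro exI[of _ "(c, d)"]) simp
  qed simp
  from exists_seq[of ?P, OF this] obtain f where f: "\<forall>i. ?P (map f [0..<i]) (f i)" ..
  define c where "c = fst \<circ> f"
  define d where "d = snd \<circ> f"
  have I: "Inv (map c [0..<N]) (map d [0..<N])" for N
  proof (induction N)
    case 0 then show ?case using Inv0 by simp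
  next
    case (Suc N)
    have "map fst (map f [0..<N]) = map c [0..<N]" "map snd (map f [0..<N]) = map d [0..<N]"
      by (simp_all add: c_def d_def)
    then show ?case using f[THEN spec, of N] Suc by (simp add: c_def d_def comp_def)
  qed
  have len: "length (c i) = ?n \<and> length (d i) = ?n" for i
    using I[of "Suc i"] unfolding Inv_def by simp
  moreover have "\<exists>x. length x = k \<and> (\<forall>j<i. \<Phi> (x @ c j)) \<and> (\<forall>j. i \<le> j \<and> j < N \<longrightarrow> \<Phi> (x @ d j))" for i N
  proof -
    \<comment> \<open>The stage must have at least \<open>i\<close> entries for the cut at
      \<open>i\<close> to be covered by the invariant.\<close>
    let ?N = "max i N"
    have "good (mix i (map c [0..<?N]) (map d [0..<?N]))" using I[of ?N] unfolding Inv_def by simp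
    then obtain u where u: "eqt M u a" "\<forall>e\<in>set (mix i (map c [0..<?N]) (map d [0..<?N])). \<Phi> (u @ e)"
      unfolding good_def by (elim exE conjE)
    have "mix i (map c [0..<?N]) (map d [0..<?N]) = map c [0..<i] @ map d [i..<?N]"
      by (simp add: mix_def take_map drop_map)
    then show ?thesis using u eqt_length[OF u(1)] a(1) by (intro exI[of _ u]) auto
  qed
  moreover have "\<nexists>x. length x = k \<and> \<Phi> (x @ c i) \<and> \<Phi> (x @ d j)" if "j \<le> i" for i j
  proof -
    have *: "\<forall>i'<length (map c [0..<Suc i]). \<forall>j\<le>i'. \<nexists>x. length x = k \<and> \<Phi> (x @ map c [0..<Suc i] ! i') \<and> \<Phi> (x @ map d [0..<Suc i] ! j)"
      using I[of "Suc i"] unfolding Inv_def by (elim conjE)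
    have "\<nexists>x. length x = k \<and> \<Phi> (x @ map c [0..<Suc i] ! i) \<and> \<Phi> (x @ map d [0..<Suc i] ! j)"
      by (rule *[THEN spec[of _ i], THEN mp, THEN spec[of _ j], THEN mp]) (use that in simp_all)
    moreover have "map c [0..<Suc i] ! i = c i" "map d [0..<Suc i] ! j = d j" using that by (simp_all del: upt_Suc)
    ultimately show ?thesis by simp
  qed
  ultimately show ?thesis by (intro exI[of _ c] exI[of _ d] conjI) simp_all
qed

end

section \<open>Semantic and syntactic types\<close>

lemma holds_inst: "holds S (case_sum a id) (inst b \<phi>) = holds S (case_sum a b) \<phi>"
  unfolding inst_def sat_map by (intro sat_cong) (auto split: sum.split simp: map_sum_def)

lemma inst_in_fms: "\<phi> \<in> fms L (V <+> W) \<Longrightarrow> b ` W \<subseteq> A \<Longrightarrow> inst b \<phi> \<in> fms L (V <+> A)"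
  unfolding inst_def map_fm_in_fms by (force simp: fms_def)

context monster
begin

text \<open>\<open>b\<close> is a list of variables, possibly with repetitions, and \<open>p\<close>
  is restricted to them. For a global type whose variables are the elements of the monster model,
  \<open>b\<close> is at the same time a tuple of elements, so \<open>sem P\<close> can serve as
  \<open>r\<close>.\<close>

definition sem :: "('f, 'r, 'i + 'm) fm set \<Rightarrow> 'i list \<Rightarrow> ('m list \<Rightarrow> bool) \<Rightarrow> bool" where
  "sem p b Q \<longleftrightarrow> (\<exists>\<phi>\<in>p. \<forall>e. Q (map e b) = holds S (case_sum e id) \<phi>)"

lemma type_sat:
  assumes "is_type L S V A p" "finite F" "F \<subseteq> p" shows "\<exists>e. \<forall>\<phi>\<in>F. holds S (case_sum e id) \<phi>"
  using assms unfolding is_type_def consistent_def realizes_def by simp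

lemma type_neg:
  assumes "is_type L S V A p" "\<phi> \<in> fms L (V <+> A)" shows "Neg \<phi> \<in> p \<longleftrightarrow> \<phi> \<notin> p"
proof -
  have "\<not> (\<phi> \<in> p \<and> Neg \<phi> \<in> p)" using type_sat[OF assms(1), of "{\<phi>, Neg \<phi>}"] by auto
  moreover have "\<phi> \<in> p \<or> Neg \<phi> \<in> p" using assms unfolding is_type_def by blast
  ultimately show ?thesis by blast
qed

lemma type_implies:
  assumes "is_type L S V A p" "\<phi> \<in> p" "\<psi> \<in> fms L (V <+> A)"
    "\<And>e. holds S (case_sum e id) \<phi> \<Longrightarrow> holds S (case_sum e id) \<psi>"
  shows "\<psi> \<in> p"
proof (rule ccontr)
  assume "\<psi> \<notin> p"
  then have "Neg \<psi> \<in> p" using type_neg[OF assms(1,3)] by simp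
  with type_sat[OF assms(1), of "{\<phi>, Neg \<psi>}"] assms(2) obtain e where
    "holds S (case_sum e id) \<phi>" "\<not> holds S (case_sum e id) \<psi>" by auto
  then show False using assms(4) by blast
qed

lemma sem_iff:
  assumes "is_type L S V UNIV p" "\<phi> \<in> fms L (V <+> UNIV)" "\<And>e. Q (map e b) = holds S (case_sum e id) \<phi>"
  shows "sem p b Q \<longleftrightarrow> \<phi> \<in> p"
proof
  assume "\<phi> \<in> p" then show "sem p b Q" unfolding sem_def using assms(3) by blast
next
  assume "sem p b Q"
  then obtain \<psi> where \<psi>: "\<psi> \<in> p" "\<forall>e. Q (map e b) = holds S (case_sum e id) \<psi>" unfolding sem_def ..
  show "\<phi> \<in> p"
  proof (rule type_implies[OF assms(1) \<psi>(1) assms(2)])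
    fix e assume "holds S (case_sum e id) \<psi>"
    then show "holds S (case_sum e id) \<phi>" using \<psi>(2)[THEN spec, of e] assms(3)[of e] by simp
  qed
qed

lemma dfn_rep:
  assumes "dfn A (length b) Q"
  shows "\<exists>\<phi>\<in>fms L (set b <+> A). \<forall>e. Q (map e b) = holds S (case_sum e id) \<phi>"
proof -
  obtain \<phi> where \<phi>: "\<phi> \<in> fms L ({..<length b} <+> A)"
    "\<And>xs. length xs = length b \<Longrightarrow> Q xs = holds S (case_sum (nth xs) id) \<phi>"
    using assms unfolding dfn_def by blast
  let ?\<psi> = "map_fm (map_sum (nth b) id) \<phi>"
  have "?\<psi> \<in> fms L (set b <+> A)" using \<phi>(1) unfolding map_fm_in_fms by (fastforce simp: fms_def)
  moreover have "Q (map e b) = holds S (case_sum e id) ?\<psi>" for e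
    unfolding sat_map \<phi>(2)[of "map e b", OF length_map]
    using \<phi>(1) by (intro sat_cong) (auto simp: fms_def)
  ultimately show ?thesis by blast
qed

lemma dfn_rep0:
  assumes "dfn {} (length b) Q"
  shows "\<exists>\<phi>\<in>fms L (set b). \<forall>e. Q (map e b) = holds S e \<phi>"
proof -
  obtain \<phi> where \<phi>: "\<phi> \<in> fms L ({..<length b} <+> {})"
    "\<And>xs. length xs = length b \<Longrightarrow> Q xs = holds S (case_sum (nth xs) id) \<phi>"
    using assms unfolding dfn_def by blast
  let ?\<psi> = "map_fm (case_sum (nth b) undefined) \<phi>"
  have "?\<psi> \<in> fms L (set b)" using \<phi>(1) unfolding map_fm_in_fms by (fastforce simp: fms_def)
  moreover have "Q (map e b) = holds S e ?\<psi>" for e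
    unfolding sat_map \<phi>(2)[of "map e b", OF length_map]
    using \<phi>(1) by (intro sat_cong) (auto simp: fms_def)
  ultimately show ?thesis by blast
qed

lemma dfn_rep2:
  assumes "dfn {} (length w + n) R"
  shows "\<exists>\<phi>\<in>fms L (set w <+> {..<n}). \<forall>a y. R (map a w @ map y [0..<n]) = holds S (case_sum a y) \<phi>"
proof -
  let ?b = "map Inl w @ map Inr [0..<n]"
  have "dfn {} (length ?b) R" using assms by simp
  from dfn_rep0[OF this] obtain \<phi> where \<phi>: "\<phi> \<in> fms L (set ?b)" "\<forall>e. R (map e ?b) = holds S e \<phi>" ..
  have "set ?b = set w <+> {..<n}" by auto
  moreover have "R (map a w @ map y [0..<n]) = holds S (case_sum a y) \<phi>" for a y
    using \<phi>(2)[THEN spec, of "case_sum a y"] by (simp add: comp_def)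
  ultimately show ?thesis using \<phi>(1) by auto
qed

lemma eqt_tp: "eqt A (map b [0..<n]) (map b' [0..<n]) \<longleftrightarrow> tp L S {..<n} b A = tp L S {..<n} b' A"
proof -
  have h: "holds S (case_sum (nth (map c [0..<n])) id) \<phi> = holds S (case_sum c id) \<phi>"
    if "\<phi> \<in> fms L ({..<n} <+> A)" for c \<phi>
    using that by (intro sat_cong) (auto simp: fms_def)
  show ?thesis
  proof
    assume e: "eqt A (map b [0..<n]) (map b' [0..<n])"
    have "holds S (case_sum b id) \<phi> = holds S (case_sum b' id) \<phi>" if \<phi>: "\<phi> \<in> fms L ({..<n} <+> A)" for \<phi>
    proof -
      have "dfn A n (\<lambda>xs. holds S (case_sum (nth xs) id) \<phi>)" using \<phi> unfolding dfn_def by blast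
      with eqtD[OF e, of "\<lambda>xs. holds S (case_sum (nth xs) id) \<phi>"] show ?thesis using h[OF \<phi>] by simp
    qed
    then show "tp L S {..<n} b A = tp L S {..<n} b' A" unfolding tp_def by blast
  next
    assume t: "tp L S {..<n} b A = tp L S {..<n} b' A"
    show "eqt A (map b [0..<n]) (map b' [0..<n])"
    proof (rule eqtI)
      fix Q assume Q: "dfn A (length (map b [0..<n])) Q" "Q (map b [0..<n])"
      then obtain \<phi> where \<phi>: "\<phi> \<in> fms L ({..<n} <+> A)"
        "\<And>xs. length xs = n \<Longrightarrow> Q xs = holds S (case_sum (nth xs) id) \<phi>"
        unfolding dfn_def by auto
      have "\<phi> \<in> tp L S {..<n} b A" using Q(2) \<phi>(2)[of "map b [0..<n]"] h[OF \<phi>(1)] \<phi>(1) by (simp add: tp_def)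
      then have "holds S (case_sum b' id) \<phi>" unfolding t by (simp add: tp_def)
      then show "Q (map b' [0..<n])" using \<phi>(2)[of "map b' [0..<n]"] h[OF \<phi>(1)] by simp
    qed simp
  qed
qed

lemma dfn_rep_UNIV:
  assumes "dfn A (length b) Q" "set b \<subseteq> V"
  shows "\<exists>\<phi>\<in>fms L (V <+> A). \<forall>e. Q (map e b) = holds S (case_sum e id) \<phi>"
proof -
  have "fms L (set b <+> A) \<subseteq> fms L (V <+> A)" using assms(2) unfolding fms_def by auto
  with dfn_rep[OF assms(1)] show ?thesis by blast
qed

text \<open>Two variable sets occur because invariance of the witnessing type is available only for
  its restriction to a small \<open>W\<close>, whereas completeness holds for all of
  \<open>V\<close>.\<close>

lemma inv_sem:
  assumes t: "is_type L S V UNIV p" and i: "invariant_type L S M W (restr L W UNIV p)"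
    and b: "set b \<subseteq> W" "W \<subseteq> V"
  shows "inv_type M (length b) (sem p b)"
proof -
  have bV: "set b \<subseteq> V" using b by auto
  have rep: "\<exists>\<phi>\<in>fms L (V <+> UNIV). \<forall>e. Q (map e b) = holds S (case_sum e id) \<phi>" if "dfn UNIV (length b) Q" for Q
    by (rule dfn_rep_UNIV[OF that bV])
  show ?thesis
    unfolding inv_type_def
  proof (intro conjI allI impI)
    fix Q assume "dfn UNIV (length b) Q"
    from rep[OF this] obtain \<phi> where \<phi>: "\<phi> \<in> fms L (V <+> UNIV)" "\<forall>e. Q (map e b) = holds S (case_sum e id) \<phi>" ..
    have "Neg \<phi> \<in> fms L (V <+> UNIV)" using \<phi>(1) by (simp add: fms_def)
    then have "sem p b (\<lambda>x. \<not> Q x) \<longleftrightarrow> Neg \<phi> \<in> p" by (rule sem_iff[OF t]) (use \<phi>(2) in simp)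
    moreover have "sem p b Q \<longleftrightarrow> \<phi> \<in> p" by (rule sem_iff[OF t \<phi>(1)]) (use \<phi>(2) in simp)
    ultimately show "sem p b (\<lambda>x. \<not> Q x) = (\<not> sem p b Q)" using type_neg[OF t \<phi>(1)] by simp
  next
    fix Q R assume QR: "dfn UNIV (length b) Q" "dfn UNIV (length b) R" and *: "sem p b Q" "sem p b R"
    from rep[OF QR(1)] obtain \<phi> where \<phi>: "\<phi> \<in> fms L (V <+> UNIV)" "\<forall>e. Q (map e b) = holds S (case_sum e id) \<phi>" ..
    from rep[OF QR(2)] obtain \<psi> where \<psi>: "\<psi> \<in> fms L (V <+> UNIV)" "\<forall>e. R (map e b) = holds S (case_sum e id) \<psi>" ..
    have in_p: "\<phi> \<in> p" "\<psi> \<in> p"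
      using * sem_iff[OF t \<phi>(1), of Q b] sem_iff[OF t \<psi>(1), of R b] \<phi>(2) \<psi>(2) by simp_all
    have c: "Conj \<phi> \<psi> \<in> fms L (V <+> UNIV)" using \<phi>(1) \<psi>(1) by (simp add: fms_def)
    have "Neg (Conj \<phi> \<psi>) \<notin> p" using type_sat[OF t, of "{\<phi>, \<psi>, Neg (Conj \<phi> \<psi>)}"] in_p by auto
    then have "Conj \<phi> \<psi> \<in> p" using type_neg[OF t c] by simp
    then show "sem p b (\<lambda>x. Q x \<and> R x)"
      unfolding sem_def by (rule bexI[rotated]) (use \<phi>(2) \<psi>(2) in simp)
  next
    fix Q assume "dfn UNIV (length b) Q" "sem p b Q"
    from this(2) obtain \<phi> where \<phi>: "\<phi> \<in> p" "\<forall>e. Q (map e b) = holds S (case_sum e id) \<phi>" unfolding sem_def ..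
    from type_sat[OF t, of "{\<phi>}"] \<phi>(1) obtain e where "holds S (case_sum e id) \<phi>" by auto
    then have "Q (map e b)" using \<phi>(2) by simp
    then show "\<exists>x. length x = length b \<and> Q x" by (intro exI[of _ "map e b"]) simp
  next
    fix R ys ys'
    assume R: "dfn {} (length b + length ys) R" and e: "eqt M ys ys'" and s: "sem p b (\<lambda>x. R (x @ ys))"
    let ?m = "length ys"
    have l: "length ys' = ?m" using eqt_length[OF e] by simp
    from dfn_rep2[OF R] obtain \<phi> where \<phi>: "\<phi> \<in> fms L (set b <+> {..<?m})"
      "\<forall>a y. R (map a b @ map y [0..<?m]) = holds S (case_sum a y) \<phi>" ..
    have \<phi>W: "\<phi> \<in> fms L (W <+> {..<?m})" using \<phi>(1) b(1) by (auto simp: fms_def)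
    have rp: "sem p b (\<lambda>x. R (x @ zs)) \<longleftrightarrow> inst (nth zs) \<phi> \<in> restr L W UNIV p" if "length zs = ?m" for zs
    proof -
      have iW: "inst (nth zs) \<phi> \<in> fms L (W <+> UNIV)" by (rule inst_in_fms[OF \<phi>W]) simp
      then have iV: "inst (nth zs) \<phi> \<in> fms L (V <+> UNIV)" using b(2) by (auto simp: fms_def)
      have "map (nth zs) [0..<?m] = zs" using that map_nth[of zs] by simp
      then have "sem p b (\<lambda>x. R (x @ zs)) \<longleftrightarrow> inst (nth zs) \<phi> \<in> p"
        using \<phi>(2) by (intro sem_iff[OF t iV]) (metis holds_inst)
      then show ?thesis using iW by (simp add: restr_def)
    qed
    have "eqt M (map (nth ys) [0..<?m]) (map (nth ys') [0..<?m])"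
      using e l map_nth[of ys] map_nth[of ys'] by simp
    then have "tp L S {..<?m} (nth ys) M = tp L S {..<?m} (nth ys') M" unfolding eqt_tp .
    then have "inst (nth ys) \<phi> \<in> restr L W UNIV p \<longleftrightarrow> inst (nth ys') \<phi> \<in> restr L W UNIV p"
      using i \<phi>W unfolding invariant_type_def by blast
    then show "sem p b (\<lambda>x. R (x @ ys'))" using s rp[OF refl] rp[OF l] by simp
  qed
qed

lemma real_sem:
  assumes "is_type L S V UNIV p" "realizes S c (restr L W A p)" "set b \<subseteq> W" "W \<subseteq> V"
  shows "realizer (sem p b) (length b) A (map c b)"
proof (rule realI)
  fix Q assume Q: "dfn A (length b) Q" "sem p b Q"
  from dfn_rep_UNIV[OF Q(1) assms(3)] obtain \<phi> where
    \<phi>: "\<phi> \<in> fms L (W <+> A)" "\<forall>e. Q (map e b) = holds S (case_sum e id) \<phi>" ..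
  have "\<phi> \<in> fms L (V <+> UNIV)" using \<phi>(1) assms(4) by (auto simp: fms_def)
  then have "\<phi> \<in> p" using sem_iff[OF assms(1), of \<phi> Q b] \<phi>(2) Q(2) by simp
  then have "holds S (case_sum c id) \<phi>" using assms(2) \<phi>(1) unfolding realizes_def restr_def by blast
  then show "Q (map c b)" using \<phi>(2) by simp
qed simp

lemma mor_sem:
  fixes c :: "nat \<Rightarrow> 'i \<Rightarrow> 'm"
  assumes t: "is_type L S V UNIV p" and c: "morley_seq L S M W (restr L W UNIV p) c" and b: "set b \<subseteq> W" "W \<subseteq> V"
  shows "mor M (length b) (sem p b) (map (\<lambda>i. map (c i) b) [0..<N])"
proof (induction N)
  case 0 then show ?case by (simp add: mor_Nil)
next
  case (Suc N)
  let ?A = "M \<union> (\<Union>j\<in>{..<N}. c j ` W)"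
  have "fms L (W <+> ?A) \<subseteq> fms L (W <+> UNIV)" by (auto simp: fms_def)
  then have "restr L W ?A (restr L W UNIV p) = restr L W ?A p" unfolding restr_def by blast
  then have "realizes S (c N) (restr L W ?A p)" using c unfolding morley_seq_def by metis
  from real_sem[OF t this b] have "realizer (sem p b) (length b) ?A (map (c N) b)" .
  then have "realizer (sem p b) (length b) (M \<union> set (concat (map (\<lambda>i. map (c i) b) [0..<N]))) (map (c N) b)"
    by (rule real_mono) (use b(1) in \<open>fastforce simp: subset_iff\<close>)
  then show ?case using Suc by (simp add: mor_snoc)
qed

text \<open>The passage opposite to \<open>sem\<close>, from predicates back to formulas:
  \<open>g v\<close> is the coordinate that represents the variable \<open>v\<close>.\<close>

definition form :: "(('m list \<Rightarrow> bool) \<Rightarrow> bool) \<Rightarrow> 'i set \<Rightarrow> ('i \<Rightarrow> nat) \<Rightarrow> ('f, 'r, 'i + 'm) fm set" where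
  "form p V g = {\<phi> \<in> fms L (V <+> UNIV). p (\<lambda>x. holds S (case_sum (\<lambda>v. x ! g v) id) \<phi>)}"

lemma dfn_form:
  assumes "\<phi> \<in> fms L (V <+> A)" "\<And>v. v \<in> V \<Longrightarrow> g v < n"
  shows "dfn A n (\<lambda>x. holds S (case_sum (\<lambda>v. x ! g v) id) \<phi>)"
proof (rule dfn_fm[OF assms(1)])
  fix w assume "w \<in> V <+> A"
  then show "(\<exists>j<n. \<forall>xs. length xs = n \<longrightarrow> case_sum (\<lambda>v. xs ! g v) id w = xs ! j)
       \<or> (\<exists>a\<in>A. \<forall>xs. length xs = n \<longrightarrow> case_sum (\<lambda>v. xs ! g v) id w = a)"
  proof (elim PlusE)
    fix v assume "v \<in> V" "w = Inl v"
    then show ?thesis using assms(2)[of v] by (intro disjI1 exI[of _ "g v"]) simp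
  next
    fix a assume "a \<in> A" "w = Inr a"
    then show ?thesis by (intro disjI2 bexI[of _ a]) simp_all
  qed
qed

lemma inv_form:
  fixes V :: "'i set"
  assumes p: "inv_type M n p" and g: "\<And>v. v \<in> V \<Longrightarrow> g v < n"
  shows "invariant_type L S M V (form p V g)"
  unfolding invariant_type_def is_type_def
proof (intro conjI ballI allI impI)
  show "form p V g \<subseteq> fms L (V <+> UNIV)" by (auto simp: form_def)
  show "consistent S (form p V g)"
    unfolding consistent_def realizes_def
  proof (intro allI impI)
    fix F assume F: "F \<subseteq> form p V g" "finite F"
    let ?Q = "\<lambda>\<phi> x. holds S (case_sum (\<lambda>v. x ! g v) id) \<phi>"
    have *: "dfn UNIV n (?Q \<phi>)" "p (?Q \<phi>)" if "\<phi> \<in> F" for \<phi>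
    proof -
      have "\<phi> \<in> fms L (V <+> UNIV)" "p (?Q \<phi>)" using that F(1) by (auto simp: form_def)
      then show "dfn UNIV n (?Q \<phi>)" "p (?Q \<phi>)" using dfn_form[OF _ g, of \<phi> V UNIV] by simp_all
    qed
    have "p (\<lambda>x. \<forall>\<phi>\<in>F. ?Q \<phi> x)" by (rule inv_ball[OF p F(2) *])
    moreover have "dfn UNIV n (\<lambda>x. \<forall>\<phi>\<in>F. ?Q \<phi> x)" by (rule dfn_ball[OF F(2) *(1)])
    ultimately obtain x where "\<forall>\<phi>\<in>F. ?Q \<phi> x" using inv_sat[OF p] by blast
    then show "\<exists>a. \<forall>\<phi>\<in>F. holds S (case_sum a id) \<phi>" by (intro exI[of _ "\<lambda>v. x ! g v"])
  qed
next
  fix \<phi> :: "('f, 'r, 'i + 'm) fm" assume \<phi>: "\<phi> \<in> fms L (V <+> UNIV)"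
  have "Neg \<phi> \<in> fms L (V <+> UNIV)" using \<phi> by (simp add: fms_def)
  moreover have "p (\<lambda>x. holds S (case_sum (\<lambda>v. x ! g v) id) (Neg \<phi>)) = (\<not> p (\<lambda>x. holds S (case_sum (\<lambda>v. x ! g v) id) \<phi>))"
    using inv_not[OF p dfn_form[OF \<phi> g]] by simp
  ultimately show "\<phi> \<in> form p V g \<or> Neg \<phi> \<in> form p V g" using \<phi> unfolding form_def by blast
next
  fix m :: nat and b b' :: "nat \<Rightarrow> 'm" and \<phi>
  assume \<phi>: "\<phi> \<in> fms L (V <+> {..<m})" and t: "tp L S {..<m} b M = tp L S {..<m} b' M"
  let ?R = "\<lambda>z. holds S (case_sum (\<lambda>v. z ! g v) (\<lambda>j. z ! (n + j))) \<phi>"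
  have dR: "dfn {} (n + length (map b [0..<m])) ?R"
  proof (rule dfn_fm[OF \<phi>])
    fix w assume "w \<in> V <+> {..<m}"
    then consider (1) v where "w = Inl v" "v \<in> V" | (2) j where "w = Inr j" "j < m" by auto
    then show "(\<exists>j<n + length (map b [0..<m]). \<forall>xs. length xs = n + length (map b [0..<m]) \<longrightarrow>
          case_sum (\<lambda>v. xs ! g v) (\<lambda>j. xs ! (n + j)) w = xs ! j)
       \<or> (\<exists>a\<in>{}. \<forall>xs. length xs = n + length (map b [0..<m]) \<longrightarrow> case_sum (\<lambda>v. xs ! g v) (\<lambda>j. xs ! (n + j)) w = a)"
    proof cases
      case 1 then show ?thesis using g[of v] by (intro disjI1 exI[of _ "g v"]) simp
    next
      case 2 then show ?thesis by (intro disjI1 exI[of _ "n + j"]) simp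
    qed
  qed
  have e: "eqt M (map b [0..<m]) (map b' [0..<m])" using t unfolding eqt_tp .
  have i: "inst c \<phi> \<in> form p V g \<longleftrightarrow> p (\<lambda>x. ?R (x @ map c [0..<m]))" for c
  proof -
    have ic: "inst c \<phi> \<in> fms L (V <+> UNIV)" by (rule inst_in_fms[OF \<phi>]) simp
    have "p (\<lambda>x. holds S (case_sum (\<lambda>v. x ! g v) id) (inst c \<phi>)) = p (\<lambda>x. ?R (x @ map c [0..<m]))"
    proof (rule inv_cong[OF p dfn_form[OF ic g]])
      fix x :: "'m list" assume "length x = n"
      then show "holds S (case_sum (\<lambda>v. x ! g v) id) (inst c \<phi>) = ?R (x @ map c [0..<m])"
        unfolding holds_inst using \<phi> g by (intro sat_cong) (auto simp: fms_def nth_append)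
    qed
    then show ?thesis using ic by (simp add: form_def)
  qed
  show "inst b \<phi> \<in> form p V g \<longleftrightarrow> inst b' \<phi> \<in> form p V g"
    unfolding i by (rule inv_inv0[OF p dR e])
qed

lemma morley_form:
  assumes p: "inv_type M n p" and g: "\<And>v. v \<in> V \<Longrightarrow> g v < n"
    and f: "\<And>N. mor M n p (map f [0..<N])"
  shows "morley_seq L S M V (form p V g) (\<lambda>(i::nat) v. f i ! g v)"
  unfolding morley_seq_def realizes_def
proof (intro allI ballI)
  fix i \<phi>
  let ?A = "M \<union> (\<Union>j\<in>{..<i}. (\<lambda>v. f j ! g v) ` V)"
  assume "\<phi> \<in> restr L V ?A (form p V g)"
  then have \<phi>: "\<phi> \<in> fms L (V <+> ?A)" "p (\<lambda>x. holds S (case_sum (\<lambda>v. x ! g v) id) \<phi>)"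
    by (auto simp: restr_def form_def)
  have m: "mor M n p (map f [0..<i])" "realizer p n (M \<union> set (concat (map f [0..<i]))) (f i)"
    using f[of "Suc i"] by (simp_all add: mor_snoc)
  have "f j ! g v \<in> set (f j)" if "j < i" "v \<in> V" for j v
  proof -
    have "realizer p n M (f j)" by (rule mor_real[OF m(1)]) (use that(1) in auto)
    then show ?thesis using g[OF that(2)] real_length[of p n M "f j"] by simp
  qed
  then have "?A \<subseteq> M \<union> set (concat (map f [0..<i]))" by auto
  from real_mono[OF m(2) this] have "realizer p n ?A (f i)" .
  from realD[OF this dfn_form[OF \<phi>(1) g] \<phi>(2)] show "holds S (case_sum (\<lambda>v. f i ! g v) id) \<phi>" .
qed

text \<open>Finite parts of the family lie in initial segments. Distinctness of \<open>w\<close>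
  lets every list of solutions be read as an assignment to the variables.\<close>

lemma consistent_iff:
  fixes c :: "nat \<Rightarrow> 'j \<Rightarrow> 'm"
  assumes rep: "\<And>a y. holds S (case_sum a y) \<phi> = R (map a w @ map y b)" and w: "distinct w"
  shows "consistent S (range (\<lambda>i. inst (c i) \<phi>)) \<longleftrightarrow> (\<forall>N. \<exists>x. length x = length w \<and> (\<forall>i<N. R (x @ map (c i) b)))"
proof
  assume con: "consistent S (range (\<lambda>i. inst (c i) \<phi>))"
  show "\<forall>N. \<exists>x. length x = length w \<and> (\<forall>i<N. R (x @ map (c i) b))"
  proof
    fix N
    let ?F = "(\<lambda>i. inst (c i) \<phi>) ` {..<N}"
    have "?F \<subseteq> range (\<lambda>i. inst (c i) \<phi>)" "finite ?F" by auto
    with con[unfolded consistent_def realizes_def, THEN spec[of _ ?F]]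
    have "\<exists>a. \<forall>\<psi>\<in>?F. holds S (case_sum a id) \<psi>" by simp
    then obtain a where a: "\<forall>\<psi>\<in>?F. holds S (case_sum a id) \<psi>" ..
    have "R (map a w @ map (c i) b)" if "i < N" for i
    proof -
      have "holds S (case_sum a id) (inst (c i) \<phi>)" by (rule bspec[OF a]) (use that in simp)
      then show ?thesis unfolding holds_inst rep .
    qed
    then show "\<exists>x. length x = length w \<and> (\<forall>i<N. R (x @ map (c i) b))" by (intro exI[of _ "map a w"]) simp
  qed
next
  assume *: "\<forall>N. \<exists>x. length x = length w \<and> (\<forall>i<N. R (x @ map (c i) b))"
  show "consistent S (range (\<lambda>i. inst (c i) \<phi>))"
    unfolding consistent_def realizes_def
  proof (intro allI impI)
    fix F assume "F \<subseteq> range (\<lambda>i. inst (c i) \<phi>)" "finite F"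
    then obtain I where I: "finite I" "F = (\<lambda>i. inst (c i) \<phi>) ` I" by (meson finite_subset_image)
    then obtain N where N: "\<forall>i\<in>I. i < N" using finite_nat_set_iff_bounded by blast
    obtain x where x: "length x = length w" "\<forall>i<N. R (x @ map (c i) b)" using *[THEN spec, of N] by (elim exE conjE)
    have "\<exists>a. map a w = x"
    \<comment> \<open>A variable takes the entry of \<open>x\<close> at its unique position in
      \<open>w\<close>; variables outside \<open>w\<close> may take any value.\<close>
    proof (intro exI[of _ "\<lambda>v. x ! (THE i. i < length w \<and> w ! i = v)"] nth_equalityI)
      fix i assume "i < length (map (\<lambda>v. x ! (THE i. i < length w \<and> w ! i = v)) w)"
      then have i: "i < length w" by simp
      have "(THE j. j < length w \<and> w ! j = w ! i) = i"
        by (rule the_equality) (use i w in \<open>auto simp: nth_eq_iff_index_eq\<close>)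
      then show "map (\<lambda>v. x ! (THE i. i < length w \<and> w ! i = v)) w ! i = x ! i" using i by simp
    qed (use x(1) in simp)
    then obtain a where a: "map a w = x" ..
    have "holds S (case_sum a id) (inst (c i) \<phi>)" if "i \<in> I" for i
      unfolding holds_inst rep a using x(2) N that by simp
    then show "\<exists>a. \<forall>\<psi>\<in>F. holds S (case_sum a id) \<psi>" unfolding I(2) by (intro exI[of _ a]) simp
  qed
qed

end

section \<open>Strong witnessing and Conant-independence\<close>

context monster
begin

lemma index_function: "\<exists>g. \<forall>v\<in>set b. g v < length b \<and> b ! g v = v"
proof -
  have "\<forall>v\<in>set b. \<exists>i. i < length b \<and> b ! i = v" by (auto simp: in_set_conv_nth)
  from bchoice[OF this] show ?thesis .
qed

lemma dfn_rep_pair: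
  fixes w :: "'i list"
  assumes "\<phi> \<in> fms L (set w <+> {..<n})" "distinct w"
  shows "\<exists>R. dfn {} (length w + n) R \<and> (\<forall>a y. holds S (case_sum a y) \<phi> = R (map a w @ map y [0..<n]))"
proof -
  obtain g where g: "\<forall>v\<in>set w. g v < length w \<and> w ! g v = v" using index_function ..
  let ?R = "\<lambda>z. holds S (case_sum (\<lambda>v. z ! g v) (\<lambda>j. z ! (length w + j))) \<phi>"
  have "dfn {} (length w + n) ?R"
  proof (rule dfn_fm[OF assms(1)])
    fix u assume "u \<in> set w <+> {..<n}"
    then show "(\<exists>j<length w + n. \<forall>xs. length xs = length w + n \<longrightarrow>
          case_sum (\<lambda>v. xs ! g v) (\<lambda>j. xs ! (length w + j)) u = xs ! j)
       \<or> (\<exists>a\<in>{}. \<forall>xs. length xs = length w + n \<longrightarrow> case_sum (\<lambda>v. xs ! g v) (\<lambda>j. xs ! (length w + j)) u = a)"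
    proof (elim PlusE)
      fix v assume "v \<in> set w" "u = Inl v"
      then show ?thesis using g by (intro disjI1 exI[of _ "g v"]) auto
    next
      fix j assume "j \<in> {..<n}" "u = Inr j"
      then show ?thesis by (intro disjI1 exI[of _ "length w + j"]) simp
    qed
  qed
  moreover have "holds S (case_sum a y) \<phi> = ?R (map a w @ map y [0..<n])" for a y
    using assms(1) g by (intro sat_cong) (auto simp: fms_def nth_append)
  ultimately show ?thesis by blast
qed

text \<open>All tuples use restrictions of one global type, which gives coherence. An arbitrary
  semantic competitor is turned into a syntactic invariant type, so that leastness in the
  Kim-dividing order can be applied to it.\<close>

lemma witness_exists:
  assumes "elem_sub L S M" and small: "small M" and "strong_witnessing L \<kappa> S"
  shows "\<exists>r. witness L \<kappa> S M r"
proof -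
  have "\<exists>P :: ('f, 'r, 'm + 'm) fm set. is_type L S UNIV UNIV P \<and> tp L S UNIV id M \<subseteq> P
        \<and> (\<forall>V. |V| <o \<kappa> \<longrightarrow> least_type L S M V (restr L V UNIV P))"
    using assms(3) unfolding strong_witnessing_def using assms(1) small_less[OF small] by simp
  then obtain P :: "('f, 'r, 'm + 'm) fm set" where P: "is_type L S UNIV UNIV P" "tp L S UNIV id M \<subseteq> P"
    "\<forall>V. |V| <o \<kappa> \<longrightarrow> least_type L S M V (restr L V UNIV P)" by (elim exE conjE)
  have least: "least_type L S M (set b) (restr L (set b) UNIV P)" for b
    using P(3) small_less[OF small_finite[of "set b"]] by simp
  \<comment> \<open>The type over \<open>M\<close> of the self-enumerated monster model is complete,
    so containing it decides every formula over \<open>M\<close> in the type.\<close>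
  have P_id: "\<phi> \<in> P \<longleftrightarrow> holds S (case_sum id id) \<phi>" if "\<phi> \<in> fms L (UNIV <+> M)" for \<phi>
  proof -
    have \<phi>U: "\<phi> \<in> fms L (UNIV <+> UNIV)" using that by (auto simp: fms_def)
    have "\<phi> \<in> tp L S UNIV id M" if "holds S (case_sum id id) \<phi>"
      using that \<open>\<phi> \<in> fms L (UNIV <+> M)\<close> by (simp add: tp_def)
    moreover have "Neg \<phi> \<in> tp L S UNIV id M" if "\<not> holds S (case_sum id id) \<phi>"
      using that \<open>\<phi> \<in> fms L (UNIV <+> M)\<close> by (simp add: tp_def fms_def)
    ultimately show ?thesis using P(2) type_neg[OF P(1) \<phi>U] by blast
  qed
  have inv: "inv_type M (length b) (sem P b)" for b
    using inv_sem[OF P(1), of M "set b" b] least[of b] unfolding least_type_def by simp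
  have "witness L \<kappa> S M (sem P)"
  proof
    show "small M" by (rule small)
    show "inv_type M (length b) (sem P b)" for b by (rule inv)
    show "realizer (sem P b) (length b) M b" for b
    proof (rule realI)
      fix Q assume Q: "dfn M (length b) Q" "sem P b Q"
      from dfn_rep_UNIV[OF Q(1) subset_UNIV] obtain \<phi> where
        \<phi>: "\<phi> \<in> fms L (UNIV <+> M)" "\<forall>e. Q (map e b) = holds S (case_sum e id) \<phi>" ..
      have "\<phi> \<in> fms L (UNIV <+> UNIV)" using \<phi>(1) by (auto simp: fms_def)
      then have "\<phi> \<in> P" using sem_iff[OF P(1), of \<phi> Q b] \<phi>(2) Q(2) by simp
      then show "Q b" using P_id[OF \<phi>(1)] \<phi>(2)[THEN spec, of id] by simp
    qed simp
    show "sem P (F b) = push F (sem P b)" if F: "sub {} (length b) m F" for b m F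
    proof
      fix Q
      \<comment> \<open>A substitution without constants only selects coordinates, hence commutes
        with evaluating variables.\<close>
      have "map e (F b) = F (map e b)" for e
      proof (rule nth_equalityI)
        show "length (map e (F b)) = length (F (map e b))" using F by (simp add: sub_def)
        fix i assume "i < length (map e (F b))"
        then have "i < m" using F by (simp add: sub_def)
        then obtain j where "j < length b" "\<forall>xs. length xs = length b \<longrightarrow> F xs ! i = xs ! j"
          using F unfolding sub_def by blast
        then show "map e (F b) ! i = F (map e b) ! i" using \<open>i < length (map e (F b))\<close> by simp
      qed
      then show "sem P (F b) Q = push F (sem P b) Q" unfolding sem_def push_def by simp
    qed
    show "CP M (length b) (sem P b) k R"
      if p: "inv_type M (length b) p" "realizer p (length b) M b" and R: "dfn {} (k + length b) R"
        and cp: "CP M (length b) p k R" for b p k R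
    proof (rule ccontr)
      assume nCP: "\<not> CP M (length b) (sem P b) k R"
      obtain g where g: "\<forall>v\<in>set b. g v < length b \<and> b ! g v = v" using index_function ..
      let ?V = "set b"
      let ?q = "form p ?V g"
      let ?w = "[0..<k]"
      have gl: "g v < length b" if "v \<in> ?V" for v using g that by simp
      let ?bs = "map Inl ?w @ map Inr b"
      have "dfn {} (length ?bs) R" using R by simp
      from dfn_rep0[OF this] obtain \<phi> where \<phi>0: "\<phi> \<in> fms L (set ?bs)" "\<forall>e. R (map e ?bs) = holds S e \<phi>" ..
      have \<phi>: "\<phi> \<in> fms L (UNIV <+> ?V)" using \<phi>0(1) by (auto simp: fms_def)
      have rep: "holds S (case_sum a y) \<phi> = R (map a ?w @ map y b)" for a y
        using \<phi>0(2)[THEN spec, of "case_sum a y"] by (simp add: comp_def)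
      have "restr L ?V M ?q = restr L ?V M (restr L ?V UNIV P)"
      proof -
        have "\<phi> \<in> ?q \<longleftrightarrow> \<phi> \<in> restr L ?V UNIV P" if \<phi>: "\<phi> \<in> fms L (?V <+> M)" for \<phi>
        proof -
          have \<phi>U: "\<phi> \<in> fms L (?V <+> UNIV)" "\<phi> \<in> fms L (UNIV <+> M)" using \<phi> by (auto simp: fms_def)
          have "\<phi> \<in> ?q \<longleftrightarrow> holds S (case_sum (\<lambda>v. b ! g v) id) \<phi>"
            using real_iff[OF p dfn_form[OF \<phi> gl]] \<phi>U(1) by (simp add: form_def)
          also have "\<dots> \<longleftrightarrow> holds S (case_sum id id) \<phi>"
            using \<phi> g by (intro sat_cong) (auto simp: fms_def)
          finally show ?thesis using P_id[OF \<phi>U(2)] \<phi>U(1) by (simp add: restr_def)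
        qed
        then show ?thesis unfolding restr_def by blast
      qed
      moreover have "invariant_type L S M ?V ?q" by (rule inv_form[OF p(1) gl])
      ultimately have ge: "kim_ge L S M ?V ?q (restr L ?V UNIV P)" using least[of b] unfolding least_type_def by blast
      have real_id: "realizes S id (restr L ?V M ?q)"
        unfolding \<open>restr L ?V M ?q = restr L ?V M (restr L ?V UNIV P)\<close> realizes_def
      proof
        fix \<psi> assume \<psi>: "\<psi> \<in> restr L ?V M (restr L ?V UNIV P)"
        then have "\<psi> \<in> fms L (UNIV <+> M)" by (auto simp: restr_def fms_def)
        with P_id[OF this] \<psi> show "holds S (case_sum id id) \<psi>" by (simp add: restr_def)
      qed
      \<comment> \<open>One consistent Morley sequence would already give \<open>CP\<close> along
        \<open>sem P\<close>. Leastness then makes \<open>\<phi>\<close> divide along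
        \<open>?q\<close> too, against the consistent sequence that \<open>cp\<close>
        supplies.\<close>
      have "kim_divides_wrt L S M ?V (restr L ?V UNIV P) \<phi> id"
        unfolding kim_divides_wrt_def
      proof (intro allI impI notI)
        fix c :: "nat \<Rightarrow> 'm \<Rightarrow> 'm"
        assume c: "morley_seq L S M ?V (restr L ?V UNIV P) c \<and> (\<forall>v\<in>?V. c 0 v = id v)"
          and con: "consistent S (range (\<lambda>i. inst (c i) \<phi>))"
        have "CP M (length b) (sem P b) k R"
        proof (rule CPI[OF inv dfn_mono[OF R empty_subsetI]])
          fix N
          from con obtain x where x: "length x = k" "\<forall>i<N. R (x @ map (c i) b)"
            unfolding consistent_iff[OF rep distinct_upt] by auto
          have m: "mor M (length b) (sem P b) (map (\<lambda>i. map (c i) b) [0..<N])"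
            by (rule mor_sem[OF P(1) conjunct1[OF c]]) auto
          show "\<exists>cs. mor M (length b) (sem P b) cs \<and> length cs = N \<and> (\<exists>x. length x = k \<and> (\<forall>c\<in>set cs. R (x @ c)))"
            by (rule exI[of _ "map (\<lambda>i. map (c i) b) [0..<N]"], intro conjI m exI[of _ x]) (use x in auto)
        qed
        with nCP show False ..
      qed
      then have kd: "kim_divides_wrt L S M ?V ?q \<phi> id" using ge \<phi> real_id unfolding kim_ge_def by blast
      from morley_exists[OF p(1) small p(2)] obtain f where f: "f 0 = b" "\<forall>N. mor M (length b) p (map f [0..<N])"
        by (elim exE conjE)
      let ?c = "\<lambda>(i::nat) v. f i ! g v"
      have "morley_seq L S M ?V ?q ?c" by (rule morley_form[OF p(1) gl]) (use f(2) in simp_all)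
      moreover have "\<forall>v\<in>?V. ?c 0 v = id v" using f(1) g by simp
      ultimately have ncon: "\<not> consistent S (range (\<lambda>i. inst (?c i) \<phi>))" using kd unfolding kim_divides_wrt_def by blast
      have "\<exists>x. length x = length ?w \<and> (\<forall>i<N. R (x @ map (?c i) b))" for N
      proof -
        from CPD[OF cp f(2)[THEN spec, of N]] obtain x where x: "length x = k" "\<forall>c\<in>set (map f [0..<N]). R (x @ c)"
          by (elim exE conjE)
        \<comment> \<open>\<open>b\<close> may repeat entries and \<open>g\<close> selects one
          position for each. Nothing is lost, since \<open>f i\<close> has the type of
          \<open>b\<close> and repeats its entries in the same places.\<close>
        have "map (?c i) b = f i" if i: "i < N" for i
        proof -
          have "realizer p (length b) M (f i)" by (rule mor_real[OF f(2)[THEN spec, of N]]) (use i in simp)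
          from real_eqt0[OF p this] have e: "eqt M b (f i)" .
          show ?thesis
          proof (rule nth_equalityI)
            show "length (map (?c i) b) = length (f i)" using eqt_length[OF e] by simp
            fix j assume "j < length (map (?c i) b)"
            then have j: "j < length b" by simp
            then have gj: "g (b ! j) < length b" "b ! g (b ! j) = b ! j" using g by simp_all
            from eqtD[OF e dfn_eq[OF gj(1) j]] gj(2) show "map (?c i) b ! j = f i ! j" using j by simp
          qed
        qed
        then show ?thesis using x by (intro exI[of _ x]) simp
      qed
      then have "consistent S (range (\<lambda>i. inst (?c i) \<phi>))" unfolding consistent_iff[OF rep distinct_upt] by blast
      with ncon show False ..
    qed
  qed
  then show ?thesis by (intro exI[of _ "sem P"])
qed

end

context witness
begin

text \<open>\<open>r\<close> of the parameter tuple is one of the invariant types over which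
  Conant-dividing quantifies; being least, it is consistent for \<open>R\<close> as soon as any
  other is. So one type decides Conant-dividing.\<close>

lemma not_CP_conant_divides:
  fixes w :: "'i list"
  assumes w: "distinct w" and R: "dfn {} (length w + n) R"
    and rep: "\<And>a y. holds S (case_sum a y) \<phi> = R (map a w @ map y [0..<n])"
  shows "conant_divides L S M \<phi> n c \<longleftrightarrow> \<not> CPr (map c [0..<n]) (length w) R"
proof
  let ?b = "map c [0..<n]"
  assume cd: "conant_divides L S M \<phi> n c"
  show "\<not> CPr ?b (length w) R"
  proof
    assume cp: "CPr ?b (length w) R"
    let ?q = "form (r ?b) {..<n} id"
    have inv: "inv_type M n (r ?b)" using r_inv[of ?b] by simp
    from morley_exists[OF r_inv[of ?b] small_M r_real] obtain f where
      f: "f 0 = ?b" "\<forall>N. mor M (length ?b) (r ?b) (map f [0..<N])" by (elim exE conjE)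
    let ?c = "\<lambda>(i::nat) j. f i ! id j"
    have "invariant_type L S M {..<n} ?q" by (rule inv_form[OF inv]) simp
    moreover have "morley_seq L S M {..<n} ?q ?c" by (rule morley_form[OF inv]) (use f(2) in simp_all)
    moreover have "\<forall>j<n. ?c 0 j = c j" using f(1) by simp
    ultimately have ncon: "\<not> consistent S (range (\<lambda>i. inst (?c i) \<phi>))" using cd unfolding conant_divides_def by blast
    have "\<exists>x. length x = length w \<and> (\<forall>i<N. R (x @ map (?c i) [0..<n]))" for N
    proof -
      from CPD[OF cp f(2)[THEN spec, of N]] obtain x where
        x: "length x = length w" "\<forall>c\<in>set (map f [0..<N]). R (x @ c)" by (elim exE conjE)
      have "map (?c i) [0..<n] = f i" if i: "i < N" for i
      proof -
        have "realizer (r ?b) (length ?b) M (f i)" by (rule mor_real[OF f(2)[THEN spec, of N]]) (use i in simp)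
        then have "length (f i) = n" using real_length by fastforce
        then show ?thesis using map_nth[of "f i"] by simp
      qed
      then show ?thesis using x by (intro exI[of _ x]) simp
    qed
    then have "consistent S (range (\<lambda>i. inst (?c i) \<phi>))" unfolding consistent_iff[OF rep w] by blast
    with ncon show False ..
  qed
next
  let ?b = "map c [0..<n]"
  assume nCP: "\<not> CPr ?b (length w) R"
  show "conant_divides L S M \<phi> n c"
    unfolding conant_divides_def
  proof (intro allI impI notI)
    fix p and d :: "nat \<Rightarrow> nat \<Rightarrow> 'm"
    assume pd: "invariant_type L S M {..<n} p \<and> morley_seq L S M {..<n} p d \<and> (\<forall>j<n. d 0 j = c j)"
      and con: "consistent S (range (\<lambda>i. inst (d i) \<phi>))"
    let ?p = "sem p [0..<n]"
    have t: "is_type L S {..<n} UNIV p" using pd unfolding invariant_type_def by blast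
    have rp: "restr L {..<n} UNIV p = p" using t unfolding is_type_def restr_def by blast
    have ind_set: "set [0..<n] \<subseteq> {..<n}" by auto
    have inv: "inv_type M (length ?b) ?p" using inv_sem[OF t _ ind_set subset_refl, of M] pd rp by simp
    have m: "mor M (length ?b) ?p (map (\<lambda>i. map (d i) [0..<n]) [0..<N])" for N
      using mor_sem[OF t _ ind_set subset_refl, of M d N] pd rp by simp
    have "map (d 0) [0..<n] = ?b" using pd by simp
    with mor_real[OF m[of 1], of "map (d 0) [0..<n]"] have re: "realizer ?p (length ?b) M ?b" by simp
    have Rb: "dfn {} (length w + length ?b) R" using R by simp
    have "CP M (length ?b) ?p (length w) R"
    proof (rule CPI[OF inv dfn_mono[OF Rb empty_subsetI]])
      fix N
      from con obtain x where x: "length x = length w" "\<forall>i<N. R (x @ map (d i) [0..<n])"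
        unfolding consistent_iff[OF rep w] by blast
      show "\<exists>cs. mor M (length ?b) ?p cs \<and> length cs = N \<and> (\<exists>x. length x = length w \<and> (\<forall>c\<in>set cs. R (x @ c)))"
        by (rule exI[of _ "map (\<lambda>i. map (d i) [0..<n]) [0..<N]"], intro conjI m exI[of _ x]) (use x in auto)
    qed
    from least0[OF inv re Rb this] nCP show False by simp
  qed
qed

text \<open>Forking is reduced to dividing by extension: a conjugate of \<open>a\<close> over
  \<open>b\<close> is made independent of all parameters of a covering finite disjunction, so the
  disjunct it satisfies does not divide. Conversely, a dividing formula forks as a disjunction with
  one member.\<close>

lemma ind_iff_conant_indep:
  fixes w :: "'i list" and a :: "'i \<Rightarrow> 'm" and b :: "'j \<Rightarrow> 'm"
  assumes w: "distinct w" and b: "b ` W = set bl"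
  shows "conant_indep L S M (set w) a W b \<longleftrightarrow> ind (map a w) bl"
proof
  let ?k = "length w"
  assume ci: "conant_indep L S M (set w) a W b"
  show "ind (map a w) bl"
    unfolding ind_def
  proof (intro allI impI)
    fix R assume "dfn M (length (map a w) + length bl) R" and Rab: "R (map a w @ bl)"
    then have R: "dfn M (?k + length bl) R" by simp
    then have "dfn ({} \<union> M) (?k + length bl) R" by simp
    from dfn_finite[OF this] obtain ms where ms: "set ms \<subseteq> M" "dfn ({} \<union> set ms) (?k + length bl) R" by (elim exE conjE)
    from dfn_params[OF ms(2)] obtain R0 where R0: "dfn {} (?k + length bl + length ms) R0"
      "\<forall>xs. length xs = ?k + length bl \<longrightarrow> R xs = R0 (xs @ ms)" by (elim exE conjE)
    \<comment> \<open>In Conant-dividing all parameters belong to the tuple that is moved, so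
      elements of \<open>M\<close> used by the formula are put into the tuple.\<close>
    let ?bm = "bl @ ms"
    let ?n = "length ?bm"
    have R0': "dfn {} (?k + ?n) R0" using R0(1) by (simp add: add.assoc)
    from dfn_rep2[OF R0'] obtain \<phi> where \<phi>: "\<phi> \<in> fms L (set w <+> {..<?n})"
      "\<forall>a y. R0 (map a w @ map y [0..<?n]) = holds S (case_sum a y) \<phi>" ..
    let ?\<psi> = "inst (nth ?bm) \<phi>"
    have bm: "map (nth ?bm) [0..<?n] = ?bm" by (rule map_nth)
    have "?\<psi> \<in> fms L (set w <+> (M \<union> b ` W))"
    proof (rule inst_in_fms[OF \<phi>(1)])
      have "nth xs ` {..<length xs} = set xs" for xs :: "'m list" by (auto simp: set_conv_nth)
      from this[of ?bm] have "nth ?bm ` {..<?n} = set ?bm" .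
      then show "nth ?bm ` {..<?n} \<subseteq> M \<union> b ` W" using ms(1) b by auto
    qed
    moreover have "holds S (case_sum a id) ?\<psi>"
    proof -
      have "R0 (map a w @ map (nth ?bm) [0..<?n])" unfolding bm using Rab R0(2)[THEN spec, of "map a w @ bl"] by simp
      then show ?thesis unfolding holds_inst using \<phi>(2) by simp
    qed
    ultimately have "?\<psi> \<in> tp L S (set w) a (M \<union> b ` W)" by (simp add: tp_def)
    then have nf: "\<not> conant_forks L S M (set w) ?\<psi>" using ci unfolding conant_indep_def by blast
    have "\<not> conant_divides L S M \<phi> ?n (nth ?bm)"
    proof
      assume "conant_divides L S M \<phi> ?n (nth ?bm)"
      then have "conant_forks L S M (set w) ?\<psi>"
        unfolding conant_forks_def using \<phi>(1) by (intro exI[of _ "{(\<phi>, ?n, nth ?bm)}"]) auto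
      with nf show False ..
    qed
    then have "CPr ?bm ?k R0"
      using not_CP_conant_divides[OF w R0', of \<phi> "nth ?bm"] \<phi>(2) unfolding bm by simp
    then show "CPr bl (length (map a w)) R" using CPr_params[OF ms(1) R R0(2)] by simp
  qed
next
  let ?k = "length w"
  assume ab: "ind (map a w) bl"
  show "conant_indep L S M (set w) a W b"
    unfolding conant_indep_def
  proof
    assume "\<exists>\<psi>\<in>tp L S (set w) a (M \<union> b ` W). conant_forks L S M (set w) \<psi>"
    then obtain \<psi> D where \<psi>: "\<psi> \<in> tp L S (set w) a (M \<union> b ` W)" and D: "finite D"
      "\<forall>(\<phi>, n, b)\<in>D. \<phi> \<in> fms L (set w <+> {..<n}) \<and> conant_divides L S M \<phi> n b"
      "\<forall>a. holds S (case_sum a id) \<psi> \<longrightarrow> (\<exists>(\<phi>, n, b)\<in>D. holds S (case_sum a id) (inst b \<phi>))"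
      unfolding conant_forks_def by (elim bexE exE conjE)
    from finite_list[OF D(1)] obtain Dl where Dl: "set Dl = D" ..
    \<comment> \<open>The parameters of all disjuncts at once, so that one extension handles
      whichever disjunct turns out to hold.\<close>
    define E where "E = concat (map (\<lambda>(\<phi>, n, c). map c [0..<n]) Dl)"
    from ind_right_extend[OF ab, of E] obtain x where x: "eqt M (map a w @ bl) (x @ bl)" "ind x (bl @ E)" by (elim exE conjE)
    have lx: "length x = ?k" using eqt_length[OF x(1)] by simp
    obtain g where g: "\<forall>v\<in>set w. g v < length w \<and> w ! g v = v" using index_function ..
    let ?a = "\<lambda>v. x ! g v"
    have xa: "map ?a w = x"
    proof (rule nth_equalityI)
      fix i assume "i < length (map ?a w)"
      then have i: "i < length w" by simp
      then have "g (w ! i) < length w" "w ! g (w ! i) = w ! i" using bspec[OF g, of "w ! i"] by simp_all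
      then have "g (w ! i) = i" using nth_eq_iff_index_eq[OF w _ i] by simp
      then show "map ?a w ! i = x ! i" using i by simp
    qed (use lx in simp)
    have \<psi>': "\<psi> \<in> fms L (set w <+> (M \<union> set bl))" using \<psi> b by (simp add: tp_def)
    have gl: "g v < ?k" if "v \<in> set w" for v using bspec[OF g that] by simp
    have d: "dfn (M \<union> set bl) ?k (\<lambda>x. holds S (case_sum (\<lambda>v. x ! g v) id) \<psi>)" by (rule dfn_form[OF \<psi>' gl])
    have "eqt (M \<union> set bl) (map a w) x" unfolding eqt_params by (rule x(1))
    from eqtD[OF this, of "\<lambda>x. holds S (case_sum (\<lambda>v. x ! g v) id) \<psi>"] d
    have "holds S (case_sum (\<lambda>v. map a w ! g v) id) \<psi> = holds S (case_sum ?a id) \<psi>" by simp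
    moreover have "holds S (case_sum (\<lambda>v. map a w ! g v) id) \<psi> = holds S (case_sum a id) \<psi>"
      using \<psi> g by (intro sat_cong) (auto simp: tp_def fms_def)
    moreover have "holds S (case_sum a id) \<psi>" using \<psi> by (simp add: tp_def)
    ultimately have "holds S (case_sum ?a id) \<psi>" by simp
    with D(3) obtain \<phi> n c where t: "(\<phi>, n, c) \<in> D" "holds S (case_sum ?a id) (inst c \<phi>)" by blast
    have \<phi>: "\<phi> \<in> fms L (set w <+> {..<n})" "conant_divides L S M \<phi> n c" using bspec[OF D(2) t(1)] by auto
    from dfn_rep_pair[OF \<phi>(1) w] obtain R where R: "dfn {} (?k + n) R"
      "\<forall>a y. holds S (case_sum a y) \<phi> = R (map a w @ map y [0..<n])" by (elim exE conjE)
    have "set (map c [0..<n]) \<subseteq> set (bl @ E)" using t(1) Dl unfolding E_def by force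
    from ind_mono[OF x(2) subset_refl this] have i: "ind x (map c [0..<n])" .
    have "R (map ?a w @ map c [0..<n])" using t(2) R(2) unfolding holds_inst by simp
    then have "R (x @ map c [0..<n])" unfolding xa .
    moreover have "dfn M (length x + length (map c [0..<n])) R" using dfn_mono[OF R(1), of M] lx by simp
    ultimately have "CPr (map c [0..<n]) (length x) R" using indD[OF i, of R] by simp
    then show False using not_CP_conant_divides[OF w R(1), of \<phi> c] R(2) \<phi>(2) lx by simp
  qed
qed

end

text \<open>Symmetry is assumed for tuples indexed by the underlying type of
  \<open>\<kappa>\<close>; finite lists need distinct indices there.\<close>

lemma (in monster) inj_nat: "\<exists>\<iota> :: nat \<Rightarrow> 'k. inj \<iota>"
proof -
  have "|fms L (UNIV :: nat set)| \<le>o |Field \<kappa>|"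
    by (rule ordLeq_ordIso_trans[OF ordLess_imp_ordLeq[OF fms_less_\<kappa>]
          ordIso_symmetric[OF card_of_Field_ordIso[OF Card_order_\<kappa>]]])
  from this[folded card_of_ordLeq] obtain f where
    f: "inj_on f (fms L (UNIV :: nat set))" "f ` fms L (UNIV :: nat set) \<subseteq> Field \<kappa>" by (elim exE conjE)
  have "inj (\<lambda>i::nat. f (Eq (Free i) (Free i)))"
  proof (rule injI)
    fix i j :: nat assume "f (Eq (Free i) (Free i)) = f (Eq (Free j) (Free j))"
    then have "(Eq (Free i) (Free i) :: ('f, 'r, nat) fm) = Eq (Free j) (Free j)"
      by (rule inj_onD[OF f(1)]) (simp_all add: fms_def)
    then show "i = j" by simp
  qed
  then show ?thesis by (intro exI[of _ "\<lambda>i. f (Eq (Free i) (Free i))"])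
qed

lemma (in witness) sym_witnessI:
  assumes sym: "conant_symmetric L \<kappa> S" and M: "elem_sub L S M"
  shows "sym_witness L \<kappa> S M r"
proof
  fix a b assume ab: "ind a b"
  obtain \<iota> :: "nat \<Rightarrow> 'k" where \<iota>: "inj \<iota>" using inj_nat ..
  let ?w = "\<lambda>l :: 'm list. map \<iota> [0..<length l]"
  let ?f = "\<lambda>l v. l ! inv \<iota> v"
  have w: "distinct (?w l)" for l using \<iota> by (auto simp: distinct_map intro: inj_on_subset[OF \<iota>])
  have f: "map (?f l) (?w l) = l" for l :: "'m list" using \<iota> by (simp add: comp_def map_nth)
  then have fs: "?f l ` set (?w l) = set l" for l :: "'m list" by (metis set_map)
  have "conant_indep L S M (set (?w a)) (?f a) (set (?w b)) (?f b)"
    unfolding ind_iff_conant_indep[OF w fs] f by (rule ab)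
  then have "conant_indep L S M (set (?w b)) (?f b) (set (?w a)) (?f a)"
    using sym M small_less[OF small_M] small_less[OF small_finite[of "set (?w a)"]] small_less[OF small_finite[of "set (?w b)"]]
    unfolding conant_symmetric_def by simp
  then show "ind b a" unfolding ind_iff_conant_indep[OF w fs] f .
qed

section \<open>Extracting coheirs from a tree\<close>

context monster
begin

text \<open>The average type of a sequence along an ultrafilter; when the sequence lies in
  \<open>M\<close> this is a coheir over \<open>M\<close>, hence invariant.\<close>

definition avg :: "nat set set \<Rightarrow> (nat \<Rightarrow> 'm list) \<Rightarrow> ('m list \<Rightarrow> bool) \<Rightarrow> bool" where
  "avg U s Q \<longleftrightarrow> {i. Q (s i)} \<in> U"

lemma ultra_UNIV: assumes "ultra U" shows "UNIV \<in> U"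
  using assms ultra_not[OF assms, of "{}"] ultra_nonempty[OF assms, of "{}"] by auto

lemma inv_avg:
  assumes U: "ultra U" and s: "\<And>i. length (s i) = n" "\<And>i. set (s i) \<subseteq> M"
  shows "inv_type M n (avg U s)"
  unfolding inv_type_def
proof (intro conjI allI impI)
  fix Q assume "dfn UNIV n Q"
  have "{i. \<not> Q (s i)} = - {i. Q (s i)}" by auto
  then show "avg U s (\<lambda>x. \<not> Q x) = (\<not> avg U s Q)" unfolding avg_def using ultra_not[OF U] by simp
next
  fix Q R assume "avg U s Q" "avg U s R"
  moreover have "{i. Q (s i) \<and> R (s i)} = {i. Q (s i)} \<inter> {i. R (s i)}" by auto
  ultimately show "avg U s (\<lambda>x. Q x \<and> R x)" unfolding avg_def using ultra_Int[OF U] by simp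
next
  fix Q assume "avg U s Q"
  then have "{i. Q (s i)} \<noteq> {}" unfolding avg_def by (rule ultra_nonempty[OF U])
  then obtain i where "Q (s i)" by auto
  then show "\<exists>x. length x = n \<and> Q x" using s(1) by (intro exI[of _ "s i"]) simp
next
  fix R ys ys' assume R: "dfn {} (n + length ys) R" and e: "eqt M ys ys'" and *: "avg U s (\<lambda>x. R (x @ ys))"
  have "R (s i @ ys) = R (s i @ ys')" for i
  proof -
    have "eqt M (s i @ ys) (s i @ ys')"
      by (rule eqt_swap[OF eqt_append_const[OF e s(2)] eqt_length[OF e]])
    from eqtD[OF this, of R] show ?thesis using dfn_mono[OF R, of M] s(1)[of i] by simp
  qed
  then show "avg U s (\<lambda>x. R (x @ ys'))" using * unfolding avg_def by simp
qed

text \<open>The induction needs a common solution for the Morley sequence together with any finite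
  part of \<open>s\<close>. The last entry of the Morley sequence satisfies whatever holds for all
  \<open>s i\<close>, and with \<open>s i\<close> in its place the shorter sequence and a larger
  finite part are concerned.\<close>

lemma CP_avg:
  assumes U: "ultra U" and s: "\<And>i. length (s i) = n" "\<And>i. set (s i) \<subseteq> M" and \<Phi>: "dfn {} (k + n) \<Phi>"
    and con: "\<And>N. \<exists>x. length x = k \<and> (\<forall>i<N. \<Phi> (x @ s i))"
  shows "CP M n (avg U s) k \<Phi>"
proof -
  have "\<exists>x. length x = k \<and> (\<forall>c\<in>set cs. \<Phi> (x @ c)) \<and> (\<forall>i\<in>I. \<Phi> (x @ s i))"
    if "mor M n (avg U s) cs" "finite I" for cs I
    using that
  proof (induction cs arbitrary: I rule: rev_induct)
    case Nil
    obtain N where N: "\<forall>i\<in>I. i < N" using Nil(2) finite_nat_set_iff_bounded by blast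
    obtain x where "length x = k" "\<forall>i<N. \<Phi> (x @ s i)" using con[of N] by (elim exE conjE)
    then show ?case using N by (intro exI[of _ x]) simp
  next
    case (snoc c cs)
    have m: "mor M n (avg U s) cs" and c: "realizer (avg U s) n (M \<union> set (concat cs)) c"
      using snoc.prems(1) by (simp_all add: mor_snoc)
    have lcs: "length c' = n" if "c' \<in> set cs" for c' by (rule real_length[OF mor_real[OF m that]])
    let ?A = "M \<union> set (concat cs)"
    let ?body = "\<lambda>y x. \<Phi> (x @ y) \<and> ((\<forall>c\<in>set cs. \<Phi> (x @ c)) \<and> (\<forall>i\<in>I. \<Phi> (x @ s i)))"
    let ?Q = "\<lambda>y. \<exists>x. length x = k \<and> ?body (take n (y @ x)) (drop n (y @ x))"
    have "dfn ?A n ?Q"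
    proof (rule dfn_ex, intro dfn_conj)
      show "dfn ?A (n + k) (\<lambda>z. \<Phi> (drop n z @ take n z))"
        by (rule dfn_sub[OF \<Phi>], intro sub_append sub_drop sub_take) simp_all
      show "dfn ?A (n + k) (\<lambda>z. \<forall>c\<in>set cs. \<Phi> (drop n z @ c))"
      proof (rule dfn_ball)
        fix c assume "c \<in> set cs"
        then show "dfn ?A (n + k) (\<lambda>z. \<Phi> (drop n z @ c))"
          using lcs by (intro dfn_sub[OF \<Phi>] sub_append sub_drop sub_const) auto
      qed simp
      show "dfn ?A (n + k) (\<lambda>z. \<forall>i\<in>I. \<Phi> (drop n z @ s i))"
      proof (rule dfn_ball[OF snoc.prems(2)])
        fix i
        show "dfn ?A (n + k) (\<lambda>z. \<Phi> (drop n z @ s i))"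
          using s(1)[of i] s(2)[of i] by (intro dfn_sub[OF \<Phi>] sub_append sub_drop sub_const) auto
      qed
    qed
    moreover have "avg U s ?Q"
    proof -
      have "?Q (s i)" for i
      proof -
        have "finite (insert i I)" using snoc.prems(2) by simp
        from snoc.IH[OF m this] obtain x where x: "length x = k" "\<forall>c\<in>set cs. \<Phi> (x @ c)"
          "\<forall>i\<in>insert i I. \<Phi> (x @ s i)" by (elim exE conjE)
        then show ?thesis using s(1)[of i] by (intro exI[of _ x]) simp
      qed
      then have "{i. ?Q (s i)} = UNIV" by blast
      then show ?thesis unfolding avg_def using ultra_UNIV[OF U] by metis
    qed
    ultimately have "?Q c" by (rule realD[OF c])
    then obtain x where "length x = k" "?body (take n (c @ x)) (drop n (c @ x))" by (elim exE conjE) blast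
    then show ?case using real_length[OF c] by (intro exI[of _ x]) simp
  qed
  from this[of _ "{}"] show ?thesis unfolding CP_def by simp
qed

section \<open>Block coordinates and the prolongation game\<close>

definition blk :: "nat \<Rightarrow> nat \<Rightarrow> 'm list \<Rightarrow> 'm list" where
  "blk n i z = take n (drop (i * n) z)"

lemma blk_concat: "(\<forall>c\<in>set cs. length c = n) \<Longrightarrow> i < length cs \<Longrightarrow> blk n i (concat cs) = cs ! i"
  unfolding blk_def by (rule take_drop_concat)

lemma mult_block_le: "i < (m::nat) \<Longrightarrow> i * n + n \<le> m * n"
  by (metis add.commute mult_Suc mult_le_mono1 Suc_leI)

lemma blk_append: "i < m \<Longrightarrow> length z = m * n \<Longrightarrow> blk n i (z @ y) = blk n i z"
  unfolding blk_def using mult_block_le[of i m n] by simp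

lemma blk_append_last: "length z = m * n \<Longrightarrow> length y = n \<Longrightarrow> blk n m (z @ y) = y"
  unfolding blk_def by simp

lemma length_blk: "i < m \<Longrightarrow> length z = m * n \<Longrightarrow> length (blk n i z) = n"
  unfolding blk_def using mult_block_le[of i m n] by simp

lemma sub_blk: "i < m \<Longrightarrow> sub A (m * n + l) n (blk n i)"
  unfolding blk_def using mult_block_le[of i m n] by (intro sub_mid) simp

text \<open>
  \<open>game\<close> is the first-order approximation of "the pairs in \<open>z\<close> can be prolonged for ever": after
  each pair \<open>(e, f)\<close>, the next one is any ordered pair from a long enough list of candidates. This
  is how the tree is used, the candidates being the nodes \<open>\<eta> 0\<^sup>i 1\<close>.
\<close>

definition clash :: "nat \<Rightarrow> ('m list \<Rightarrow> bool) \<Rightarrow> 'm list \<Rightarrow> 'm list \<Rightarrow> bool" where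
  "clash k \<Phi> y z \<longleftrightarrow> (\<nexists>x. length x = k \<and> \<Phi> (x @ y) \<and> \<Phi> (x @ z))"

lemma clash_sym: "clash k \<Phi> y z \<Longrightarrow> clash k \<Phi> z y"
  unfolding clash_def by blast

text \<open>Each block of length \<open>n + n\<close> is a pair \<open>(e, f)\<close>. The second
  components must be jointly consistent, the first components pairwise contradictory.\<close>

definition base :: "nat \<Rightarrow> nat \<Rightarrow> ('m list \<Rightarrow> bool) \<Rightarrow> nat \<Rightarrow> 'm list \<Rightarrow> bool" where
  "base k n \<Phi> m z \<longleftrightarrow> (\<exists>x. length x = k \<and> (\<forall>i\<in>{..<m}. \<Phi> (x @ drop n (blk (n + n) i z))))
     \<and> (\<forall>j\<in>{..<m}. \<forall>i\<in>{..<j}. clash k \<Phi> (take n (blk (n + n) i z)) (take n (blk (n + n) j z)))"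

fun game :: "nat \<Rightarrow> nat \<Rightarrow> ('m list \<Rightarrow> bool) \<Rightarrow> nat \<Rightarrow> nat \<Rightarrow> nat \<Rightarrow> 'm list \<Rightarrow> bool" where
  "game k n \<Phi> N 0 m z = base k n \<Phi> m z"
| "game k n \<Phi> N (Suc h) m z = (\<exists>w. length w = N * n
     \<and> (\<forall>j\<in>{..<N}. \<forall>i\<in>{..<j}. game k n \<Phi> N h (Suc m) (z @ blk n i w @ blk n j w)))"

lemma dfn_clash:
  assumes \<Phi>: "dfn {} (k + n) \<Phi>" and F: "sub A l n F" and G: "sub A l n G"
  shows "dfn A l (\<lambda>z. clash k \<Phi> (F z) (G z))"
proof -
  have "dfn A l (\<lambda>z. \<exists>x. length x = k \<and> (\<Phi> (drop l (z @ x) @ F (take l (z @ x))) \<and> \<Phi> (drop l (z @ x) @ G (take l (z @ x)))))"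
  proof (rule dfn_ex, rule dfn_conj)
    show "dfn A (l + k) (\<lambda>z. \<Phi> (drop l z @ F (take l z)))"
      by (rule dfn_sub[OF \<Phi>], intro sub_append sub_drop sub_comp[OF _ F] sub_take) simp_all
    show "dfn A (l + k) (\<lambda>z. \<Phi> (drop l z @ G (take l z)))"
      by (rule dfn_sub[OF \<Phi>], intro sub_append sub_drop sub_comp[OF _ G] sub_take) simp_all
  qed
  from dfn_not[OF this] show ?thesis by (rule dfn_cong) (simp add: clash_def)
qed

lemma dfn_base:
  assumes \<Phi>: "dfn {} (k + n) \<Phi>"
  shows "dfn {} (m * (n + n)) (base k n \<Phi> m)"
proof -
  let ?l = "m * (n + n)"
  have sE: "sub {} ?l n (\<lambda>z. take n (blk (n + n) i z))" if "i < m" for i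
  proof (rule sub_comp[OF _ sub_take])
    show "sub {} ?l (n + n) (blk (n + n) i)" using sub_blk[OF that, of "{}" "n + n" 0] by simp
  qed (rule le_add1)
  have sF: "sub {} (?l + k) n (\<lambda>z. drop n (blk (n + n) i z))" if "i < m" for i
    by (rule sub_comp[OF sub_blk[OF that] sub_drop]) simp
  have "dfn {} ?l (\<lambda>z. \<exists>x. length x = k \<and> (\<forall>i\<in>{..<m}. \<Phi> (drop ?l (z @ x) @ drop n (blk (n + n) i (z @ x)))))"
  proof (rule dfn_ex, rule dfn_ball)
    fix i assume "i \<in> {..<m}"
    then show "dfn {} (?l + k) (\<lambda>z. \<Phi> (drop ?l z @ drop n (blk (n + n) i z)))"
      by (intro dfn_sub[OF \<Phi>] sub_append sub_drop sF) simp_all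
  qed simp
  moreover have "dfn {} ?l (\<lambda>z. \<forall>j\<in>{..<m}. \<forall>i\<in>{..<j}. clash k \<Phi> (take n (blk (n + n) i z)) (take n (blk (n + n) j z)))"
    by (intro dfn_ball finite_lessThan dfn_clash[OF \<Phi>] sE) auto
  ultimately show ?thesis
    by (rule dfn_cong[OF dfn_conj]) (simp add: base_def blk_append cong: ex_cong conj_cong)
qed

text \<open>For fixed width \<open>N\<close> and depth \<open>h\<close> all quantifiers range over
  lists of fixed length, so the game is first-order; unbounded play is then reached by
  saturation.\<close>

lemma dfn_game:
  assumes \<Phi>: "dfn {} (k + n) \<Phi>"
  shows "dfn {} (m * (n + n)) (game k n \<Phi> N h m)"
proof (induction h arbitrary: m)
  case 0
  show ?case using dfn_base[OF \<Phi>] by (simp add: dfn_cong)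
next
  case (Suc h)
  let ?l = "m * (n + n)"
  have IH: "dfn {} (?l + (n + n)) (game k n \<Phi> N h (Suc m))" using Suc[of "Suc m"] by (simp add: add.commute)
  have "dfn {} ?l (\<lambda>z. \<exists>w. length w = N * n \<and> (\<forall>j\<in>{..<N}. \<forall>i\<in>{..<j}.
      game k n \<Phi> N h (Suc m) (take ?l (z @ w) @ blk n i (drop ?l (z @ w)) @ blk n j (drop ?l (z @ w)))))"
  proof (rule dfn_ex, intro dfn_ball finite_lessThan)
    fix j i assume "j \<in> {..<N}" "i \<in> {..<j}"
    then have ij: "i < N" "j < N" by auto
    have "sub {} (?l + N * n) n (\<lambda>z. blk n i (drop ?l z))" if "i < N" for i
      by (rule sub_comp[OF sub_drop[OF refl]]) (use sub_blk[OF that, of "{}" n 0] in simp)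
    then show "dfn {} (?l + N * n) (\<lambda>z. game k n \<Phi> N h (Suc m) (take ?l z @ blk n i (drop ?l z) @ blk n j (drop ?l z)))"
      using ij by (intro dfn_sub[OF IH] sub_append sub_take) simp_all
  qed
  then show ?case by (rule dfn_cong) simp
qed

lemma game_mono_N:
  "game k n \<Phi> N h m z \<Longrightarrow> N' \<le> N \<Longrightarrow> game k n \<Phi> N' h m z"
proof (induction h arbitrary: m z)
  case (Suc h)
  obtain w where w: "length w = N * n"
    "\<forall>j\<in>{..<N}. \<forall>i\<in>{..<j}. game k n \<Phi> N h (Suc m) (z @ blk n i w @ blk n j w)"
    using Suc.prems(1) unfolding game.simps by (elim exE conjE)
  have "N' * n \<le> N * n" using Suc.prems(2) by simp
  then have l: "length (take (N' * n) w) = N' * n" using w(1) by simp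
  have b: "blk n i (take (N' * n) w) = blk n i w" if "i < N'" for i
    using blk_append[OF that l, of "drop (N' * n) w"] by simp
  have "game k n \<Phi> N' h (Suc m) (z @ blk n i (take (N' * n) w) @ blk n j (take (N' * n) w))"
    if "j < N'" "i < j" for i j
    using w(2) that Suc.prems(2) b[of i] b[of j] by (intro Suc.IH) auto
  then show ?case using l by (intro game.simps(2)[THEN iffD2] exI[of _ "take (N' * n) w"]) simp
qed simp

lemma base_down:
  assumes "base k n \<Phi> (Suc m) (z @ y)" "length z = m * (n + n)"
  shows "base k n \<Phi> m z"
proof -
  have b: "blk (n + n) i (z @ y) = blk (n + n) i z" if "i < m" for i
    by (rule blk_append[OF that assms(2)])
  obtain x where x: "length x = k" "\<forall>i\<in>{..<Suc m}. \<Phi> (x @ drop n (blk (n + n) i (z @ y)))"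
    and c: "\<forall>j\<in>{..<Suc m}. \<forall>i\<in>{..<j}. clash k \<Phi> (take n (blk (n + n) i (z @ y))) (take n (blk (n + n) j (z @ y)))"
    using assms(1)[unfolded base_def] by (elim exE conjE)
  have "\<Phi> (x @ drop n (blk (n + n) i z))" if "i < m" for i
    using bspec[OF x(2), of i] that b[OF that] by simp
  moreover have "clash k \<Phi> (take n (blk (n + n) i z)) (take n (blk (n + n) j z))" if "j < m" "i < j" for i j
    using bspec[OF bspec[OF c, of j], of i] that b[of i] b[of j] by simp
  ultimately show ?thesis unfolding base_def using x(1) by (intro conjI exI[of _ x]) simp_all
qed

text \<open>Two candidates ensure that a round offers at least one pair, so that a longer game
  really restricts the present position. Together with \<open>game_mono_N\<close>, finitely many
  demands \<open>(N, h)\<close> reduce to a single one.\<close>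

lemma game_down:
  assumes "2 \<le> N"
  shows "game k n \<Phi> N (Suc h) m z \<Longrightarrow> length z = m * (n + n) \<Longrightarrow> game k n \<Phi> N h m z"
proof (induction h arbitrary: m z)
  case 0
  obtain w where w: "length w = N * n"
    "\<forall>j\<in>{..<N}. \<forall>i\<in>{..<j}. base k n \<Phi> (Suc m) (z @ blk n i w @ blk n j w)"
    using 0(1) unfolding game.simps by (elim exE conjE)
  have "base k n \<Phi> (Suc m) (z @ blk n 0 w @ blk n 1 w)" using w(2) assms by simp
  from base_down[OF this 0(2)] show ?case by simp
next
  case (Suc h)
  obtain w where w: "length w = N * n"
    "\<forall>j\<in>{..<N}. \<forall>i\<in>{..<j}. game k n \<Phi> N (Suc h) (Suc m) (z @ blk n i w @ blk n j w)"
    using Suc.prems(1) unfolding game.simps(2)[of k n \<Phi> N "Suc h"] by (elim exE conjE)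
  have "game k n \<Phi> N h (Suc m) (z @ blk n i w @ blk n j w)" if "j < N" "i < j" for i j
  proof (rule Suc.IH)
    show "game k n \<Phi> N (Suc h) (Suc m) (z @ blk n i w @ blk n j w)" using w(2) that by blast
    show "length (z @ blk n i w @ blk n j w) = Suc m * (n + n)"
      using length_blk[of i N w n] length_blk[of j N w n] that w(1) Suc.prems(2) by simp
  qed
  then show ?case using w(1) by (intro game.simps(2)[THEN iffD2] exI[of _ w]) simp
qed

lemma game_down_le:
  assumes "2 \<le> N" "h' \<le> h" "game k n \<Phi> N h m z" "length z = m * (n + n)"
  shows "game k n \<Phi> N h' m z"
  using assms(2,3)
proof (induction h rule: dec_induct)
  case (step h)
  then show ?case using game_down[OF assms(1) _ assms(4)] by blast
qed

text \<open>By the pigeonhole principle, among enough candidates two agree on any given finite set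
  of predicates over \<open>A\<close>, and every ordered pair of candidates is a legal move.
  Saturation makes the two components agree on all predicates over \<open>A\<close> and win all
  games.\<close>

lemma game_step:
  assumes \<Phi>: "dfn {} (k + n) \<Phi>" and A: "small A" and z: "length z = m * (n + n)"
    and game: "\<And>N h. game k n \<Phi> N h m z"
  shows "\<exists>e f. length e = n \<and> length f = n \<and> eqt A e f \<and> (\<forall>N h. game k n \<Phi> N h (Suc m) (z @ e @ f))"
proof -
  let ?I = "{Q. dfn A n Q} <+> (UNIV :: (nat \<times> nat) set)"
  let ?P = "\<lambda>i y. case i of Inl Q \<Rightarrow> Q (take n y) = Q (drop n y) | Inr (N, h) \<Rightarrow> game k n \<Phi> N h (Suc m) (z @ y)"
  have sm: "small (A \<union> set z)" by (intro small_Un A small_finite) simp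
  have "\<exists>y. length y = n + n \<and> (\<forall>i\<in>?I. ?P i y)"
  proof (rule saturation_family[OF sm])
    fix i assume i: "i \<in> ?I"
    show "dfn (A \<union> set z) (n + n) (?P i)"
    proof (cases i)
      case (Inl Q)
      then have "dfn A n Q" using i by auto
      then have "dfn (A \<union> set z) (n + n) (\<lambda>y. Q (take n y))" "dfn (A \<union> set z) (n + n) (\<lambda>y. Q (drop n y))"
        by (rule dfn_sub; simp add: sub_take sub_drop)+
      from dfn_iff[OF this] show ?thesis using Inl by simp
    next
      case (Inr Nh)
      obtain N h where Nh: "Nh = (N, h)" by (cases Nh)
      have "dfn {} (m * (n + n) + (n + n)) (game k n \<Phi> N h (Suc m))"
        using dfn_game[OF \<Phi>, of "Suc m" N h] by (simp add: add.commute)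
      then have "dfn (A \<union> set z) (n + n) (\<lambda>y. game k n \<Phi> N h (Suc m) (z @ y))"
        by (rule dfn_sub, intro sub_append sub_const sub_id) (use z in simp_all)
      then show ?thesis using Inr Nh by simp
    qed
  next
    fix J assume J: "finite J" "J \<subseteq> ?I"
    define J1 where "J1 = Inl -` J"
    define J2 where "J2 = Inr -` J"
    have f: "finite J1" "finite J2" unfolding J1_def J2_def by (auto intro: finite_vimageI[OF J(1)])
    define h where "h = Max (insert 0 (snd ` J2))"
    \<comment> \<open>More candidates than truth patterns on \<open>J1\<close>; the summand 2 also
      secures the width that shortening a game requires.\<close>
    define N where "N = Max (insert (2 + 2 ^ card J1) (fst ` J2))"
    have h: "h' \<le> h" "N' \<le> N" if "(N', h') \<in> J2" for N' h'
      unfolding h_def N_def using f(2) that by (auto intro!: Max_ge image_eqI[of _ _ "(N', h')"])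
    have N: "2 + 2 ^ card J1 \<le> N" unfolding N_def using f(2) by (intro Max_ge) auto
    \<comment> \<open>One extra round, because choosing the new pair uses one up.\<close>
    from game[of N "Suc h"] obtain w where w: "length w = N * n"
      "\<forall>j\<in>{..<N}. \<forall>i\<in>{..<j}. game k n \<Phi> N h (Suc m) (z @ blk n i w @ blk n j w)"
      unfolding game.simps by (elim exE conjE)
    let ?col = "\<lambda>i. {Q \<in> J1. Q (blk n i w)}"
    have "\<not> inj_on ?col {..<N}"
    proof
      assume "inj_on ?col {..<N}"
      then have "card {..<N} \<le> card (Pow J1)" using f(1) by (intro card_inj_on_le[of ?col]) auto
      then show False using N f(1) by (simp add: card_Pow)
    qed
    then obtain i j where ij: "i < N" "j < N" "i \<noteq> j" "?col i = ?col j" unfolding inj_on_def by auto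
    have "\<exists>i j. i < j \<and> j < N \<and> ?col i = ?col j"
    proof (cases "i < j")
      case True then show ?thesis using ij by blast
    next
      case False
      then have "j < i" using ij(3) by simp
      then show ?thesis using ij(1) ij(4)[symmetric] by blast
    qed
    then obtain i j where ij: "i < j" "j < N" "?col i = ?col j" by (elim exE conjE)
    let ?y = "blk n i w @ blk n j w"
    have l: "length (blk n i w) = n" "length (blk n j w) = n" using length_blk[OF _ w(1)] ij by simp_all
    have g: "game k n \<Phi> N h (Suc m) (z @ ?y)" using w(2) ij by simp
    have "?P p ?y" if p: "p \<in> J" for p
    proof (cases p)
      case (Inl Q)
      then have "Q \<in> J1" using p by (simp add: J1_def)
      have "Q \<in> ?col i \<longleftrightarrow> Q \<in> ?col j" by (simp only: ij(3))
      then have "Q (blk n i w) = Q (blk n j w)" using \<open>Q \<in> J1\<close> by simp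
      moreover have "take n ?y = blk n i w" "drop n ?y = blk n j w" using l by simp_all
      ultimately show ?thesis unfolding Inl sum.case by (simp only:)
    next
      case (Inr Nh)
      obtain N' h' where Nh: "Nh = (N', h')" by (cases Nh)
      then have "(N', h') \<in> J2" using p Inr by (simp add: J2_def)
      note h[OF this]
      have "game k n \<Phi> N h' (Suc m) (z @ ?y)"
        by (rule game_down_le[OF _ \<open>h' \<le> h\<close> g]) (use N l z in simp_all)
      from game_mono_N[OF this \<open>N' \<le> N\<close>] show ?thesis using Inr Nh by simp
    qed
    then show "\<exists>y. length y = n + n \<and> (\<forall>i\<in>J. ?P i y)" using l by (intro exI[of _ ?y]) simp
  qed
  then obtain y where y: "length y = n + n" "\<forall>i\<in>?I. ?P i y" by (elim exE conjE)
  have "eqt A (take n y) (drop n y)"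
  proof (rule eqtI)
    fix Q assume Q: "dfn A (length (take n y)) Q" "Q (take n y)"
    then have "Q \<in> {Q. dfn A n Q}" using y(1) by simp
    from bspec[OF y(2) InlI[OF this]] Q(2) show "Q (drop n y)" by simp
  qed (use y(1) in simp)
  moreover have "game k n \<Phi> N h (Suc m) (z @ take n y @ drop n y)" for N h
    using bspec[OF y(2) InrI[OF UNIV_I, of "(N, h)"]] by simp
  ultimately show ?thesis using y(1) by (intro exI[of _ "take n y"] exI[of _ "drop n y"]) simp
qed


section \<open>Playing the game on the tree\<close>

text \<open>The position after play has reached the node \<open>\<eta>\<close>: second components
  lie on the path to \<open>\<eta>\<close>, hence are consistent, and first components contradict
  everything at or above \<open>\<eta>\<close>, hence all future moves.\<close>

definition on_tree :: "nat \<Rightarrow> nat \<Rightarrow> ('m list \<Rightarrow> bool) \<Rightarrow> (bool list \<Rightarrow> 'm list) \<Rightarrow> bool list \<Rightarrow> nat \<Rightarrow> 'm list \<Rightarrow> bool" where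
  "on_tree k n \<Phi> t \<eta> m z \<longleftrightarrow> length z = m * (n + n)
     \<and> (\<forall>i<m. \<exists>j\<le>length \<eta>. drop n (blk (n + n) i z) = t (take j \<eta>))
     \<and> (\<forall>i<m. \<forall>\<eta>'. prefix \<eta> \<eta>' \<longrightarrow> clash k \<Phi> (take n (blk (n + n) i z)) (t \<eta>'))
     \<and> (\<forall>j<m. \<forall>i<j. clash k \<Phi> (take n (blk (n + n) i z)) (take n (blk (n + n) j z)))"

lemma on_tree_base:
  assumes con: "\<And>\<sigma> l. \<exists>x. length x = k \<and> (\<forall>i<l. \<Phi> (x @ t (map \<sigma> [0..<i])))"
    and on: "on_tree k n \<Phi> t \<eta> m z"
  shows "base k n \<Phi> m z"
proof -
  \<comment> \<open>Any infinite branch through \<open>\<eta>\<close> would do; the consistency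
    hypothesis is about branches.\<close>
  define \<sigma> where "\<sigma> i = (if i < length \<eta> then \<eta> ! i else False)" for i
  have \<sigma>: "map \<sigma> [0..<j] = take j \<eta>" if "j \<le> length \<eta>" for j
    by (rule nth_equalityI) (use that in \<open>auto simp: \<sigma>_def\<close>)
  obtain x where x: "length x = k" "\<forall>i<Suc (length \<eta>). \<Phi> (x @ t (map \<sigma> [0..<i]))"
    using con[of "Suc (length \<eta>)" \<sigma>] by (elim exE conjE)
  have "\<Phi> (x @ drop n (blk (n + n) i z))" if "i < m" for i
  proof -
    obtain j where j: "j \<le> length \<eta>" "drop n (blk (n + n) i z) = t (take j \<eta>)"
      using on \<open>i < m\<close> unfolding on_tree_def by blast
    then show ?thesis using x(2)[THEN spec, of j] \<sigma>[OF j(1)] by simp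
  qed
  moreover have "\<forall>j<m. \<forall>i<j. clash k \<Phi> (take n (blk (n + n) i z)) (take n (blk (n + n) j z))"
    using on unfolding on_tree_def by (elim conjE)
  ultimately show ?thesis unfolding base_def using x(1) by (intro conjI exI[of _ x]) simp_all
qed

text \<open>For \<open>i < j\<close> the move is \<open>e = t (c i)\<close>,
  \<open>f = t (c j)\<close>, and play continues at \<open>c j\<close>. The node \<open>c j\<close>
  lies above the sibling of \<open>c i\<close>, so \<open>e\<close> contradicts everything from
  \<open>c j\<close> on, while \<open>f\<close> joins the path.\<close>

lemma on_tree_game:
  assumes con: "\<And>\<sigma> l. \<exists>x. length x = k \<and> (\<forall>i<l. \<Phi> (x @ t (map \<sigma> [0..<i])))"
    and len: "\<And>\<eta>. length (t \<eta>) = n"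
    and inc: "\<And>\<eta>1 \<eta>2. prefix (\<eta>1 @ [False]) \<eta>2 \<Longrightarrow> clash k \<Phi> (t \<eta>2) (t (\<eta>1 @ [True]))"
  shows "on_tree k n \<Phi> t \<eta> m z \<Longrightarrow> game k n \<Phi> N h m z"
proof (induction h arbitrary: \<eta> m z)
  case 0
  from on_tree_base[OF con 0] show ?case by simp
next
  case (Suc h)
  define c where "c i = \<eta> @ replicate i False @ [True]" for i
  let ?w = "concat (map (\<lambda>i. t (c i)) [0..<N])"
  have l: "length z = m * (n + n)" using Suc.prems by (simp add: on_tree_def)
  have w: "blk n i ?w = t (c i)" if "i < N" for i
    using blk_concat[of "map (\<lambda>i. t (c i)) [0..<N]" n i] that len by simp
  have lw: "length ?w = N * n" by (induction N) (simp_all add: len)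
  have "game k n \<Phi> N h (Suc m) (z @ blk n i ?w @ blk n j ?w)" if j: "j < N" and i: "i < j" for i j
  proof -
    let ?z = "z @ t (c i) @ t (c j)"
    have pre: "prefix \<eta> (c i)" for i by (simp add: c_def)
    have old: "blk (n + n) i' ?z = blk (n + n) i' z" if "i' < m" for i' by (rule blk_append[OF that l])
    have new: "blk (n + n) m ?z = t (c i) @ t (c j)" by (rule blk_append_last[OF l]) (simp add: len)
    \<comment> \<open>Since \<open>i < j\<close>, the node \<open>c j\<close> starts with
      \<open>\<eta>\<close> followed by \<open>i + 1\<close> entries \<open>False\<close>, whereas
      \<open>c i\<close> has \<open>True\<close> at the last of these places.\<close>
    have ej: "clash k \<Phi> (t (c i)) (t \<eta>')" if "prefix (c j) \<eta>'" for \<eta>'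
    proof -
      obtain d where d: "j = i + Suc d" using less_imp_Suc_add[OF i] by auto
      have "c j = ((\<eta> @ replicate i False) @ [False]) @ (replicate d False @ [True])"
        unfolding c_def d replicate_add by simp
      then have "prefix ((\<eta> @ replicate i False) @ [False]) (c j)" by (rule prefixI)
      then have "prefix ((\<eta> @ replicate i False) @ [False]) \<eta>'" using that prefix_order.trans by blast
      from clash_sym[OF inc[OF this]] show ?thesis by (simp add: c_def)
    qed
    note prems = Suc.prems[unfolded on_tree_def, THEN conjunct2]
    note on = prems[THEN conjunct1] prems[THEN conjunct2, THEN conjunct1] prems[THEN conjunct2, THEN conjunct2]
    have "on_tree k n \<Phi> t (c j) (Suc m) ?z"
      unfolding on_tree_def
    proof (intro conjI allI impI)
      show "length ?z = Suc m * (n + n)" using l len by simp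
    next
      fix i' assume "i' < Suc m"
      show "\<exists>j'\<le>length (c j). drop n (blk (n + n) i' ?z) = t (take j' (c j))"
      proof (cases "i' = m")
        case True
        then show ?thesis using new len by (intro exI[of _ "length (c j)"]) simp
      next
        case False
        then have "i' < m" using \<open>i' < Suc m\<close> by simp
        then obtain j' where j': "j' \<le> length \<eta>" "drop n (blk (n + n) i' z) = t (take j' \<eta>)" using on(1) by blast
        have "take j' (c j) = take j' \<eta>" using j'(1) by (simp add: c_def)
        then show ?thesis using j' old[OF \<open>i' < m\<close>] by (intro exI[of _ j']) (simp add: c_def)
      qed
    next
      fix i' \<eta>' assume "i' < Suc m" and p: "prefix (c j) \<eta>'"
      show "clash k \<Phi> (take n (blk (n + n) i' ?z)) (t \<eta>')"
      proof (cases "i' = m")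
        case True
        then show ?thesis using new len ej[OF p] by simp
      next
        case False
        then have "i' < m" using \<open>i' < Suc m\<close> by simp
        have "prefix \<eta> \<eta>'" using pre[of j] p prefix_order.trans by blast
        then show ?thesis using on(2) \<open>i' < m\<close> old[OF \<open>i' < m\<close>] by simp
      qed
    next
      fix j' i' assume "j' < Suc m" and i': "i' < j'"
      show "clash k \<Phi> (take n (blk (n + n) i' ?z)) (take n (blk (n + n) j' ?z))"
      proof (cases "j' = m")
        case True
        then show ?thesis using on(2) pre[of i] i' old[of i'] new len by simp
      next
        case False
        then have "j' < m" using \<open>j' < Suc m\<close> by simp
        then show ?thesis using on(3) i' old[of i'] old[of j'] by simp
      qed
    qed
    from Suc.IH[OF this] show ?thesis using w[of i] w[of j] i j by simp
  qed
  then show ?case using lw by (intro game.simps(2)[THEN iffD2] exI[of _ ?w]) simp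
qed

text \<open>Each pair is chosen with equal types over the Skolem hull of all earlier pairs. The
  union of these hulls is the model; a finite part of it lies in one of them, and from that stage on
  the two sequences agree over it.\<close>

lemma coheir_sequences:
  assumes \<Phi>: "dfn {} (k + n) \<Phi>" and game: "\<And>N h. game k n \<Phi> N h 0 []"
  shows "\<exists>M (e :: nat \<Rightarrow> 'm list) f. closed M \<and> small M
    \<and> (\<forall>i. length (e i) = n \<and> length (f i) = n \<and> set (e i) \<subseteq> M \<and> set (f i) \<subseteq> M)
    \<and> (\<forall>ys. set ys \<subseteq> M \<longrightarrow> (\<exists>i0. \<forall>i\<ge>i0. eqt (set ys) (e i) (f i)))
    \<and> (\<forall>N. \<exists>x. length x = k \<and> (\<forall>i<N. \<Phi> (x @ f i))) \<and> (\<forall>i j. i < j \<longrightarrow> clash k \<Phi> (e i) (e j))"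
proof -
  define good where "good m z \<longleftrightarrow> length z = m * (n + n) \<and> (\<forall>N h. game k n \<Phi> N h m z)" for m z
  define zz where "zz l = concat (map (\<lambda>(e, f). e @ f) l)" for l :: "('m list \<times> 'm list) list"
  let ?P = "\<lambda>l p. good (length l) (zz l) \<longrightarrow> length (fst p) = n \<and> length (snd p) = n
      \<and> eqt (hull (set (zz l))) (fst p) (snd p) \<and> good (Suc (length l)) (zz l @ fst p @ snd p)"
  have "\<exists>p. ?P l p" for l
  proof (cases "good (length l) (zz l)")
    case True
    then have z: "length (zz l) = length l * (n + n)" "\<And>N h. game k n \<Phi> N h (length l) (zz l)"
      unfolding good_def by simp_all
    have "small (hull (set (zz l)))" by (intro small_hull small_finite) simp
    from game_step[OF \<Phi> this z] obtain e f where ef: "length e = n" "length f = n" "eqt (hull (set (zz l))) e f"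
      "\<forall>N h. game k n \<Phi> N h (Suc (length l)) (zz l @ e @ f)" by (elim exE conjE)
    then show ?thesis using z(1) unfolding good_def by (intro exI[of _ "(e, f)"]) simp
  qed simp
  from exists_seq[of ?P, OF this] obtain p where p: "\<forall>i. ?P (map p [0..<i]) (p i)" ..
  define e where "e = fst \<circ> p"
  define f where "f = snd \<circ> p"
  define Z where "Z i = zz (map p [0..<i])" for i
  have Z_Suc: "Z (Suc i) = Z i @ e i @ f i" for i by (simp add: Z_def zz_def e_def f_def case_prod_beta)
  have good: "good i (Z i)" for i
  proof (induction i)
    case 0 then show ?case using game by (simp add: good_def Z_def zz_def)
  next
    case (Suc i)
    then show ?case using p[THEN spec, of i] unfolding Z_Suc by (simp add: Z_def e_def f_def)
  qed
  have props: "length (e i) = n" "length (f i) = n" "eqt (hull (set (Z i))) (e i) (f i)" for i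
    using p[THEN spec, of i] good[of i] by (simp_all add: Z_def e_def f_def)
  define H where "H i = hull (set (Z i))" for i
  have mono: "mono H"
    unfolding mono_iff_le_Suc H_def by (intro allI hull_mono) (simp add: Z_Suc)
  define M where "M = (\<Union>i. H i)"
  have "closed M"
    unfolding M_def
  proof (rule closed_UN[OF mono])
    fix i Q y assume "dfn (H i) 1 Q" "Q [y]"
    then have "\<exists>y\<in>H i. Q [y]" unfolding H_def by (rule closedD[OF closed_hull])
    then show "\<exists>y\<in>\<Union>i. H i. Q [y]" by (rule bexE) (rule bexI, assumption, blast)
  qed
  moreover have "small M" unfolding M_def H_def by (intro small_countable_UN small_hull small_finite) simp
  moreover have "set (e i) \<subseteq> M" "set (f i) \<subseteq> M" for i
  proof -
    have "set (Z (Suc i)) \<subseteq> H (Suc i)" unfolding H_def by (rule hull_superset)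
    then show "set (e i) \<subseteq> M" "set (f i) \<subseteq> M" unfolding Z_Suc M_def by auto
  qed
  moreover have "\<exists>i0. \<forall>i\<ge>i0. eqt (set ys) (e i) (f i)" if "set ys \<subseteq> M" for ys
  proof -
    have "\<exists>i0. set ys \<subseteq> H i0"
      using that
    proof (induction ys)
      case (Cons y ys)
      then obtain i1 i2 where "set ys \<subseteq> H i1" "y \<in> H i2" unfolding M_def by auto
      moreover have "H i1 \<subseteq> H (max i1 i2)" "H i2 \<subseteq> H (max i1 i2)" using mono by (auto simp: mono_def)
      ultimately have "set (y # ys) \<subseteq> H (max i1 i2)" by auto
      then show ?case by (rule exI)
    qed simp
    then obtain i0 where i0: "set ys \<subseteq> H i0" ..
    have "eqt (set ys) (e i) (f i)" if "i0 \<le> i" for i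
    proof (rule eqt_mono[OF props(3)])
      show "set ys \<subseteq> hull (set (Z i))" using i0 monoD[OF mono that] unfolding H_def by auto
    qed
    then show ?thesis by blast
  qed
  moreover have base: "base k n \<Phi> i (Z i)" for i
    using good[of i] game.simps(1)[of k n \<Phi> 0 i "Z i"] unfolding good_def by blast
  have lZ: "length (Z i) = i * (n + n)" for i using good[of i] by (simp add: good_def)
  have blkZ: "blk (n + n) i (Z N) = e i @ f i" if "i < N" for i N
    using that
  proof (induction N)
    case (Suc N)
    show ?case
    proof (cases "i = N")
      case True
      then show ?thesis unfolding Z_Suc using blk_append_last[OF lZ] props(1,2) by simp
    next
      case False
      then have "i < N" using Suc.prems by simp
      then show ?thesis unfolding Z_Suc using blk_append[OF \<open>i < N\<close> lZ] Suc.IH by simp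
    qed
  qed simp
  moreover have "\<exists>x. length x = k \<and> (\<forall>i<N. \<Phi> (x @ f i))" for N
  proof -
    obtain x where x: "length x = k" "\<forall>i\<in>{..<N}. \<Phi> (x @ drop n (blk (n + n) i (Z N)))"
      using base[of N] unfolding base_def by (elim exE conjE)
    then show ?thesis using blkZ props(1) by (intro exI[of _ x]) simp
  qed
  moreover have "clash k \<Phi> (e i) (e j)" if "i < j" for i j
  proof -
    have "\<forall>j'\<in>{..<Suc j}. \<forall>i\<in>{..<j'}. clash k \<Phi> (take n (blk (n + n) i (Z (Suc j)))) (take n (blk (n + n) j' (Z (Suc j))))"
      using base[of "Suc j"] unfolding base_def by (elim conjE)
    then have "clash k \<Phi> (take n (blk (n + n) i (Z (Suc j)))) (take n (blk (n + n) j (Z (Suc j))))"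
      using that by simp
    then show ?thesis using blkZ[of i "Suc j"] blkZ[of j "Suc j"] that props(1) by simp
  qed
  ultimately show ?thesis using props(1,2)
    by (intro exI[of _ M] exI[of _ e] exI[of _ f] conjI allI impI) simp_all
qed

lemma sop1_tree:
  assumes "sop1 L S"
  shows "\<exists>k n \<Phi>. dfn {} (k + n) \<Phi> \<and> (\<forall>N h. game k n \<Phi> N h 0 [])"
proof -
  obtain k n :: nat and \<phi> and b :: "bool list \<Rightarrow> nat \<Rightarrow> 'm" where \<phi>: "\<phi> \<in> fms L ({..<k} <+> {..<n})"
    and con: "\<forall>\<sigma> :: nat \<Rightarrow> bool. consistent S (range (\<lambda>l. inst (b (map \<sigma> [0..<l])) \<phi>))"
    and inc: "\<forall>\<eta>1 \<eta>2. prefix (\<eta>1 @ [False]) \<eta>2 \<longrightarrow> \<not> consistent S {inst (b \<eta>2) \<phi>, inst (b (\<eta>1 @ [True])) \<phi>}"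
    using assms unfolding sop1_def by (elim exE bexE conjE)
  have "\<phi> \<in> fms L (set [0..<k] <+> {..<n})" using \<phi> by (simp add: atLeast0LessThan)
  from dfn_rep_pair[OF this distinct_upt] obtain \<Phi> where \<Phi>: "dfn {} (k + n) \<Phi>"
    and rep: "\<forall>a y. holds S (case_sum a y) \<phi> = \<Phi> (map a [0..<k] @ map y [0..<n])" by auto
  define t where "t \<eta> = map (b \<eta>) [0..<n]" for \<eta>
  have 1: "\<exists>x. length x = k \<and> (\<forall>i<l. \<Phi> (x @ t (map \<sigma> [0..<i])))" for \<sigma> l
    using con[THEN spec, of \<sigma>] unfolding consistent_iff[OF rep[THEN spec, THEN spec] distinct_upt] t_def by simp
  have 2: "clash k \<Phi> (t \<eta>2) (t (\<eta>1 @ [True]))" if "prefix (\<eta>1 @ [False]) \<eta>2" for \<eta>1 \<eta>2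
  proof (rule ccontr)
    assume "\<not> clash k \<Phi> (t \<eta>2) (t (\<eta>1 @ [True]))"
    then obtain x where x: "length x = k" "\<Phi> (x @ t \<eta>2)" "\<Phi> (x @ t (\<eta>1 @ [True]))" unfolding clash_def by blast
    have "map (nth x) [0..<k] = x" using x(1) map_nth[of x] by simp
    then have "holds S (case_sum (nth x) id) (inst (b \<eta>2) \<phi>)" "holds S (case_sum (nth x) id) (inst (b (\<eta>1 @ [True])) \<phi>)"
      using x(2,3) rep unfolding holds_inst t_def by simp_all
    then have "consistent S {inst (b \<eta>2) \<phi>, inst (b (\<eta>1 @ [True])) \<phi>}"
      unfolding consistent_def realizes_def by (intro allI impI exI[of _ "nth x"]) blast
    with inc that show False by blast
  qed
  have "on_tree k n \<Phi> t [] 0 []" by (simp add: on_tree_def)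
  from on_tree_game[OF 1 _ 2 this] have "game k n \<Phi> N h 0 []" for N h by (simp add: t_def)
  with \<Phi> show ?thesis by blast
qed

section \<open>From the half graph to a relation without 3-cycles\<close>

text \<open>Compactness gives solutions \<open>a i\<close> of \<open>\<Phi>\<close> at every
  \<open>c j\<close> with \<open>j < i\<close> and every \<open>d j\<close> with
  \<open>j \<ge> i\<close>. The relation lives on the triples \<open>(a i, c i, d i)\<close>, so
  that consistency and inconsistency of instances both become conditions on pairs of
  triples.\<close>

lemma sop3I:
  fixes c d :: "nat \<Rightarrow> 'm list"
  assumes \<Phi>: "dfn {} (k + n) \<Phi>"
    and len: "\<And>i. length (c i) = n" "\<And>i. length (d i) = n"
    and con: "\<And>i N. \<exists>x. length x = k \<and> (\<forall>j<i. \<Phi> (x @ c j)) \<and> (\<forall>j. i \<le> j \<and> j < N \<longrightarrow> \<Phi> (x @ d j))"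
    and inc: "\<And>i j. j \<le> i \<Longrightarrow> \<nexists>x. length x = k \<and> \<Phi> (x @ c i) \<and> \<Phi> (x @ d j)"
  shows "sop3 L S"
proof -
  have "\<exists>x. length x = k \<and> (\<forall>j<i. \<Phi> (x @ c j)) \<and> (\<forall>j\<ge>i. \<Phi> (x @ d j))" for i
  proof -
    let ?A = "\<Union>j. set (c j @ d j)"
    let ?Q = "\<lambda>j x. \<Phi> (x @ (if j < i then c j else d j))"
    have sm: "small ?A" by (rule small_countable_UN, rule small_finite) simp
    have "\<exists>x. length x = k \<and> (\<forall>j\<in>UNIV. ?Q j x)"
    proof (rule saturation_family[OF sm])
      fix j
      show "dfn ?A k (?Q j)"
      proof (rule dfn_sub[OF \<Phi> sub_append[OF sub_id sub_const]])
        show "set (if j < i then c j else d j) \<subseteq> ?A" by auto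
      qed (simp_all add: len)
    next
      fix J :: "nat set" assume "finite J"
      then obtain N where N: "\<forall>j\<in>J. j < N" using finite_nat_set_iff_bounded by blast
      obtain x where "length x = k" "\<forall>j<i. \<Phi> (x @ c j)" "\<forall>j. i \<le> j \<and> j < N \<longrightarrow> \<Phi> (x @ d j)"
        using con[of i N] by (elim exE conjE)
      then show "\<exists>x. length x = k \<and> (\<forall>j\<in>J. ?Q j x)" using N by (intro exI[of _ x]) auto
    qed
    then obtain x where x: "length x = k" "\<forall>j. ?Q j x" by auto
    have "\<Phi> (x @ c j)" if "j < i" for j using x(2)[THEN spec, of j] that by simp
    moreover have "\<Phi> (x @ d j)" if "i \<le> j" for j using x(2)[THEN spec, of j] that by simp
    ultimately show ?thesis using x(1) by blast
  qed
  then have "\<forall>i. \<exists>x. length x = k \<and> (\<forall>j<i. \<Phi> (x @ c j)) \<and> (\<forall>j\<ge>i. \<Phi> (x @ d j))" ..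
  from choice[OF this] obtain a where a: "\<And>i. length (a i) = k" "\<And>i j. j < i \<Longrightarrow> \<Phi> (a i @ c j)"
    "\<And>i j. i \<le> j \<Longrightarrow> \<Phi> (a i @ d j)" by blast
  let ?K = "k + (n + n)"
  define E where "E i = a i @ c i @ d i" for i
  define fa where "fa z = take k z" for z :: "'m list"
  define fc where "fc z = take n (drop k z)" for z :: "'m list"
  define fd where "fd z = drop (k + n) z" for z :: "'m list"
  \<comment> \<open>For the triples with indices \<open>i < j\<close>: \<open>a j\<close> solves at
    the earlier \<open>c i\<close>, \<open>a i\<close> solves at the later \<open>d j\<close>, and
    the later \<open>c j\<close> contradicts the earlier \<open>d i\<close>.\<close>
  define \<rho> where "\<rho> z z' \<longleftrightarrow> \<Phi> (fa z' @ fc z) \<and> \<Phi> (fa z @ fd z') \<and> clash k \<Phi> (fc z') (fd z)" for z z'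
  have sf: "sub {} ?K k fa" "sub {} ?K n fc" "sub {} ?K n fd"
    unfolding fa_def fc_def fd_def by (intro sub_take sub_mid sub_drop; simp)+
  have s1: "sub {} (?K + ?K) ?K (take ?K)" and s2: "sub {} (?K + ?K) ?K (drop ?K)"
    by (intro sub_take sub_drop; simp)+
  have "dfn {} (length [0..<?K] + ?K) (\<lambda>z. \<rho> (take ?K z) (drop ?K z))"
  proof -
    have "dfn {} (?K + ?K) (\<lambda>z. \<Phi> (fa (drop ?K z) @ fc (take ?K z)))"
      by (rule dfn_sub[OF \<Phi> sub_append[OF sub_comp[OF s2 sf(1)] sub_comp[OF s1 sf(2)]]]) simp
    moreover have "dfn {} (?K + ?K) (\<lambda>z. \<Phi> (fa (take ?K z) @ fd (drop ?K z)))"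
      by (rule dfn_sub[OF \<Phi> sub_append[OF sub_comp[OF s1 sf(1)] sub_comp[OF s2 sf(3)]]]) simp
    moreover have "dfn {} (?K + ?K) (\<lambda>z. clash k \<Phi> (fc (drop ?K z)) (fd (take ?K z)))"
      by (rule dfn_clash[OF \<Phi> sub_comp[OF s2 sf(2)] sub_comp[OF s1 sf(3)]])
    ultimately show ?thesis unfolding \<rho>_def length_upt diff_zero by (intro dfn_conj)
  qed
  from dfn_rep2[OF this] obtain \<phi> where \<phi>: "\<phi> \<in> fms L (set [0..<?K] <+> {..<?K})"
    "\<forall>x y. \<rho> (take ?K (map x [0..<?K] @ map y [0..<?K])) (drop ?K (map x [0..<?K] @ map y [0..<?K]))
       = holds S (case_sum x y) \<phi>" ..
  have \<phi>1: "\<phi> \<in> fms L ({..<?K} <+> {..<?K})" using \<phi>(1) by (simp add: atLeast0LessThan)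
  have \<phi>2: "holds S (case_sum x y) \<phi> \<longleftrightarrow> \<rho> (map x [0..<?K]) (map y [0..<?K])" for x y
    using \<phi>(2)[THEN spec, THEN spec, of x y] by simp
  have cycle: "\<not> (\<rho> x y \<and> \<rho> y z \<and> \<rho> z x)" if "length y = ?K" for x y z
    \<comment> \<open>the component \<open>fa y\<close> would realize \<open>\<Phi>\<close> at both \<open>fc x\<close> and \<open>fd z\<close>\<close>
    using that unfolding \<rho>_def clash_def fa_def by auto
  have chain: "\<rho> (E i) (E j)" if "i < j" for i j
  proof -
    have f: "fa (E i) = a i" "fc (E i) = c i" "fd (E i) = d i" for i
      using a(1) len by (simp_all add: E_def fa_def fc_def fd_def)
    show ?thesis unfolding \<rho>_def f clash_def using a(2)[OF that] a(3)[of i j] inc[of i j] that by simp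
  qed
  show ?thesis
    unfolding sop3_def Let_def
  proof (intro exI[of _ ?K] bexI[OF _ \<phi>1] conjI)
    show "\<nexists>x y z. holds S (case_sum x y) \<phi> \<and> holds S (case_sum y z) \<phi> \<and> holds S (case_sum z x) \<phi>"
      unfolding \<phi>2 using cycle[of "map _ [0..<?K]"] by (metis length_map length_upt diff_zero)
    show "\<exists>a :: nat \<Rightarrow> nat \<Rightarrow> 'm. \<forall>i j. i < j \<longrightarrow> holds S (case_sum (a i) (a j)) \<phi>"
    proof (intro exI[of _ "\<lambda>i. nth (E i)"] allI impI)
      fix i j :: nat assume "i < j"
      have "map (nth (E i)) [0..<?K] = E i" for i
      proof -
        have "length (E i) = ?K" using a(1) len by (simp add: E_def)
        then show ?thesis using map_nth[of "E i"] by simp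
      qed
      then show "holds S (case_sum (nth (E i)) (nth (E j))) \<phi>" unfolding \<phi>2 using chain[OF \<open>i < j\<close>] by simp
    qed
  qed
qed

lemma sop1_imp_sop3:
  assumes sw: "strong_witnessing L \<kappa> S" and sym: "conant_symmetric L \<kappa> S" and sop1: "sop1 L S"
  shows "sop3 L S"
proof -
  from sop1_tree[OF sop1] obtain k n \<Phi> where \<Phi>: "dfn {} (k + n) \<Phi>" and game: "\<forall>N h. game k n \<Phi> N h 0 []"
    by (elim exE conjE)
  obtain M and e f :: "nat \<Rightarrow> 'm list" where M: "closed M" "small M"
    and ef: "\<forall>i. length (e i) = n \<and> length (f i) = n \<and> set (e i) \<subseteq> M \<and> set (f i) \<subseteq> M"
    and eq: "\<forall>ys. set ys \<subseteq> M \<longrightarrow> (\<exists>i0. \<forall>i\<ge>i0. eqt (set ys) (e i) (f i))"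
    and con: "\<forall>N. \<exists>x. length x = k \<and> (\<forall>i<N. \<Phi> (x @ f i))" and inc: "\<forall>i j. i < j \<longrightarrow> clash k \<Phi> (e i) (e j)"
    using coheir_sequences[OF \<Phi> game[THEN spec, THEN spec]] by (elim exE conjE)
  \<comment> \<open>The ultrafilter must contain all tails, so that what holds eventually along the
    sequences holds in the averages.\<close>
  have "fip (range (\<lambda>i::nat. {i..}))"
    unfolding fip_def
  proof (intro allI impI)
    fix G assume "G \<subseteq> range (\<lambda>i::nat. {i..})" "finite G"
    then obtain I where I: "finite I" "G = (\<lambda>i::nat. {i..}) ` I" by (meson finite_subset_image)
    then obtain N where "\<forall>i\<in>I. i < N" using finite_nat_set_iff_bounded by blast
    then have "N \<in> \<Inter>G" using I(2) by auto
    then show "\<Inter>G \<noteq> {}" by blast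
  qed
  from ultra_extends[OF this] obtain U where U: "ultra U" "range (\<lambda>i::nat. {i..}) \<subseteq> U" by (elim exE conjE)
  have tail: "X \<in> U" if "{i..} \<subseteq> X" for i X
    by (rule ultra_mono[OF U(1) _ that]) (use U(2) in auto)
  let ?p = "avg U e" and ?q = "avg U f"
  have p: "inv_type M n ?p" by (rule inv_avg[OF U(1)]) (use ef in simp_all)
  have q: "inv_type M n ?q" by (rule inv_avg[OF U(1)]) (use ef in simp_all)
  have pq: "?p Q = ?q Q" if "dfn M n Q" for Q
  proof -
    have "dfn ({} \<union> M) n Q" using that by simp
    from dfn_finite[OF this] obtain ys where ys: "set ys \<subseteq> M" "dfn (set ys) n Q" by auto
    obtain i0 where i0: "\<forall>i\<ge>i0. eqt (set ys) (e i) (f i)" using eq ys(1) by blast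
    have same: "Q (e i) = Q (f i)" if "i0 \<le> i" for i
      using eqtD[OF i0[THEN spec[of _ i], THEN mp, OF that], of Q] ys(2) ef by simp
    have t: "{i0..} \<in> U" by (rule tail[of i0]) simp
    have "i \<in> {i. Q (e i)} \<inter> {i0..} \<longleftrightarrow> i \<in> {i. Q (f i)} \<inter> {i0..}" for i using same[of i] by auto
    then have "{i. Q (e i)} \<inter> {i0..} = {i. Q (f i)} \<inter> {i0..}" by (rule set_eqI)
    then have "{i. Q (e i)} \<inter> {i0..} \<in> U \<longleftrightarrow> {i. Q (f i)} \<inter> {i0..} \<in> U" by (simp only:)
    then show ?thesis unfolding avg_def ultra_Int[OF U(1)] using t by simp
  qed
  \<comment> \<open>Consistency is known along \<open>?q\<close>, contradiction along
    \<open>?p\<close>; as the two agree over \<open>M\<close>, a realization \<open>b\<close> of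
    \<open>?p\<close> over \<open>M\<close> also realizes \<open>?q\<close>.\<close>
  have cp: "CP M n ?q k \<Phi>" by (rule CP_avg[OF U(1) _ _ \<Phi>]) (use ef con in simp_all)
  obtain b where b: "realizer ?p n M b" using real_exists[OF p M(2)] ..
  have lb: "length b = n" by (rule real_length[OF b])
  have bq: "realizer ?q n M b"
  proof (rule realI[OF lb])
    fix Q assume Q: "dfn M n Q" "?q Q"
    then have "?p Q" using pq by simp
    from realD[OF b Q(1) this] show "Q b" .
  qed
  have "small (M \<union> set b)" by (intro small_Un M(2) small_finite) simp
  from real_exists[OF p this] obtain b' where b': "realizer ?p n (M \<union> set b) b'" ..
  have bb': "eqt M b b'" by (rule real_eqt0[OF p b]) (rule real_mono[OF b'], simp)
  \<comment> \<open>The average is taken twice: \<open>e i\<close> contradicts all later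
    \<open>e j\<close>, hence contradicts \<open>b\<close>; as this holds for every
    \<open>i\<close>, also \<open>b'\<close>, which realizes \<open>?p\<close> over
    \<open>b\<close>, contradicts \<open>b\<close>.\<close>
  have clash: "clash k \<Phi> b' b"
  proof -
    have 1: "clash k \<Phi> (e i) b" for i
    proof -
      have "dfn M n (\<lambda>y. clash k \<Phi> (e i) y)"
        by (rule dfn_clash[OF \<Phi> sub_const sub_id]) (use ef in simp_all)
      moreover have "?p (\<lambda>y. clash k \<Phi> (e i) y)"
        unfolding avg_def by (rule tail[of "Suc i"]) (use inc in auto)
      ultimately show ?thesis by (rule realD[OF b])
    qed
    have "dfn (M \<union> set b) n (\<lambda>y. clash k \<Phi> y b)"
      by (rule dfn_clash[OF \<Phi> sub_id sub_const]) (use lb in simp_all)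
    moreover have "?p (\<lambda>y. clash k \<Phi> y b)"
      unfolding avg_def by (rule tail[of 0]) (use 1 in auto)
    ultimately show ?thesis by (rule realD[OF b'])
  qed
  have elem: "elem_sub L S M" by (rule closed_elem_sub[OF M(1)])
  from witness_exists[OF elem M(2) sw] obtain r where "witness L \<kappa> S M r" ..
  then interpret witness L \<kappa> S M r .
  interpret sym_witness L \<kappa> S M r by (rule sym_witnessI[OF sym elem])
  have \<Phi>b: "dfn {} (k + length b) \<Phi>" "dfn M (k + length b) \<Phi>" using \<Phi> dfn_mono[OF \<Phi>, of M] lb by simp_all
  \<comment> \<open>Leastness is applied to the second coheir, so \<open>\<Phi>\<close> at
    \<open>b\<close> does not Conant-divide and has a realization independent of
    \<open>b\<close>.\<close>
  have cpr: "CPr b k \<Phi>" by (rule least[OF _ _ \<Phi>b(2)]) (use q bq cp lb in simp_all)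
  have "\<exists>x. length x = k \<and> (\<forall>i\<in>{()}. \<Phi> (x @ b)) \<and> ind (x @ []) b"
    by (rule ind_extend[OF ind_Nil, where R = "\<lambda>_. \<Phi>"]) (use \<Phi>b(2) CP_mono[OF cpr] in simp_all)
  then obtain a where a: "length a = k" "\<Phi> (a @ b)" "ind a b" by auto
  have "ind ([] @ b') b" by (rule ind_inv[OF ind_Nil p]) (use b' in simp)
  then have "ind b' b" by simp
  from half_graph[OF \<Phi>b(1) a bb' this clash[unfolded clash_def]] obtain c d :: "nat \<Rightarrow> 'm list" where
    cd: "\<forall>i. length (c i) = length b \<and> length (d i) = length b"
      "\<forall>i N. \<exists>x. length x = k \<and> (\<forall>j<i. \<Phi> (x @ c j)) \<and> (\<forall>j. i \<le> j \<and> j < N \<longrightarrow> \<Phi> (x @ d j))"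
      "\<forall>i j. j \<le> i \<longrightarrow> (\<nexists>x. length x = k \<and> \<Phi> (x @ c i) \<and> \<Phi> (x @ d j))" by (elim exE conjE)
  show ?thesis by (rule sop3I[where c = c and d = d, OF \<Phi>b(1)]) (use cd in simp_all)
qed

end

theorem theorem3p18:
  fixes L :: "('f, 'r) lang"
    and T :: "('f, 'r, nat) fm set"
    and \<kappa> :: "'k rel"
    and \<MM> :: "('f, 'r, 'm) interp"
  assumes "complete_theory L T"
    and "monster_model L T \<kappa> \<MM>"
    and "strong_witnessing L \<kappa> \<MM>"
    and "conant_symmetric L \<kappa> \<MM>"
  shows "\<not> sop1 L \<MM> \<or> sop3 L \<MM>"
proof -
  interpret monster L \<kappa> \<MM>
    using assms(2) by unfold_locales (simp_all add: monster_model_def)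
  show ?thesis using sop1_imp_sop3[OF assms(3,4)] by blast
qed

end
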